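(* Let $M$ be a $2n$-dimensional smooth manifold with an almost complex structure $J$ (not necessarily integrable) and a compatible Riemannian metric. Then the following identity of operators on (sections of) the complexified Clifford bundle $\mathbb{C}\mathrm{l}(M)$ holds: $$[D, \mathcal H] = -i D^c +i D_\sigma - i L_{D\omega}.$$
   Context: $J^2=-I$ and $\langle JX,JY\rangle=\langle X,Y\rangle$. $\mathrm{Cl}(M)$ is the Clifford bundle of $TM$ with convention $X\cdot Y+Y\cdot X=-2\langle X,Y\rangle$ for $X,Y\in TM$, and $\mathbb{C}\mathrm{l}(M)$ is its complexification; the same symbols denote the spaces of smooth sections. $\nabla$ is the Levi-Civita connection, extended to $\mathbb{C}\mathrm{l}(M)$ as a derivation. $J$ is extended complex-linearly to $T_{\mathbb C}M$, and then to $\mathbb{C}\mathrm{l}(M)$ in two ways: as a derivation $J_d$ ($J_d(X\cdot Y)=JX\cdot Y+X\cdot JY$ for vectors, zero on scalars) and as an algebra map $J_a$ ($J_a(X\cdot Y)=JX\cdot JY$ for vectors, identity on scalars). $\{e_A\}_{A=1}^{2n}$ is a local orthonormal frame with $Je_i=e_{i+n}$ for $1\le i\le n$. $\omega=\sum_{i=1}^n e_i\cdot e_{i+n}\in\mathrm{Cl}(M)$ (the Clifford element corresponding to the fundamental form $\omega(X,Y)=\langle JX,Y\rangle$). The Dirac operator is $DX=\sum_{A=1}^{2n}e_A\cdot\nabla_{e_A}X$. $\mathcal H(X)=\frac{1}{2i}(\omega\cdot X+X\cdot\omega)$. $L_X(Y)=X\cdot Y$ for $X,Y\in\mathbb{C}\mathrm{l}(M)$.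 For an operator $P$ on $\mathbb{C}\mathrm{l}(M)$, $P^c=J_a^{-1}\circ P\circ J_a$. For $X\in T_{\mathbb C}M$, $\sigma_X=\nabla_XJ_d+J_a^{-1}\circ(\nabla_{JX}J_a)$, where $(\nabla_XJ_d)(Y)=\nabla_X(J_dY)-J_d\nabla_XY$ and similarly for $J_a$. $D_\sigma(Y)=\sum_{A=1}^{2n}e_A\cdot\sigma_{e_A}(Y)$. $[D,\mathcal H]=D\mathcal H-\mathcal HD$. *)

theory Defs
  imports
    "HOL-Analysis.Analysis"
    "HOL-Algebra.QuotRing"
    "HOL-Algebra.Module"
    "HOL-Library.Function_Algebras"
begin

section \<open>Functions into a vector space\<close>

instantiation "fun" :: (type, real_vector) real_vector
begin

definition scaleR_fun :: "real \<Rightarrow> ('a \<Rightarrow> 'b) \<Rightarrow> 'a \<Rightarrow> 'b" where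
  "scaleR_fun a f = (\<lambda>x. a *\<^sub>R f x)"

instance
  by standard (auto simp: scaleR_fun_def fun_eq_iff scaleR_add_right scaleR_add_left)

end

section \<open>Smooth manifolds\<close>

primrec C_k_on ::
  "nat \<Rightarrow> 'a::real_normed_vector set \<Rightarrow> ('a \<Rightarrow> 'b::real_normed_vector) \<Rightarrow> bool" where
  "C_k_on 0 S f \<longleftrightarrow> continuous_on S f"
| "C_k_on (Suc k) S f \<longleftrightarrow>
     (\<forall>x\<in>S. f differentiable (at x)) \<and>
     (\<forall>v. C_k_on k S (\<lambda>x. frechet_derivative f (at x) v))"

text \<open>Only used for open sets in Euclidean spaces, where the existence and continuity of all
  iterated directional derivatives is the usual notion.\<close>

definition smooth_on :: "'a::real_normed_vector set \<Rightarrow> ('a \<Rightarrow> 'b::real_normed_vector) \<Rightarrow> bool" where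
  "smooth_on S f \<longleftrightarrow> (\<forall>k. C_k_on k S f)"

text \<open>A chart is its domain together with the coordinate map; the values of the latter outside
  of the domain are irrelevant.\<close>

type_synonym ('m, 'e) chart = "'m set \<times> ('m \<Rightarrow> 'e)"

definition is_chart :: "('m::topological_space, 'e::euclidean_space) chart \<Rightarrow> bool" where
  "is_chart c \<longleftrightarrow> open (fst c) \<and> open (snd c ` fst c) \<and>
     (\<exists>\<psi>. homeomorphism (fst c) (snd c ` fst c) (snd c) \<psi>)"

definition chart_inv :: "('m, 'e) chart \<Rightarrow> 'e \<Rightarrow> 'm" where
  "chart_inv c = inv_into (fst c) (snd c)"

definition smooth_atlas :: "('m::topological_space, 'e::euclidean_space) chart set \<Rightarrow> bool" where
  "smooth_atlas \<A> \<longleftrightarrow>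
     (\<forall>c\<in>\<A>. is_chart c) \<and>
     (\<Union>c\<in>\<A>. fst c) = UNIV \<and>
     (\<forall>c\<in>\<A>. \<forall>d\<in>\<A>. smooth_on (snd c ` (fst c \<inter> fst d)) (snd d \<circ> chart_inv c))"

definition smooth_fun ::
  "('m::topological_space, 'e::euclidean_space) chart set \<Rightarrow> 'm set \<Rightarrow>
   ('m \<Rightarrow> 'b::real_normed_vector) \<Rightarrow> bool" where
  "smooth_fun \<A> U f \<longleftrightarrow> (\<forall>c\<in>\<A>. smooth_on (snd c ` (U \<inter> fst c)) (f \<circ> chart_inv c))"

text \<open>A tangent vector at \<open>p\<close> is an equivalence class of pairs (chart around \<open>p\<close>, coordinate
  vector), where vectors are identified by the derivatives of the transition maps.  The class is
  stored as the map sending each chart of the atlas around \<open>p\<close> to its coordinate vector, extended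
  by zero to all other pairs.\<close>

type_synonym ('m, 'e) tvec = "('m, 'e) chart \<Rightarrow> 'e"

definition tangent_space ::
  "('m::topological_space, 'e::euclidean_space) chart set \<Rightarrow> 'm \<Rightarrow> ('m, 'e) tvec set" where
  "tangent_space \<A> p = {v.
     (\<forall>c\<in>\<A>. \<forall>d\<in>\<A>. p \<in> fst c \<longrightarrow> p \<in> fst d \<longrightarrow>
        v d = frechet_derivative (snd d \<circ> chart_inv c) (at (snd c p)) (v c)) \<and>
     (\<forall>c. \<not> (c \<in> \<A> \<and> p \<in> fst c) \<longrightarrow> v c = 0)}"

text \<open>The derivative of \<open>f\<close> along \<open>v \<in> T\<^sub>pM\<close>; by the chain rule it does not depend on the chart.\<close>

definition dir_deriv ::
  "('m::topological_space, 'e::euclidean_space) chart set \<Rightarrow> 'm \<Rightarrow> ('m, 'e) tvec \<Rightarrow>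
   ('m \<Rightarrow> 'b::real_normed_vector) \<Rightarrow> 'b" where
  "dir_deriv \<A> p v f =
     (let c = (SOME c. c \<in> \<A> \<and> p \<in> fst c)
      in frechet_derivative (f \<circ> chart_inv c) (at (snd c p)) (v c))"

definition smooth_vf ::
  "('m::topological_space, 'e::euclidean_space) chart set \<Rightarrow> 'm set \<Rightarrow>
   ('m \<Rightarrow> ('m, 'e) tvec) \<Rightarrow> bool" where
  "smooth_vf \<A> U X \<longleftrightarrow>
     (\<forall>p\<in>U. X p \<in> tangent_space \<A> p) \<and>
     (\<forall>c\<in>\<A>. smooth_on (snd c ` (U \<inter> fst c)) (\<lambda>x. X (chart_inv c x) c))"

section \<open>Almost Hermitian structures and the Levi-Civita connection\<close>

definition riemannian_metric ::
  "('m::topological_space, 'e::euclidean_space) chart set \<Rightarrow>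
   ('m \<Rightarrow> ('m, 'e) tvec \<Rightarrow> ('m, 'e) tvec \<Rightarrow> real) \<Rightarrow> bool" where
  "riemannian_metric \<A> g \<longleftrightarrow>
     (\<forall>p. \<forall>u\<in>tangent_space \<A> p. \<forall>v\<in>tangent_space \<A> p.
        g p u v = g p v u \<and>
        (\<forall>w\<in>tangent_space \<A> p. g p (u + v) w = g p u w + g p v w) \<and>
        (\<forall>a. g p (a *\<^sub>R u) v = a * g p u v) \<and>
        (u \<noteq> 0 \<longrightarrow> g p u u > 0)) \<and>
     (\<forall>U X Y. open U \<longrightarrow> smooth_vf \<A> U X \<longrightarrow> smooth_vf \<A> U Y \<longrightarrow>
        smooth_fun \<A> U (\<lambda>p. g p (X p) (Y p)))"

definition almost_complex_structure ::
  "('m::topological_space, 'e::euclidean_space) chart set \<Rightarrow>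
   ('m \<Rightarrow> ('m, 'e) tvec \<Rightarrow> ('m, 'e) tvec) \<Rightarrow> bool" where
  "almost_complex_structure \<A> J \<longleftrightarrow>
     (\<forall>p. \<forall>u\<in>tangent_space \<A> p.
        J p u \<in> tangent_space \<A> p \<and>
        J p (J p u) = - u \<and>
        (\<forall>v\<in>tangent_space \<A> p. J p (u + v) = J p u + J p v) \<and>
        (\<forall>a. J p (a *\<^sub>R u) = a *\<^sub>R J p u)) \<and>
     (\<forall>U X. open U \<longrightarrow> smooth_vf \<A> U X \<longrightarrow> smooth_vf \<A> U (\<lambda>p. J p (X p)))"

definition compatible_metric ::
  "('m::topological_space, 'e::euclidean_space) chart set \<Rightarrow>
   ('m \<Rightarrow> ('m, 'e) tvec \<Rightarrow> ('m, 'e) tvec \<Rightarrow> real) \<Rightarrow>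
   ('m \<Rightarrow> ('m, 'e) tvec \<Rightarrow> ('m, 'e) tvec) \<Rightarrow> bool" where
  "compatible_metric \<A> g J \<longleftrightarrow>
     (\<forall>p. \<forall>u\<in>tangent_space \<A> p. \<forall>v\<in>tangent_space \<A> p. g p (J p u) (J p v) = g p u v)"

text \<open>In the following, \<open>nab p v Y\<close> is the covariant derivative of the section \<open>Y\<close> along
  \<open>v \<in> T\<^sub>pM\<close>.\<close>

definition affine_connection ::
  "('m::topological_space, 'e::euclidean_space) chart set \<Rightarrow>
   ('m \<Rightarrow> ('m, 'e) tvec \<Rightarrow> ('m \<Rightarrow> ('m, 'e) tvec) \<Rightarrow> ('m, 'e) tvec) \<Rightarrow> bool" where
  "affine_connection \<A> nab \<longleftrightarrow>
     (\<forall>p Y. smooth_vf \<A> UNIV Y \<longrightarrow> (\<forall>v\<in>tangent_space \<A> p.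
        nab p v Y \<in> tangent_space \<A> p \<and>
        (\<forall>w\<in>tangent_space \<A> p. nab p (v + w) Y = nab p v Y + nab p w Y) \<and>
        (\<forall>a. nab p (a *\<^sub>R v) Y = a *\<^sub>R nab p v Y) \<and>
        (\<forall>Z. smooth_vf \<A> UNIV Z \<longrightarrow> nab p v (\<lambda>q. Y q + Z q) = nab p v Y + nab p v Z) \<and>
        (\<forall>f::'m \<Rightarrow> real. smooth_fun \<A> UNIV f \<longrightarrow>
           nab p v (\<lambda>q. f q *\<^sub>R Y q) = dir_deriv \<A> p v f *\<^sub>R Y p + f p *\<^sub>R nab p v Y))) \<and>
     (\<forall>X Y. smooth_vf \<A> UNIV X \<longrightarrow> smooth_vf \<A> UNIV Y \<longrightarrow> smooth_vf \<A> UNIV (\<lambda>p. nab p (X p) Y))"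

definition metric_connection ::
  "('m::topological_space, 'e::euclidean_space) chart set \<Rightarrow>
   ('m \<Rightarrow> ('m, 'e) tvec \<Rightarrow> ('m, 'e) tvec \<Rightarrow> real) \<Rightarrow>
   ('m \<Rightarrow> ('m, 'e) tvec \<Rightarrow> ('m \<Rightarrow> ('m, 'e) tvec) \<Rightarrow> ('m, 'e) tvec) \<Rightarrow> bool" where
  "metric_connection \<A> g nab \<longleftrightarrow>
     (\<forall>p Y Z. smooth_vf \<A> UNIV Y \<longrightarrow> smooth_vf \<A> UNIV Z \<longrightarrow> (\<forall>v\<in>tangent_space \<A> p.
        dir_deriv \<A> p v (\<lambda>q. g q (Y q) (Z q)) = g p (nab p v Y) (Z p) + g p (Y p) (nab p v Z)))"

text \<open>\<open>\<nabla>\<^sub>XY - \<nabla>\<^sub>YX = [X, Y]\<close>, where \<open>[X, Y]\<close> is the vector field acting on functions as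
  \<open>f \<mapsto> X(Yf) - Y(Xf)\<close>.\<close>

definition torsion_free ::
  "('m::topological_space, 'e::euclidean_space) chart set \<Rightarrow>
   ('m \<Rightarrow> ('m, 'e) tvec \<Rightarrow> ('m \<Rightarrow> ('m, 'e) tvec) \<Rightarrow> ('m, 'e) tvec) \<Rightarrow> bool" where
  "torsion_free \<A> nab \<longleftrightarrow>
     (\<forall>p X Y. smooth_vf \<A> UNIV X \<longrightarrow> smooth_vf \<A> UNIV Y \<longrightarrow>
        (\<forall>f::'m \<Rightarrow> real. smooth_fun \<A> UNIV f \<longrightarrow>
           dir_deriv \<A> p (nab p (X p) Y - nab p (Y p) X) f =
             dir_deriv \<A> p (X p) (\<lambda>q. dir_deriv \<A> q (Y q) f) -
             dir_deriv \<A> p (Y p) (\<lambda>q. dir_deriv \<A> q (X q) f)))"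

definition levi_civita_connection ::
  "('m::topological_space, 'e::euclidean_space) chart set \<Rightarrow>
   ('m \<Rightarrow> ('m, 'e) tvec \<Rightarrow> ('m, 'e) tvec \<Rightarrow> real) \<Rightarrow>
   ('m \<Rightarrow> ('m, 'e) tvec \<Rightarrow> ('m \<Rightarrow> ('m, 'e) tvec) \<Rightarrow> ('m, 'e) tvec) \<Rightarrow> bool" where
  "levi_civita_connection \<A> g nab \<longleftrightarrow>
     affine_connection \<A> nab \<and> metric_connection \<A> g nab \<and> torsion_free \<A> nab"

section \<open>Clifford algebras\<close>

text \<open>The free unital real algebra on a set \<open>V\<close>: finitely supported functions on words over \<open>V\<close>,
  with the product extending concatenation.\<close>

definition fscalar :: "real \<Rightarrow> 'v list \<Rightarrow> real" where
  "fscalar a = (\<lambda>w. if w = [] then a else 0)"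

definition fvec :: "'v \<Rightarrow> 'v list \<Rightarrow> real" where
  "fvec v = (\<lambda>w. if w = [v] then 1 else 0)"

definition free_algebra :: "'v set \<Rightarrow> ('v list \<Rightarrow> real) ring" where
  "free_algebra V =
     \<lparr>carrier = {f. finite {w. f w \<noteq> 0} \<and> (\<forall>w. f w \<noteq> 0 \<longrightarrow> set w \<subseteq> V)},
      monoid.mult = (\<lambda>f h w. \<Sum>i\<le>length w. f (take i w) * h (drop i w)),
      one = fscalar 1, zero = (\<lambda>w. 0), add = (\<lambda>f h w. f w + h w)\<rparr>"

text \<open>The Clifford algebra of a linear subspace \<open>V\<close> with symmetric bilinear form \<open>B\<close>.  The first two
  families of relations turn the free algebra into the tensor algebra of \<open>V\<close>; the third one is
  \<open>v\<cdot>w + w\<cdot>v = -2 B(v, w)\<close>.\<close>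

definition clifford_relations ::
  "'v::real_vector set \<Rightarrow> ('v \<Rightarrow> 'v \<Rightarrow> real) \<Rightarrow> ('v list \<Rightarrow> real) set" where
  "clifford_relations V B =
     {fvec (v + w) - fvec v - fvec w | v w. v \<in> V \<and> w \<in> V} \<union>
     {fvec (a *\<^sub>R v) - a *\<^sub>R fvec v | a v. v \<in> V} \<union>
     {fvec v \<otimes>\<^bsub>free_algebra V\<^esub> fvec w + fvec w \<otimes>\<^bsub>free_algebra V\<^esub> fvec v + fscalar (2 * B v w)
        | v w. v \<in> V \<and> w \<in> V}"

definition clifford_ideal ::
  "'v::real_vector set \<Rightarrow> ('v \<Rightarrow> 'v \<Rightarrow> real) \<Rightarrow> ('v list \<Rightarrow> real) set" where
  "clifford_ideal V B = genideal (free_algebra V) (clifford_relations V B)"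

definition clifford_algebra ::
  "'v::real_vector set \<Rightarrow> ('v \<Rightarrow> 'v \<Rightarrow> real) \<Rightarrow> (real, ('v list \<Rightarrow> real) set) module" where
  "clifford_algebra V B =
     (let I = clifford_ideal V B; Q = free_algebra V Quot I in
      \<lparr>carrier = carrier Q, monoid.mult = monoid.mult Q, one = one Q, zero = zero Q, add = add Q,
       smult = (\<lambda>a x. (I +>\<^bsub>free_algebra V\<^esub> fscalar a) \<otimes>\<^bsub>Q\<^esub> x)\<rparr>)"

definition clifford_vec ::
  "'v::real_vector set \<Rightarrow> ('v \<Rightarrow> 'v \<Rightarrow> real) \<Rightarrow> 'v \<Rightarrow> ('v list \<Rightarrow> real) set" where
  "clifford_vec V B v = clifford_ideal V B +>\<^bsub>free_algebra V\<^esub> fvec v"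

text \<open>The complexification of a real algebra; the pair \<open>(x, y)\<close> stands for \<open>x + i y\<close>.\<close>

definition complexification :: "(real, 'b) module \<Rightarrow> (complex, 'b \<times> 'b) module" where
  "complexification A =
     \<lparr>carrier = carrier A \<times> carrier A,
      monoid.mult = (\<lambda>(a, b) (c, d). ((a \<otimes>\<^bsub>A\<^esub> c) \<ominus>\<^bsub>A\<^esub> (b \<otimes>\<^bsub>A\<^esub> d), (a \<otimes>\<^bsub>A\<^esub> d) \<oplus>\<^bsub>A\<^esub> (b \<otimes>\<^bsub>A\<^esub> c))),
      one = (\<one>\<^bsub>A\<^esub>, \<zero>\<^bsub>A\<^esub>), zero = (\<zero>\<^bsub>A\<^esub>, \<zero>\<^bsub>A\<^esub>),
      add = (\<lambda>(a, b) (c, d). (a \<oplus>\<^bsub>A\<^esub> c, b \<oplus>\<^bsub>A\<^esub> d)),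
      smult = (\<lambda>z (a, b). ((Re z \<odot>\<^bsub>A\<^esub> a) \<ominus>\<^bsub>A\<^esub> (Im z \<odot>\<^bsub>A\<^esub> b), (Re z \<odot>\<^bsub>A\<^esub> b) \<oplus>\<^bsub>A\<^esub> (Im z \<odot>\<^bsub>A\<^esub> a)))\<rparr>"

section \<open>The complexified Clifford bundle\<close>

type_synonym ('m, 'e) cliff = "(('m, 'e) tvec list \<Rightarrow> real) set \<times> (('m, 'e) tvec list \<Rightarrow> real) set"

definition Cl ::
  "('m::topological_space, 'e::euclidean_space) chart set \<Rightarrow>
   ('m \<Rightarrow> ('m, 'e) tvec \<Rightarrow> ('m, 'e) tvec \<Rightarrow> real) \<Rightarrow> 'm \<Rightarrow> (complex, ('m, 'e) cliff) module" where
  "Cl \<A> g p = complexification (clifford_algebra (tangent_space \<A> p) (g p))"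

definition cvec ::
  "('m::topological_space, 'e::euclidean_space) chart set \<Rightarrow>
   ('m \<Rightarrow> ('m, 'e) tvec \<Rightarrow> ('m, 'e) tvec \<Rightarrow> real) \<Rightarrow> 'm \<Rightarrow> ('m, 'e) tvec \<Rightarrow> ('m, 'e) cliff" where
  "cvec \<A> g p v =
     (clifford_vec (tangent_space \<A> p) (g p) v, \<zero>\<^bsub>clifford_algebra (tangent_space \<A> p) (g p)\<^esub>)"

text \<open>A section of the complexified Clifford bundle is smooth if it is locally a linear combination,
  with smooth complex coefficients, of Clifford products of smooth vector fields.\<close>

definition smooth_section ::
  "('m::topological_space, 'e::euclidean_space) chart set \<Rightarrow>
   ('m \<Rightarrow> ('m, 'e) tvec \<Rightarrow> ('m, 'e) tvec \<Rightarrow> real) \<Rightarrow> ('m \<Rightarrow> ('m, 'e) cliff) \<Rightarrow> bool" where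
  "smooth_section \<A> g s \<longleftrightarrow>
     (\<forall>p. s p \<in> carrier (Cl \<A> g p)) \<and>
     (\<forall>p. \<exists>U (N::nat) (f :: nat \<Rightarrow> 'm \<Rightarrow> complex) (X :: nat \<Rightarrow> ('m \<Rightarrow> ('m, 'e) tvec) list).
        open U \<and> p \<in> U \<and>
        (\<forall>k<N. smooth_fun \<A> U (f k) \<and> (\<forall>Y\<in>set (X k). smooth_vf \<A> U Y)) \<and>
        (\<forall>q\<in>U. s q =
           (\<Oplus>\<^bsub>Cl \<A> g q\<^esub>k\<in>{..<N}. f k q \<odot>\<^bsub>Cl \<A> g q\<^esub>
              foldr (\<lambda>Y x. cvec \<A> g q (Y q) \<otimes>\<^bsub>Cl \<A> g q\<^esub> x) (X k) \<one>\<^bsub>Cl \<A> g q\<^esub>)))"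

text \<open>A connection on the complexified Clifford bundle which is a derivation of the Clifford product
  and restricts to the connection \<open>nabT\<close> on tangent vectors.\<close>

definition clifford_connection ::
  "('m::topological_space, 'e::euclidean_space) chart set \<Rightarrow>
   ('m \<Rightarrow> ('m, 'e) tvec \<Rightarrow> ('m, 'e) tvec \<Rightarrow> real) \<Rightarrow>
   ('m \<Rightarrow> ('m, 'e) tvec \<Rightarrow> ('m \<Rightarrow> ('m, 'e) tvec) \<Rightarrow> ('m, 'e) tvec) \<Rightarrow>
   ('m \<Rightarrow> ('m, 'e) tvec \<Rightarrow> ('m \<Rightarrow> ('m, 'e) cliff) \<Rightarrow> ('m, 'e) cliff) \<Rightarrow> bool" where
  "clifford_connection \<A> g nabT nab \<longleftrightarrow>
     (\<forall>p s. smooth_section \<A> g s \<longrightarrow> (\<forall>v\<in>tangent_space \<A> p.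
        nab p v s \<in> carrier (Cl \<A> g p) \<and>
        (\<forall>w\<in>tangent_space \<A> p. nab p (v + w) s = nab p v s \<oplus>\<^bsub>Cl \<A> g p\<^esub> nab p w s) \<and>
        (\<forall>a. nab p (a *\<^sub>R v) s = complex_of_real a \<odot>\<^bsub>Cl \<A> g p\<^esub> nab p v s) \<and>
        (\<forall>t. smooth_section \<A> g t \<longrightarrow>
           nab p v (\<lambda>q. s q \<oplus>\<^bsub>Cl \<A> g q\<^esub> t q) = nab p v s \<oplus>\<^bsub>Cl \<A> g p\<^esub> nab p v t) \<and>
        (\<forall>f::'m \<Rightarrow> complex. smooth_fun \<A> UNIV f \<longrightarrow>
           nab p v (\<lambda>q. f q \<odot>\<^bsub>Cl \<A> g q\<^esub> s q) =
             (dir_deriv \<A> p v f \<odot>\<^bsub>Cl \<A> g p\<^esub> s p) \<oplus>\<^bsub>Cl \<A> g p\<^esub> (f p \<odot>\<^bsub>Cl \<A> g p\<^esub> nab p v s)) \<and>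
        (\<forall>t. smooth_section \<A> g t \<longrightarrow>
           nab p v (\<lambda>q. s q \<otimes>\<^bsub>Cl \<A> g q\<^esub> t q) =
             (nab p v s \<otimes>\<^bsub>Cl \<A> g p\<^esub> t p) \<oplus>\<^bsub>Cl \<A> g p\<^esub> (s p \<otimes>\<^bsub>Cl \<A> g p\<^esub> nab p v t)))) \<and>
     (\<forall>p Y. smooth_vf \<A> UNIV Y \<longrightarrow> (\<forall>v\<in>tangent_space \<A> p.
        nab p v (\<lambda>q. cvec \<A> g q (Y q)) = cvec \<A> g p (nabT p v Y))) \<and>
     (\<forall>X s. smooth_vf \<A> UNIV X \<longrightarrow> smooth_section \<A> g s \<longrightarrow> smooth_section \<A> g (\<lambda>p. nab p (X p) s))"

definition clifford_linear ::
  "('m::topological_space, 'e::euclidean_space) chart set \<Rightarrow>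
   ('m \<Rightarrow> ('m, 'e) tvec \<Rightarrow> ('m, 'e) tvec \<Rightarrow> real) \<Rightarrow>
   ('m \<Rightarrow> ('m, 'e) cliff \<Rightarrow> ('m, 'e) cliff) \<Rightarrow> bool" where
  "clifford_linear \<A> g P \<longleftrightarrow>
     (\<forall>p. \<forall>x\<in>carrier (Cl \<A> g p).
        P p x \<in> carrier (Cl \<A> g p) \<and>
        (\<forall>y\<in>carrier (Cl \<A> g p). P p (x \<oplus>\<^bsub>Cl \<A> g p\<^esub> y) = P p x \<oplus>\<^bsub>Cl \<A> g p\<^esub> P p y) \<and>
        (\<forall>z. P p (z \<odot>\<^bsub>Cl \<A> g p\<^esub> x) = z \<odot>\<^bsub>Cl \<A> g p\<^esub> P p x))"

definition derivation_extension ::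
  "('m::topological_space, 'e::euclidean_space) chart set \<Rightarrow>
   ('m \<Rightarrow> ('m, 'e) tvec \<Rightarrow> ('m, 'e) tvec \<Rightarrow> real) \<Rightarrow>
   ('m \<Rightarrow> ('m, 'e) tvec \<Rightarrow> ('m, 'e) tvec) \<Rightarrow>
   ('m \<Rightarrow> ('m, 'e) cliff \<Rightarrow> ('m, 'e) cliff) \<Rightarrow> bool" where
  "derivation_extension \<A> g J Jd \<longleftrightarrow>
     clifford_linear \<A> g Jd \<and>
     (\<forall>p. \<forall>v\<in>tangent_space \<A> p. Jd p (cvec \<A> g p v) = cvec \<A> g p (J p v)) \<and>
     (\<forall>p. Jd p \<one>\<^bsub>Cl \<A> g p\<^esub> = \<zero>\<^bsub>Cl \<A> g p\<^esub>) \<and>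
     (\<forall>p. \<forall>x\<in>carrier (Cl \<A> g p). \<forall>y\<in>carrier (Cl \<A> g p).
        Jd p (x \<otimes>\<^bsub>Cl \<A> g p\<^esub> y) =
          (Jd p x \<otimes>\<^bsub>Cl \<A> g p\<^esub> y) \<oplus>\<^bsub>Cl \<A> g p\<^esub> (x \<otimes>\<^bsub>Cl \<A> g p\<^esub> Jd p y))"

definition algebra_extension ::
  "('m::topological_space, 'e::euclidean_space) chart set \<Rightarrow>
   ('m \<Rightarrow> ('m, 'e) tvec \<Rightarrow> ('m, 'e) tvec \<Rightarrow> real) \<Rightarrow>
   ('m \<Rightarrow> ('m, 'e) tvec \<Rightarrow> ('m, 'e) tvec) \<Rightarrow>
   ('m \<Rightarrow> ('m, 'e) cliff \<Rightarrow> ('m, 'e) cliff) \<Rightarrow> bool" where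
  "algebra_extension \<A> g J Ja \<longleftrightarrow>
     clifford_linear \<A> g Ja \<and>
     (\<forall>p. \<forall>v\<in>tangent_space \<A> p. Ja p (cvec \<A> g p v) = cvec \<A> g p (J p v)) \<and>
     (\<forall>p. Ja p \<in> ring_hom (Cl \<A> g p) (Cl \<A> g p))"

section \<open>Frames and operators\<close>

text \<open>An orthonormal basis \<open>e\<^sub>1, \<dots>, e\<^bsub>2n\<^esub>\<close> of \<open>T\<^sub>pM\<close> with \<open>J e\<^sub>i = e\<^bsub>i+n\<^esub>\<close>.
  The operators below involve the values of a frame only at the point of evaluation; they take such
  a basis \<open>e p\<close> for every point \<open>p\<close>, with no continuity required since global frames need not
  exist.\<close>

definition adapted_basis ::
  "('m::topological_space, 'e::euclidean_space) chart set \<Rightarrow>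
   ('m \<Rightarrow> ('m, 'e) tvec \<Rightarrow> ('m, 'e) tvec \<Rightarrow> real) \<Rightarrow>
   ('m \<Rightarrow> ('m, 'e) tvec \<Rightarrow> ('m, 'e) tvec) \<Rightarrow> nat \<Rightarrow> 'm \<Rightarrow> (nat \<Rightarrow> ('m, 'e) tvec) \<Rightarrow> bool" where
  "adapted_basis \<A> g J n p e \<longleftrightarrow>
     (\<forall>A\<in>{1..2*n}. e A \<in> tangent_space \<A> p) \<and>
     span (e ` {1..2*n}) = tangent_space \<A> p \<and>
     (\<forall>A\<in>{1..2*n}. \<forall>B\<in>{1..2*n}. g p (e A) (e B) = (if A = B then 1 else 0)) \<and>
     (\<forall>i\<in>{1..n}. J p (e i) = e (i + n))"

definition fundamental_element ::
  "('m::topological_space, 'e::euclidean_space) chart set \<Rightarrow>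
   ('m \<Rightarrow> ('m, 'e) tvec \<Rightarrow> ('m, 'e) tvec \<Rightarrow> real) \<Rightarrow> nat \<Rightarrow> ('m \<Rightarrow> nat \<Rightarrow> ('m, 'e) tvec) \<Rightarrow>
   'm \<Rightarrow> ('m, 'e) cliff" where
  "fundamental_element \<A> g n e p =
     (\<Oplus>\<^bsub>Cl \<A> g p\<^esub>i\<in>{1..n}. cvec \<A> g p (e p i) \<otimes>\<^bsub>Cl \<A> g p\<^esub> cvec \<A> g p (e p (i + n)))"

definition dirac ::
  "('m::topological_space, 'e::euclidean_space) chart set \<Rightarrow>
   ('m \<Rightarrow> ('m, 'e) tvec \<Rightarrow> ('m, 'e) tvec \<Rightarrow> real) \<Rightarrow> nat \<Rightarrow> ('m \<Rightarrow> nat \<Rightarrow> ('m, 'e) tvec) \<Rightarrow>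
   ('m \<Rightarrow> ('m, 'e) tvec \<Rightarrow> ('m \<Rightarrow> ('m, 'e) cliff) \<Rightarrow> ('m, 'e) cliff) \<Rightarrow>
   ('m \<Rightarrow> ('m, 'e) cliff) \<Rightarrow> 'm \<Rightarrow> ('m, 'e) cliff" where
  "dirac \<A> g n e nab s p =
     (\<Oplus>\<^bsub>Cl \<A> g p\<^esub>A\<in>{1..2*n}. cvec \<A> g p (e p A) \<otimes>\<^bsub>Cl \<A> g p\<^esub> nab p (e p A) s)"

definition clifford_left_mult ::
  "('m::topological_space, 'e::euclidean_space) chart set \<Rightarrow>
   ('m \<Rightarrow> ('m, 'e) tvec \<Rightarrow> ('m, 'e) tvec \<Rightarrow> real) \<Rightarrow>
   ('m \<Rightarrow> ('m, 'e) cliff) \<Rightarrow> ('m \<Rightarrow> ('m, 'e) cliff) \<Rightarrow> 'm \<Rightarrow> ('m, 'e) cliff" where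
  "clifford_left_mult \<A> g t s p = t p \<otimes>\<^bsub>Cl \<A> g p\<^esub> s p"

definition H_op ::
  "('m::topological_space, 'e::euclidean_space) chart set \<Rightarrow>
   ('m \<Rightarrow> ('m, 'e) tvec \<Rightarrow> ('m, 'e) tvec \<Rightarrow> real) \<Rightarrow> ('m \<Rightarrow> ('m, 'e) cliff) \<Rightarrow>
   ('m \<Rightarrow> ('m, 'e) cliff) \<Rightarrow> 'm \<Rightarrow> ('m, 'e) cliff" where
  "H_op \<A> g \<omega> s p =
     (1 / (2 * \<i>)) \<odot>\<^bsub>Cl \<A> g p\<^esub> ((\<omega> p \<otimes>\<^bsub>Cl \<A> g p\<^esub> s p) \<oplus>\<^bsub>Cl \<A> g p\<^esub> (s p \<otimes>\<^bsub>Cl \<A> g p\<^esub> \<omega> p))"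

definition fibre_inverse ::
  "('m::topological_space, 'e::euclidean_space) chart set \<Rightarrow>
   ('m \<Rightarrow> ('m, 'e) tvec \<Rightarrow> ('m, 'e) tvec \<Rightarrow> real) \<Rightarrow>
   ('m \<Rightarrow> ('m, 'e) cliff \<Rightarrow> ('m, 'e) cliff) \<Rightarrow> 'm \<Rightarrow> ('m, 'e) cliff \<Rightarrow> ('m, 'e) cliff" where
  "fibre_inverse \<A> g P p = inv_into (carrier (Cl \<A> g p)) (P p)"

definition conjugate_op ::
  "('m::topological_space, 'e::euclidean_space) chart set \<Rightarrow>
   ('m \<Rightarrow> ('m, 'e) tvec \<Rightarrow> ('m, 'e) tvec \<Rightarrow> real) \<Rightarrow>
   ('m \<Rightarrow> ('m, 'e) cliff \<Rightarrow> ('m, 'e) cliff) \<Rightarrow>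
   (('m \<Rightarrow> ('m, 'e) cliff) \<Rightarrow> 'm \<Rightarrow> ('m, 'e) cliff) \<Rightarrow>
   ('m \<Rightarrow> ('m, 'e) cliff) \<Rightarrow> 'm \<Rightarrow> ('m, 'e) cliff" where
  "conjugate_op \<A> g Ja P s p = fibre_inverse \<A> g Ja p (P (\<lambda>q. Ja q (s q)) p)"

text \<open>The covariant derivative \<open>(\<nabla>\<^sub>v P)(s)\<close> of a field \<open>P\<close> of endomorphisms of the fibres.\<close>

definition nabla_end ::
  "('m::topological_space, 'e::euclidean_space) chart set \<Rightarrow>
   ('m \<Rightarrow> ('m, 'e) tvec \<Rightarrow> ('m, 'e) tvec \<Rightarrow> real) \<Rightarrow>
   ('m \<Rightarrow> ('m, 'e) tvec \<Rightarrow> ('m \<Rightarrow> ('m, 'e) cliff) \<Rightarrow> ('m, 'e) cliff) \<Rightarrow>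
   ('m \<Rightarrow> ('m, 'e) cliff \<Rightarrow> ('m, 'e) cliff) \<Rightarrow>
   'm \<Rightarrow> ('m, 'e) tvec \<Rightarrow> ('m \<Rightarrow> ('m, 'e) cliff) \<Rightarrow> ('m, 'e) cliff" where
  "nabla_end \<A> g nab P p v s = nab p v (\<lambda>q. P q (s q)) \<ominus>\<^bsub>Cl \<A> g p\<^esub> P p (nab p v s)"

definition sigma ::
  "('m::topological_space, 'e::euclidean_space) chart set \<Rightarrow>
   ('m \<Rightarrow> ('m, 'e) tvec \<Rightarrow> ('m, 'e) tvec \<Rightarrow> real) \<Rightarrow>
   ('m \<Rightarrow> ('m, 'e) tvec \<Rightarrow> ('m, 'e) tvec) \<Rightarrow>
   ('m \<Rightarrow> ('m, 'e) tvec \<Rightarrow> ('m \<Rightarrow> ('m, 'e) cliff) \<Rightarrow> ('m, 'e) cliff) \<Rightarrow>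
   ('m \<Rightarrow> ('m, 'e) cliff \<Rightarrow> ('m, 'e) cliff) \<Rightarrow> ('m \<Rightarrow> ('m, 'e) cliff \<Rightarrow> ('m, 'e) cliff) \<Rightarrow>
   'm \<Rightarrow> ('m, 'e) tvec \<Rightarrow> ('m \<Rightarrow> ('m, 'e) cliff) \<Rightarrow> ('m, 'e) cliff" where
  "sigma \<A> g J nab Jd Ja p v s =
     nabla_end \<A> g nab Jd p v s \<oplus>\<^bsub>Cl \<A> g p\<^esub>
     fibre_inverse \<A> g Ja p (nabla_end \<A> g nab Ja p (J p v) s)"

definition dirac_sigma ::
  "('m::topological_space, 'e::euclidean_space) chart set \<Rightarrow>
   ('m \<Rightarrow> ('m, 'e) tvec \<Rightarrow> ('m, 'e) tvec \<Rightarrow> real) \<Rightarrow>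
   ('m \<Rightarrow> ('m, 'e) tvec \<Rightarrow> ('m, 'e) tvec) \<Rightarrow> nat \<Rightarrow> ('m \<Rightarrow> nat \<Rightarrow> ('m, 'e) tvec) \<Rightarrow>
   ('m \<Rightarrow> ('m, 'e) tvec \<Rightarrow> ('m \<Rightarrow> ('m, 'e) cliff) \<Rightarrow> ('m, 'e) cliff) \<Rightarrow>
   ('m \<Rightarrow> ('m, 'e) cliff \<Rightarrow> ('m, 'e) cliff) \<Rightarrow> ('m \<Rightarrow> ('m, 'e) cliff \<Rightarrow> ('m, 'e) cliff) \<Rightarrow>
   ('m \<Rightarrow> ('m, 'e) cliff) \<Rightarrow> 'm \<Rightarrow> ('m, 'e) cliff" where
  "dirac_sigma \<A> g J n e nab Jd Ja s p =
     (\<Oplus>\<^bsub>Cl \<A> g p\<^esub>A\<in>{1..2*n}.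
        cvec \<A> g p (e p A) \<otimes>\<^bsub>Cl \<A> g p\<^esub> sigma \<A> g J nab Jd Ja p (e p A) s)"

definition op_commutator ::
  "('m::topological_space, 'e::euclidean_space) chart set \<Rightarrow>
   ('m \<Rightarrow> ('m, 'e) tvec \<Rightarrow> ('m, 'e) tvec \<Rightarrow> real) \<Rightarrow>
   (('m \<Rightarrow> ('m, 'e) cliff) \<Rightarrow> 'm \<Rightarrow> ('m, 'e) cliff) \<Rightarrow>
   (('m \<Rightarrow> ('m, 'e) cliff) \<Rightarrow> 'm \<Rightarrow> ('m, 'e) cliff) \<Rightarrow>
   ('m \<Rightarrow> ('m, 'e) cliff) \<Rightarrow> 'm \<Rightarrow> ('m, 'e) cliff" where
  "op_commutator \<A> g P Q s p = P (Q s) p \<ominus>\<^bsub>Cl \<A> g p\<^esub> Q (P s) p"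

end

theory Submission
  imports Defs
begin

text \<open>In the Clifford algebra \<open>[\<omega>, v] = 2Jv\<close> for vectors \<open>v\<close>, hence \<open>[\<omega>, x] = 2J\<^sub>d x\<close> for all \<open>x\<close>,
  since both sides are derivations.  Differentiating gives \<open>(\<nabla>\<^sub>v\<omega>)\<cdot>x - x\<cdot>\<nabla>\<^sub>v\<omega> = 2(\<nabla>\<^sub>v J\<^sub>d)x\<close>.  Using the two
  identities to move \<open>\<omega>\<close> and \<open>\<nabla>\<omega>\<close> to the left in \<open>2i[D, H]x\<close> leaves twice the sum over the frame of
  \<open>e\<^sub>A\<cdot>\<nabla>\<^sub>A\<omega>\<cdot>x - Je\<^sub>A\<cdot>\<nabla>\<^sub>A x - e\<^sub>A\<cdot>(\<nabla>\<^sub>A J\<^sub>d)x\<close>.  On the other side \<open>J\<^sub>a\<^sup>-\<^sup>1 e\<^sub>A = -Je\<^sub>A\<close>, and reindexing the frame by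
  \<open>J\<close> turns \<open>D\<^sup>c x\<close> into the sum of \<open>-Je\<^sub>A\<cdot>\<nabla>\<^sub>A x + e\<^sub>A\<cdot>J\<^sub>a\<^sup>-\<^sup>1(\<nabla>\<^bsub>Je\<^sub>A\<^esub> J\<^sub>a)x\<close>; the second summand is cancelled by
  \<open>D\<^sub>\<sigma>\<close>.  The connection is only known to obey the Leibniz rule on smooth sections, so \<open>\<omega>\<close>, which is
  given by a possibly discontinuous frame, has to be rewritten in a local smooth orthogonal frame
  obtained by the Gram-Schmidt process.\<close>

section \<open>Iterated differentiability\<close>

text \<open>\<open>nab\<close> acts on globally defined sections and its axioms speak of smooth ones
  only, so computing with it in a local frame would call for cut-off functions. This is avoided: the
  frame \<open>e\<close> is never differentiated, and the one field that must be differentiated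
  through a formula, \<open>Jd q (s q)\<close>, is half of \<open>\<omega> s - s \<omega>\<close>,
  an expression in global sections to which the product rule applies at once. Derivatives of
  \<open>Ja q (s q)\<close> stay unevaluated, as they cancel in the end. What remains is the
  smoothness of \<open>\<omega>\<close>. For this it is written as half the trace of
  \<open>(u, v) \<mapsto> u \<cdot> J v\<close>, which makes sense in every basis: for orthogonal
  vectors \<open>f k\<close> it is half the sum of \<open>f k \<cdot> J (f k)\<close> divided by the
  squared length of \<open>f k\<close>. Keeping this frame unnormalised avoids square roots and
  questions about their smoothness. The constant \<open>- \<i>\<close> arises as
  \<open>2 / (2 * \<i>)\<close>.\<close>

lemma C_k_on_SucD:
  assumes "C_k_on (Suc k) S f" "x \<in> S"
  shows "(f has_derivative frechet_derivative f (at x)) (at x)"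
  using assms by (simp add: frechet_derivative_works[symmetric])

text \<open>Functions agreeing on an open set have the same derivatives at its points, so the
  hypothesis carries over to every directional derivative.\<close>

lemma C_k_on_cong:
  assumes "open S" "\<And>x. x \<in> S \<Longrightarrow> f x = h x"
  shows "C_k_on k S f \<longleftrightarrow> C_k_on k S h"
proof -
  have *: "C_k_on k S h" if "C_k_on k S f" "\<And>x. x \<in> S \<Longrightarrow> f x = h x" for f h :: "'a \<Rightarrow> 'b"
    using that
  proof (induction k arbitrary: f h)
    case 0
    then show ?case
      using continuous_on_cong by (metis C_k_on.simps(1))
  next
    case (Suc k)
    have d: "(h has_derivative frechet_derivative f (at x)) (at x)" if "x \<in> S" for x
      using C_k_on_SucD[OF Suc.prems(1) that] Suc.prems(2) \<open>open S\<close> that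
      by (metis has_derivative_transform_within_open)
    then have eq: "frechet_derivative h (at x) = frechet_derivative f (at x)" if "x \<in> S" for x
      using frechet_derivative_at[OF d[OF that]] by simp
    have "C_k_on k S (\<lambda>x. frechet_derivative h (at x) v)" for v
      by (rule Suc.IH[of "\<lambda>x. frechet_derivative f (at x) v"]) (use Suc.prems eq in auto)
    then show ?case
      using d by (auto simp: differentiable_def)
  qed
  show ?thesis
    using *[of f h] *[of h f] assms(2) by auto
qed

text \<open>Each closure property below exhibits a derivative by a calculus rule and feeds its
  directional derivatives back into the induction. By uniqueness this derivative may replace the
  choice hidden in \<open>frechet_derivative\<close>.\<close>

lemma C_k_on_SucI:
  assumes "open S" "\<And>x. x \<in> S \<Longrightarrow> (f has_derivative f' x) (at x)"
    and "\<And>v. C_k_on k S (\<lambda>x. f' x v)"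
  shows "C_k_on (Suc k) S f"
proof -
  have "f' x = frechet_derivative f (at x)" if "x \<in> S" for x
    using assms(2)[OF that] by (rule frechet_derivative_at)
  then have "C_k_on k S (\<lambda>x. frechet_derivative f (at x) v)" for v
    using C_k_on_cong[OF assms(1), of "\<lambda>x. f' x v" "\<lambda>x. frechet_derivative f (at x) v" k]
      assms(3) by simp
  then show ?thesis
    using assms(2) by (auto simp: differentiable_def)
qed

text \<open>Not immediate from the recursion, which asks for level \<open>k\<close> of the
  directional derivatives and not of \<open>f\<close> itself; the base case is that
  differentiability implies continuity.\<close>

lemma C_k_on_Suc_imp: "C_k_on (Suc k) S f \<Longrightarrow> C_k_on k S f"
proof (induction k arbitrary: f)
  case 0
  then show ?case
    by (auto intro!: continuous_at_imp_continuous_on differentiable_imp_continuous_within)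
next
  case (Suc k)
  then show ?case by (metis C_k_on.simps(2))
qed

lemma C_k_on_subset: "C_k_on k S f \<Longrightarrow> T \<subseteq> S \<Longrightarrow> C_k_on k T f"
  by (induction k arbitrary: f) (auto intro: continuous_on_subset)

lemma C_k_on_const: "C_k_on k S (\<lambda>x. c)"
proof (induction k arbitrary: c)
  case (Suc k)
  then show ?case by (simp add: frechet_derivative_const)
qed simp

lemma C_k_on_bounded_linear:
  assumes "bounded_linear L" "open S" "C_k_on k S f"
  shows "C_k_on k S (\<lambda>x. L (f x))"
  using assms(3)
proof (induction k arbitrary: f)
  case 0
  then show ?case
    using assms(1) by (simp add: bounded_linear.continuous_on)
next
  case (Suc k)
  show ?case
    by (rule C_k_on_SucI[OF assms(2)
          bounded_linear.has_derivative[OF assms(1) C_k_on_SucD[OF Suc.prems]]])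
      (use Suc in auto)
qed

lemma C_k_on_add:
  assumes "open S" "C_k_on k S f" "C_k_on k S h"
  shows "C_k_on k S (\<lambda>x. f x + h x)"
  using assms(2,3)
proof (induction k arbitrary: f h)
  case 0
  then show ?case by (simp add: continuous_on_add)
next
  case (Suc k)
  show ?case
    by (rule C_k_on_SucI[OF assms(1)
          has_derivative_add[OF C_k_on_SucD[OF Suc.prems(1)] C_k_on_SucD[OF Suc.prems(2)]]])
      (use Suc in auto)
qed

lemma C_k_on_sum:
  assumes "open S" "\<And>i. i \<in> I \<Longrightarrow> C_k_on k S (f i)"
  shows "C_k_on k S (\<lambda>x. \<Sum>i\<in>I. f i x)"
  using assms(2)
  by (induction I rule: infinite_finite_induct) (auto simp: C_k_on_const intro!: C_k_on_add assms(1))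

text \<open>The product rule gives two terms of the same shape, in which one factor is
  differentiated and the other one is lowered from level \<open>Suc k\<close> to level
  \<open>k\<close>.\<close>

lemma C_k_on_bilinear:
  assumes "bounded_bilinear B" "open S" "C_k_on k S f" "C_k_on k S h"
  shows "C_k_on k S (\<lambda>x. B (f x) (h x))"
  using assms(3,4)
proof (induction k arbitrary: f h)
  case 0
  then show ?case by (simp add: bounded_bilinear.continuous_on[OF assms(1)])
next
  case (Suc k)
  show ?case
    by (rule C_k_on_SucI[OF assms(2) bounded_bilinear.FDERIV[OF assms(1)
            C_k_on_SucD[OF Suc.prems(1)] C_k_on_SucD[OF Suc.prems(2)]]])
      (use Suc.prems in \<open>auto intro!: C_k_on_add assms(2) Suc.IH C_k_on_Suc_imp[OF Suc.prems(1)]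
         C_k_on_Suc_imp[OF Suc.prems(2)]\<close>)
qed

text \<open>The derivative of \<open>1/f\<close> is a product of two factors \<open>1/f\<close> and
  a derivative of \<open>f\<close>, so the induction hypothesis for \<open>1/f\<close> itself is
  enough.\<close>

lemma C_k_on_inverse:
  fixes f :: "'a::real_normed_vector \<Rightarrow> real"
  assumes "open S" "C_k_on k S f" "\<And>x. x \<in> S \<Longrightarrow> f x \<noteq> 0"
  shows "C_k_on k S (\<lambda>x. inverse (f x))"
  using assms(2)
proof (induction k)
  case 0
  then show ?case using assms(3) by (auto intro: continuous_on_inverse)
next
  case (Suc k)
  note IH = Suc.IH[OF C_k_on_Suc_imp[OF Suc.prems]]
  show ?case
  proof (rule C_k_on_SucI[OF assms(1)])
    show "((\<lambda>x. inverse (f x)) has_derivative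
        (\<lambda>v. - (inverse (f x) * frechet_derivative f (at x) v * inverse (f x)))) (at x)"
      if "x \<in> S" for x
      using Deriv.has_derivative_inverse[OF assms(3)[OF that] C_k_on_SucD[OF Suc.prems that]] by simp
    show "C_k_on k S (\<lambda>x. - (inverse (f x) * frechet_derivative f (at x) v * inverse (f x)))" for v
      using Suc.prems
      by (auto intro!: C_k_on_bounded_linear[OF bounded_linear_minus[OF bounded_linear_ident]]
          C_k_on_bilinear[OF bounded_bilinear_mult] IH assms(1))
  qed
qed

text \<open>In the chain rule the derivative of \<open>f\<close> is taken in the direction
  \<open>?Dh x v\<close>, which varies with \<open>x\<close>, whereas \<open>C_k_on\<close> only
  knows fixed directions. Expanding this vector in \<open>Basis\<close> leaves the fixed directions
  \<open>b\<close>, with coefficients of level \<open>k\<close>.\<close>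

lemma C_k_on_compose:
  fixes h :: "'a::real_normed_vector \<Rightarrow> 'e::euclidean_space"
  assumes "open S" "open T" "h ` S \<subseteq> T" "C_k_on k T f" "C_k_on k S h"
  shows "C_k_on k S (\<lambda>x. f (h x))"
  using assms(4,5)
proof (induction k arbitrary: f)
  case 0
  then show ?case using assms(3) by (auto intro: continuous_on_compose2)
next
  case (Suc k)
  let ?Dh = "\<lambda>x. frechet_derivative h (at x)" and ?Df = "\<lambda>y. frechet_derivative f (at y)"
  have hT: "h x \<in> T" if "x \<in> S" for x using assms(3) that by auto
  show ?case
  proof (rule C_k_on_SucI[OF assms(1)])
    show "((\<lambda>x. f (h x)) has_derivative
        (\<lambda>v. \<Sum>b\<in>Basis. (?Dh x v \<bullet> b) *\<^sub>R ?Df (h x) b)) (at x)" if "x \<in> S" for x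
    proof -
      note Df = C_k_on_SucD[OF Suc.prems(1) hT[OF that]]
      have "?Df (h x) w = (\<Sum>b\<in>Basis. (w \<bullet> b) *\<^sub>R ?Df (h x) b)" for w
      proof -
        interpret linear "?Df (h x)" using Df has_derivative_linear by blast
        have "?Df (h x) w = ?Df (h x) (\<Sum>b\<in>Basis. (w \<bullet> b) *\<^sub>R b)"
          by (simp add: euclidean_representation)
        then show ?thesis by (simp add: sum scale)
      qed
      then have "?Df (h x) (?Dh x v) = (\<Sum>b\<in>Basis. (?Dh x v \<bullet> b) *\<^sub>R ?Df (h x) b)" for v .
      then show ?thesis
        using has_derivative_compose[OF C_k_on_SucD[OF Suc.prems(2) that] Df] by presburger
    qed
    show "C_k_on k S (\<lambda>x. \<Sum>b\<in>Basis. (?Dh x v \<bullet> b) *\<^sub>R ?Df (h x) b)" for v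
      using Suc.prems C_k_on_Suc_imp[OF Suc.prems(2)]
      by (auto intro!: C_k_on_sum C_k_on_bilinear[OF bounded_bilinear_scaleR]
          C_k_on_bounded_linear[OF bounded_linear_inner_left] Suc.IH assms(1))
  qed
qed

lemma smooth_on_cong:
  "open S \<Longrightarrow> (\<And>x. x \<in> S \<Longrightarrow> f x = h x) \<Longrightarrow> smooth_on S f \<longleftrightarrow> smooth_on S h"
  using C_k_on_cong by (metis smooth_on_def)

lemma smooth_on_subset: "smooth_on S f \<Longrightarrow> T \<subseteq> S \<Longrightarrow> smooth_on T f"
  using C_k_on_subset by (metis smooth_on_def)

lemma smooth_on_const: "smooth_on S (\<lambda>x. c)"
  by (simp add: smooth_on_def C_k_on_const)

lemma smooth_on_bounded_linear:
  "bounded_linear L \<Longrightarrow> open S \<Longrightarrow> smooth_on S f \<Longrightarrow> smooth_on S (\<lambda>x. L (f x))"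
  by (simp add: smooth_on_def C_k_on_bounded_linear)

lemma smooth_on_add:
  "open S \<Longrightarrow> smooth_on S f \<Longrightarrow> smooth_on S h \<Longrightarrow> smooth_on S (\<lambda>x. f x + h x)"
  by (simp add: smooth_on_def C_k_on_add)

lemma smooth_on_bilinear:
  "bounded_bilinear B \<Longrightarrow> open S \<Longrightarrow> smooth_on S f \<Longrightarrow> smooth_on S h \<Longrightarrow>
     smooth_on S (\<lambda>x. B (f x) (h x))"
  by (simp add: smooth_on_def C_k_on_bilinear)

lemma smooth_on_inverse:
  fixes f :: "'a::real_normed_vector \<Rightarrow> real"
  shows "open S \<Longrightarrow> smooth_on S f \<Longrightarrow> (\<And>x. x \<in> S \<Longrightarrow> f x \<noteq> 0) \<Longrightarrow>
    smooth_on S (\<lambda>x. inverse (f x))"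
  by (simp add: smooth_on_def C_k_on_inverse)

lemma smooth_on_compose:
  fixes h :: "'a::real_normed_vector \<Rightarrow> 'e::euclidean_space"
  shows "open S \<Longrightarrow> open T \<Longrightarrow> h ` S \<subseteq> T \<Longrightarrow> smooth_on T f \<Longrightarrow> smooth_on S h \<Longrightarrow>
    smooth_on S (\<lambda>x. f (h x))"
  unfolding smooth_on_def using C_k_on_compose by blast

lemma smooth_on_has_derivative:
  "smooth_on S f \<Longrightarrow> x \<in> S \<Longrightarrow> (f has_derivative frechet_derivative f (at x)) (at x)"
  using C_k_on_SucD by (metis smooth_on_def)

lemma smooth_on_derivative: "smooth_on S f \<Longrightarrow> smooth_on S (\<lambda>x. frechet_derivative f (at x) v)"
  unfolding smooth_on_def using C_k_on.simps(2)[of _ S f] by blast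

section \<open>Vector fields on a manifold\<close>

locale smooth_manifold =
  fixes \<A> :: "('m::topological_space, 'e::euclidean_space) chart set"
  assumes atlas: "smooth_atlas \<A>"
begin

section \<open>Charts, transition maps and tangent spaces\<close>

lemma chart_domain_open: "c \<in> \<A> \<Longrightarrow> open (fst c)"
  using atlas by (auto simp: smooth_atlas_def is_chart_def)

lemma chart_inj: "c \<in> \<A> \<Longrightarrow> inj_on (snd c) (fst c)"
  using atlas unfolding smooth_atlas_def is_chart_def homeomorphism_def by (metis inj_onI)

lemma chart_inv [simp]: "c \<in> \<A> \<Longrightarrow> p \<in> fst c \<Longrightarrow> chart_inv c (snd c p) = p"
  by (simp add: chart_inv_def chart_inj)

text \<open>Supplies the openness that most rules for \<open>smooth_on\<close> require: coordinate
  expressions live on these images.\<close>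

lemma chart_image_open:
  assumes "c \<in> \<A>" "open U"
  shows "open (snd c ` (U \<inter> fst c))"
proof -
  obtain \<psi> where hom: "homeomorphism (fst c) (snd c ` fst c) (snd c) \<psi>"
    and op: "open (snd c ` fst c)" "open (fst c)"
    using atlas assms(1) by (auto simp: smooth_atlas_def is_chart_def)
  have "openin (top_of_set (fst c)) (U \<inter> fst c)"
    using assms(2) op(2) by (simp add: openin_open_eq open_Int)
  then have "openin (top_of_set (snd c ` fst c)) (snd c ` (U \<inter> fst c))"
    using homeomorphism_imp_open_map[OF hom] by blast
  then show ?thesis
    using op(1) openin_open_trans by blast
qed

lemma chart_exists: "\<exists>c\<in>\<A>. p \<in> fst c"
  using atlas by (auto simp: smooth_atlas_def)

lemma transition_smooth:
  "c \<in> \<A> \<Longrightarrow> d \<in> \<A> \<Longrightarrow> smooth_on (snd c ` (fst c \<inter> fst d)) (snd d \<circ> chart_inv c)"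
  using atlas by (auto simp: smooth_atlas_def)

lemma transition_domain_open: "c \<in> \<A> \<Longrightarrow> d \<in> \<A> \<Longrightarrow> open (snd c ` (fst c \<inter> fst d))"
  using chart_image_open[of c "fst d"] chart_domain_open by (simp add: Int_commute)

definition transition_deriv :: "('m, 'e) chart \<Rightarrow> ('m, 'e) chart \<Rightarrow> 'm \<Rightarrow> 'e \<Rightarrow> 'e" where
  "transition_deriv c d p = frechet_derivative (snd d \<circ> chart_inv c) (at (snd c p))"

lemma transition_has_derivative:
  assumes "c \<in> \<A>" "d \<in> \<A>" "p \<in> fst c" "p \<in> fst d"
  shows "((snd d \<circ> chart_inv c) has_derivative transition_deriv c d p) (at (snd c p))"
  unfolding transition_deriv_def
  by (rule smooth_on_has_derivative[OF transition_smooth[OF assms(1,2)]]) (use assms in auto)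

lemma transition_deriv_linear:
  "c \<in> \<A> \<Longrightarrow> d \<in> \<A> \<Longrightarrow> p \<in> fst c \<Longrightarrow> p \<in> fst d \<Longrightarrow> linear (transition_deriv c d p)"
  using transition_has_derivative has_derivative_linear by blast

text \<open>Chain rule on the triple overlap. This cocycle condition is what makes
  \<open>coord_vf\<close> a tangent vector.\<close>

lemma transition_deriv_compose:
  assumes "c \<in> \<A>" "d \<in> \<A>" "d' \<in> \<A>" "p \<in> fst c" "p \<in> fst d" "p \<in> fst d'"
  shows "transition_deriv c d' p v = transition_deriv d d' p (transition_deriv c d p v)"
proof -
  let ?S = "snd c ` ((fst d \<inter> fst d') \<inter> fst c)"
  have "((snd d' \<circ> chart_inv d) has_derivative transition_deriv d d' p)
      (at ((snd d \<circ> chart_inv c) (snd c p)))"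
    using transition_has_derivative[of d d' p] assms by simp
  then have "((\<lambda>x. (snd d' \<circ> chart_inv d) ((snd d \<circ> chart_inv c) x)) has_derivative
      (\<lambda>v. transition_deriv d d' p (transition_deriv c d p v))) (at (snd c p))"
    using has_derivative_compose[OF transition_has_derivative[of c d p]] assms by blast
  then have "((snd d' \<circ> chart_inv c) has_derivative
      (\<lambda>v. transition_deriv d d' p (transition_deriv c d p v))) (at (snd c p))"
    by (rule has_derivative_transform_within_open[of _ _ _ _ ?S])
      (use assms in \<open>auto intro!: chart_image_open open_Int simp: chart_domain_open\<close>)
  from frechet_derivative_at[OF this] show ?thesis
    by (metis transition_deriv_def)
qed

lemma transition_deriv_refl:
  assumes "c \<in> \<A>" "p \<in> fst c"
  shows "transition_deriv c c p v = v"
proof -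
  have "((snd c \<circ> chart_inv c) has_derivative (\<lambda>v. v)) (at (snd c p))"
    by (rule has_derivative_transform_within_open[OF has_derivative_ident,
          of "snd c ` (fst c \<inter> fst c)"])
      (use assms transition_domain_open[of c c] in auto)
  from frechet_derivative_at[OF this] show ?thesis
    by (metis transition_deriv_def)
qed

lemma tangent_space_iff:
  "v \<in> tangent_space \<A> p \<longleftrightarrow>
     (\<forall>c\<in>\<A>. \<forall>d\<in>\<A>. p \<in> fst c \<longrightarrow> p \<in> fst d \<longrightarrow> v d = transition_deriv c d p (v c)) \<and>
     (\<forall>c. \<not> (c \<in> \<A> \<and> p \<in> fst c) \<longrightarrow> v c = 0)"
  by (simp add: tangent_space_def transition_deriv_def)

lemma tangent_vector_transition:
  "v \<in> tangent_space \<A> p \<Longrightarrow> c \<in> \<A> \<Longrightarrow> d \<in> \<A> \<Longrightarrow> p \<in> fst c \<Longrightarrow> p \<in> fst d \<Longrightarrow>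
    transition_deriv c d p (v c) = v d"
  unfolding tangent_space_iff by metis

lemma tangent_vector_outside:
  "v \<in> tangent_space \<A> p \<Longrightarrow> \<not> (c \<in> \<A> \<and> p \<in> fst c) \<Longrightarrow> v c = 0"
  unfolding tangent_space_iff by blast

lemma tangent_space_subspace: "subspace (tangent_space \<A> p)"
proof (rule subspaceI)
  show "0 \<in> tangent_space \<A> p"
    using linear_0[OF transition_deriv_linear] by (simp add: tangent_space_iff)
next
  fix u v assume "u \<in> tangent_space \<A> p" "v \<in> tangent_space \<A> p"
  then show "u + v \<in> tangent_space \<A> p"
    unfolding tangent_space_iff[of "u + v"]
    by (simp add: linear_add[OF transition_deriv_linear] tangent_vector_transition
        tangent_vector_outside)
next
  fix a v assume "v \<in> tangent_space \<A> p"
  then show "a *\<^sub>R v \<in> tangent_space \<A> p"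
    unfolding tangent_space_iff[of "a *\<^sub>R v"]
    by (simp add: scaleR_fun_def linear_cmul[OF transition_deriv_linear] tangent_vector_transition
        tangent_vector_outside)
qed

text \<open>Tangent vectors are functions of the chart, but one component determines them: the
  others around \<open>p\<close> follow by transition, and all remaining ones are zero.\<close>

lemma tangent_vector_eqI:
  assumes "c \<in> \<A>" "p \<in> fst c" "u \<in> tangent_space \<A> p" "v \<in> tangent_space \<A> p" "u c = v c"
  shows "u = v"
proof
  fix d
  show "u d = v d"
  proof (cases "d \<in> \<A> \<and> p \<in> fst d")
    case True
    then show ?thesis
      using tangent_vector_transition[of u p c d] tangent_vector_transition[of v p c d] assms by simp
  next
    case False
    then show ?thesis
      using tangent_vector_outside assms(3,4) by metis
  qed
qed

section \<open>Smooth functions and smooth vector fields on open sets\<close>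

lemma smooth_fun_subset: "smooth_fun \<A> U f \<Longrightarrow> V \<subseteq> U \<Longrightarrow> smooth_fun \<A> V f"
  unfolding smooth_fun_def by (meson Int_mono image_mono order_refl smooth_on_subset)

lemma smooth_vf_subset: "smooth_vf \<A> U X \<Longrightarrow> V \<subseteq> U \<Longrightarrow> smooth_vf \<A> V X"
  unfolding smooth_vf_def by (meson Int_mono image_mono order_refl smooth_on_subset subsetD)

lemma smooth_fun_const: "smooth_fun \<A> U (\<lambda>p. a)"
  by (simp add: smooth_fun_def comp_def smooth_on_const)

lemma smooth_fun_bounded_linear:
  "bounded_linear L \<Longrightarrow> open U \<Longrightarrow> smooth_fun \<A> U f \<Longrightarrow> smooth_fun \<A> U (\<lambda>p. L (f p))"
  unfolding smooth_fun_def comp_def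
  by (rule ballI, rule smooth_on_bounded_linear) (simp_all add: chart_image_open)

lemma smooth_fun_bilinear:
  "bounded_bilinear B \<Longrightarrow> open U \<Longrightarrow> smooth_fun \<A> U f \<Longrightarrow> smooth_fun \<A> U h \<Longrightarrow>
    smooth_fun \<A> U (\<lambda>p. B (f p) (h p))"
  unfolding smooth_fun_def comp_def
  by (rule ballI, rule smooth_on_bilinear) (simp_all add: chart_image_open)

lemma smooth_fun_inverse:
  fixes f :: "'m \<Rightarrow> real"
  assumes "open U" "smooth_fun \<A> U f" "\<And>p. p \<in> U \<Longrightarrow> f p \<noteq> 0"
  shows "smooth_fun \<A> U (\<lambda>p. inverse (f p))"
  unfolding smooth_fun_def comp_def
proof (intro ballI smooth_on_inverse)
  fix c x assume "c \<in> \<A>" "x \<in> snd c ` (U \<inter> fst c)"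
  then show "f (chart_inv c x) \<noteq> 0"
    using assms(3) by auto
qed (use assms in \<open>auto simp: smooth_fun_def comp_def intro: chart_image_open\<close>)

lemma smooth_vf_tangent: "smooth_vf \<A> U X \<Longrightarrow> p \<in> U \<Longrightarrow> X p \<in> tangent_space \<A> p"
  by (simp add: smooth_vf_def)

lemma smooth_vf_zero: "smooth_vf \<A> U (\<lambda>p. 0)"
  using subspace_0[OF tangent_space_subspace] by (simp add: smooth_vf_def smooth_on_const)

lemma smooth_vf_add:
  "open U \<Longrightarrow> smooth_vf \<A> U X \<Longrightarrow> smooth_vf \<A> U Y \<Longrightarrow> smooth_vf \<A> U (\<lambda>p. X p + Y p)"
  using subspace_add[OF tangent_space_subspace]
  by (simp add: smooth_vf_def smooth_on_add chart_image_open)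

lemma smooth_vf_scaleR:
  "open U \<Longrightarrow> smooth_fun \<A> U f \<Longrightarrow> smooth_vf \<A> U X \<Longrightarrow> smooth_vf \<A> U (\<lambda>p. f p *\<^sub>R X p)"
  using subspace_scale[OF tangent_space_subspace]
  by (simp add: smooth_vf_def smooth_fun_def comp_def scaleR_fun_def chart_image_open
      smooth_on_bilinear[OF bounded_bilinear_scaleR])

lemma smooth_vf_sum:
  "open U \<Longrightarrow> (\<And>i. i \<in> I \<Longrightarrow> smooth_vf \<A> U (X i)) \<Longrightarrow> smooth_vf \<A> U (\<lambda>p. \<Sum>i\<in>I. X i p)"
  by (induction I rule: infinite_finite_induct) (auto simp: smooth_vf_zero intro!: smooth_vf_add)

lemma smooth_vf_diff:
  "open U \<Longrightarrow> smooth_vf \<A> U X \<Longrightarrow> smooth_vf \<A> U Y \<Longrightarrow> smooth_vf \<A> U (\<lambda>p. X p - Y p)"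
  using smooth_vf_add[of U X "\<lambda>p. (-1) *\<^sub>R Y p"]
    smooth_vf_scaleR[OF _ smooth_fun_const[of U "-1"], of Y] by simp

lemma dir_deriv_const [simp]: "dir_deriv \<A> p v (\<lambda>q. a) = 0"
  by (simp add: dir_deriv_def comp_def frechet_derivative_const Let_def)

text \<open>The coordinate field of \<open>c\<close> in the constant direction \<open>b\<close>,
  given by its component in every chart \<open>d\<close>. Only its values on \<open>fst c\<close>
  are meaningful.\<close>

definition coord_vf :: "('m, 'e) chart \<Rightarrow> 'e \<Rightarrow> 'm \<Rightarrow> ('m, 'e) tvec" where
  "coord_vf c b p = (\<lambda>d. if d \<in> \<A> \<and> p \<in> fst d then transition_deriv c d p b else 0)"

lemma coord_vf_tangent:
  assumes "c \<in> \<A>" "p \<in> fst c"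
  shows "coord_vf c b p \<in> tangent_space \<A> p"
  unfolding tangent_space_iff
proof (intro conjI ballI impI allI)
  fix d d' assume "d \<in> \<A>" "d' \<in> \<A>" "p \<in> fst d" "p \<in> fst d'"
  then show "coord_vf c b p d' = transition_deriv d d' p (coord_vf c b p d)"
    using transition_deriv_compose[OF assms(1), of d d' p b] assms(2) by (simp add: coord_vf_def)
qed (auto simp: coord_vf_def)

lemma coord_vf_self: "c \<in> \<A> \<Longrightarrow> p \<in> fst c \<Longrightarrow> coord_vf c b p c = b"
  by (simp add: coord_vf_def transition_deriv_refl)

text \<open>In a chart \<open>d\<close> the component is a directional derivative of the transition
  from \<open>c\<close> to \<open>d\<close>, which is a function of the coordinates of
  \<open>c\<close>; composing with the transition from \<open>d\<close> to \<open>c\<close>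
  expresses it in those of \<open>d\<close>.\<close>

lemma smooth_vf_coord_vf:
  assumes "c \<in> \<A>"
  shows "smooth_vf \<A> (fst c) (coord_vf c b)"
proof -
  have "smooth_on (snd d ` (fst c \<inter> fst d)) (\<lambda>x. coord_vf c b (chart_inv d x) d)"
    if "d \<in> \<A>" for d
  proof -
    let ?f = "\<lambda>y. frechet_derivative (snd d \<circ> chart_inv c) (at y) b"
    let ?h = "snd c \<circ> chart_inv d"
    have "smooth_on (snd d ` (fst d \<inter> fst c)) (\<lambda>x. ?f (?h x))"
    proof (rule smooth_on_compose[where T = "snd c ` (fst c \<inter> fst d)" and f = ?f and h = ?h])
      show "?h ` snd d ` (fst d \<inter> fst c) \<subseteq> snd c ` (fst c \<inter> fst d)"
        using assms that by auto
    qed (intro transition_domain_open transition_smooth smooth_on_derivative assms that)+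
    moreover have "?f (?h x) = coord_vf c b (chart_inv d x) d" if "x \<in> snd d ` (fst d \<inter> fst c)" for x
      using that \<open>d \<in> \<A>\<close> by (auto simp: coord_vf_def transition_deriv_def)
    ultimately have "smooth_on (snd d ` (fst d \<inter> fst c)) (\<lambda>x. coord_vf c b (chart_inv d x) d)"
      using smooth_on_cong[OF transition_domain_open[OF that assms],
          of "\<lambda>x. ?f (?h x)" "\<lambda>x. coord_vf c b (chart_inv d x) d"] by blast
    then show ?thesis by (simp add: Int_commute)
  qed
  then show ?thesis
    using coord_vf_tangent[OF assms] by (simp add: smooth_vf_def)
qed

lemma coord_vf_expansion:
  assumes "c \<in> \<A>" "p \<in> fst c" "v \<in> tangent_space \<A> p"
  shows "v = (\<Sum>b\<in>Basis. (v c \<bullet> b) *\<^sub>R coord_vf c b p)"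
proof (rule tangent_vector_eqI[OF assms])
  show "(\<Sum>b\<in>Basis. (v c \<bullet> b) *\<^sub>R coord_vf c b p) \<in> tangent_space \<A> p"
    by (intro subspace_sum[OF tangent_space_subspace] subspace_scale[OF tangent_space_subspace]
        coord_vf_tangent assms)
  have "(\<Sum>b\<in>B. (v c \<bullet> b) *\<^sub>R coord_vf c b p) c = (\<Sum>b\<in>B. (v c \<bullet> b) *\<^sub>R b)" for B
    by (induction B rule: infinite_finite_induct) (simp_all add: scaleR_fun_def coord_vf_self assms)
  then show "v c = (\<Sum>b\<in>Basis. (v c \<bullet> b) *\<^sub>R coord_vf c b p) c"
    by (simp add: euclidean_representation)
qed

end

section \<open>Local orthogonal frames\<close>

locale riemannian_manifold = smooth_manifold \<A>
  for \<A> :: "('m::topological_space, 'e::euclidean_space) chart set" +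
  fixes g :: "'m \<Rightarrow> ('m, 'e) tvec \<Rightarrow> ('m, 'e) tvec \<Rightarrow> real"
  assumes metric: "riemannian_metric \<A> g"
begin

section \<open>The metric on a single tangent space\<close>

abbreviation T :: "'m \<Rightarrow> ('m, 'e) tvec set" where "T \<equiv> tangent_space \<A>"

lemmas T_add = subspace_add[OF tangent_space_subspace]
lemmas T_scale = subspace_scale[OF tangent_space_subspace]
lemmas T_zero = subspace_0[OF tangent_space_subspace]
lemmas T_diff = subspace_diff[OF tangent_space_subspace]
lemmas T_neg = subspace_neg[OF tangent_space_subspace]
lemmas T_sum = subspace_sum[OF tangent_space_subspace]

lemma g_sym: "u \<in> T p \<Longrightarrow> v \<in> T p \<Longrightarrow> g p u v = g p v u"
  and g_add_left: "u \<in> T p \<Longrightarrow> v \<in> T p \<Longrightarrow> w \<in> T p \<Longrightarrow> g p (u + v) w = g p u w + g p v w"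
  and g_scale_left: "u \<in> T p \<Longrightarrow> v \<in> T p \<Longrightarrow> g p (a *\<^sub>R u) v = a * g p u v"
  and g_pos: "u \<in> T p \<Longrightarrow> u \<noteq> 0 \<Longrightarrow> g p u u > 0"
  and g_smooth: "open U \<Longrightarrow> smooth_vf \<A> U X \<Longrightarrow> smooth_vf \<A> U Y \<Longrightarrow>
    smooth_fun \<A> U (\<lambda>p. g p (X p) (Y p))"
  using metric unfolding riemannian_metric_def by blast+

lemma g_zero_left: "v \<in> T p \<Longrightarrow> g p 0 v = 0"
  using g_scale_left[of 0 p v 0] T_zero by simp

lemma g_diff_left: "u \<in> T p \<Longrightarrow> v \<in> T p \<Longrightarrow> w \<in> T p \<Longrightarrow> g p (u - v) w = g p u w - g p v w"
  using g_add_left[of u p "- v" w] g_scale_left[of v p w "-1"] T_neg by simp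

lemma g_sum_left:
  "(\<And>i. i \<in> I \<Longrightarrow> X i \<in> T p) \<Longrightarrow> v \<in> T p \<Longrightarrow> g p (\<Sum>i\<in>I. X i) v = (\<Sum>i\<in>I. g p (X i) v)"
  by (induction I rule: infinite_finite_induct) (auto simp: g_zero_left g_add_left T_sum)

text \<open>The vectors equal to their own expansion form a subspace containing each
  \<open>f i\<close>, hence the whole span. The denominators are there because the
  \<open>f i\<close> are not normalised.\<close>

lemma orthogonal_expansion:
  assumes "finite I" "\<And>i. i \<in> I \<Longrightarrow> f i \<in> T p"
    and "\<And>i j. i \<in> I \<Longrightarrow> j \<in> I \<Longrightarrow> i \<noteq> j \<Longrightarrow> g p (f i) (f j) = 0"
    and "\<And>i. i \<in> I \<Longrightarrow> f i \<noteq> 0"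
    and "v \<in> span (f ` I)"
  shows "v = (\<Sum>i\<in>I. (g p v (f i) / g p (f i) (f i)) *\<^sub>R f i)"
proof -
  let ?E = "\<lambda>v. \<Sum>i\<in>I. (g p v (f i) / g p (f i) (f i)) *\<^sub>R f i"
  let ?S = "{v \<in> T p. v = ?E v}"
  have "subspace ?S"
  proof (rule subspaceI)
    show "0 \<in> ?S"
      using assms(2) by (simp add: T_zero g_zero_left)
  next
    fix u v assume "u \<in> ?S" "v \<in> ?S"
    then have T: "u \<in> T p" "v \<in> T p" and E: "?E u = u" "?E v = v"
      by simp_all
    have "?E (u + v) = ?E u + ?E v"
      using T assms(2) by (simp add: g_add_left add_divide_distrib scaleR_add_left sum.distrib)
    then show "u + v \<in> ?S"
      unfolding E using T by (simp add: T_add)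
  next
    fix a v assume "v \<in> ?S"
    then have T: "v \<in> T p" and E: "?E v = v"
      by simp_all
    have "?E (a *\<^sub>R v) = a *\<^sub>R ?E v"
      using T assms(2) by (simp add: g_scale_left scaleR_sum_right)
    then show "a *\<^sub>R v \<in> ?S"
      unfolding E using T by (simp add: T_scale)
  qed
  moreover have "f k \<in> ?S" if "k \<in> I" for k
  proof -
    have "?E (f k) = (\<Sum>i\<in>I. if i = k then f k else 0)"
      using assms(3)[OF that] g_pos[OF assms(2,4)] that by (intro sum.cong) fastforce+
    then show ?thesis
      using that assms(1,2) by simp
  qed
  ultimately have "span (f ` I) \<subseteq> ?S"
    by (intro span_minimal) auto
  then show ?thesis
    using assms(5) by blast
qed

text \<open>The unnormalised process, at each point separately. The equation makes sense for
  arbitrary fields, by \<open>inverse 0 = 0\<close>; that no vector vanishes is a hypothesis of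
  those lemmas below which rely on it.\<close>

function gram_schmidt :: "(nat \<Rightarrow> 'm \<Rightarrow> ('m, 'e) tvec) \<Rightarrow> nat \<Rightarrow> 'm \<Rightarrow> ('m, 'e) tvec" where
  "gram_schmidt X k p = X k p - (\<Sum>j\<in>{..<k}.
     (g p (X k p) (gram_schmidt X j p) * inverse (g p (gram_schmidt X j p) (gram_schmidt X j p)))
       *\<^sub>R gram_schmidt X j p)"
  by auto
termination by (relation "Wellfounded.measure (\<lambda>(X, k, p). k)") auto

declare gram_schmidt.simps [simp del]

lemma gram_schmidt_tangent:
  assumes "\<And>k. k < N \<Longrightarrow> X k p \<in> T p"
  shows "k < N \<Longrightarrow> gram_schmidt X k p \<in> T p"
proof (induction k rule: less_induct)
  case (less k)
  then show ?case
    by (subst gram_schmidt.simps) (intro T_diff T_sum T_scale assms; simp)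
qed

text \<open>Strong induction on the larger index: in the product of the \<open>k\<close>-th vector
  with the \<open>i\<close>-th one, \<open>i < k\<close>, only the term \<open>j = i\<close> of the
  sum survives, and it cancels the product of \<open>X k p\<close> with the \<open>i\<close>-th
  vector.\<close>

lemma gram_schmidt_orthogonal:
  assumes "\<And>k. k < N \<Longrightarrow> X k p \<in> T p" "\<And>k. k < N \<Longrightarrow> gram_schmidt X k p \<noteq> 0"
    and "i < N" "j < N" "i \<noteq> j"
  shows "g p (gram_schmidt X i p) (gram_schmidt X j p) = 0"
proof -
  let ?f = "\<lambda>k. gram_schmidt X k p"
  have fT: "?f k \<in> T p" if "k < N" for k
    using gram_schmidt_tangent[of N X p] assms(1) that by blast
  have "\<forall>i<k. g p (?f k) (?f i) = 0" if "k < N" for k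
    using that
  proof (induction k rule: less_induct)
    case (less k)
    show ?case
    proof (intro allI impI)
      fix i assume "i < k"
      let ?c = "\<lambda>j. g p (X k p) (?f j) * inverse (g p (?f j) (?f j))"
      have "g p (?f k) (?f i) = g p (X k p) (?f i) - (\<Sum>j<k. ?c j * g p (?f j) (?f i))"
      proof -
        have fj: "?f j \<in> T p" if "j \<le> k" for j
          using that less.prems by (intro fT) simp
        have fi: "?f i \<in> T p"
          using \<open>i < k\<close> by (intro fj) simp
        have cf: "?c j *\<^sub>R ?f j \<in> T p" if "j \<in> {..<k}" for j
          using that by (intro T_scale fj) simp
        have "g p (?f k) (?f i) = g p (X k p - (\<Sum>j<k. ?c j *\<^sub>R ?f j)) (?f i)"
          using gram_schmidt.simps[of X k p] by presburger
        also have "\<dots> = g p (X k p) (?f i) - (\<Sum>j<k. g p (?c j *\<^sub>R ?f j) (?f i))"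
        proof -
          have "(\<Sum>j<k. ?c j *\<^sub>R ?f j) \<in> T p"
            by (intro T_sum cf)
          then show ?thesis
            using g_diff_left[OF assms(1)[OF less.prems] _ fi] g_sum_left[of "{..<k}", OF cf fi]
            by presburger
        qed
        also have "(\<Sum>j<k. g p (?c j *\<^sub>R ?f j) (?f i)) = (\<Sum>j<k. ?c j * g p (?f j) (?f i))"
          by (intro sum.cong refl g_scale_left fj fi) simp
        finally show ?thesis .
      qed
      also have "(\<Sum>j<k. ?c j * g p (?f j) (?f i)) = (\<Sum>j<k. if j = i then g p (X k p) (?f i) else 0)"
      proof (intro sum.cong refl)
        fix j assume "j \<in> {..<k}"
        \<comment> \<open>Both indices are below \<open>k\<close>, so the induction hypothesis
          applies to the larger one; symmetry of \<open>g\<close> covers the case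
          \<open>j < i\<close>.\<close>
        then have "g p (?f j) (?f i) = 0" if "j \<noteq> i"
          using less.IH[of j] less.IH[of i] less.prems \<open>i < k\<close> g_sym[OF fT fT, of i j] that
          by (cases "j < i") auto
        moreover have "g p (?f i) (?f i) \<noteq> 0"
          using g_pos[OF fT assms(2), of i] less.prems \<open>i < k\<close> by simp
        ultimately show "?c j * g p (?f j) (?f i) = (if j = i then g p (X k p) (?f i) else 0)"
          by auto
      qed
      finally show "g p (?f k) (?f i) = 0"
        using \<open>i < k\<close> by simp
    qed
  qed
  then show ?thesis
    using assms(3-5) g_sym[OF fT fT, of i j] by (metis linorder_neqE_nat)
qed

lemma gram_schmidt_span: "k < N \<Longrightarrow> X k p \<in> span ((\<lambda>k. gram_schmidt X k p) ` {..<N})"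
proof -
  assume "k < N"
  let ?S = "span ((\<lambda>k. gram_schmidt X k p) ` {..<N})"
  have *: "gram_schmidt X j p \<in> ?S" if "j \<le> k" for j
    using that \<open>k < N\<close> by (intro span_base) auto
  have "X k p = gram_schmidt X k p + (\<Sum>j\<in>{..<k}.
     (g p (X k p) (gram_schmidt X j p) * inverse (g p (gram_schmidt X j p) (gram_schmidt X j p)))
       *\<^sub>R gram_schmidt X j p)"
    by (subst (1) gram_schmidt.simps) simp
  also have "\<dots> \<in> ?S"
    by (intro span_add span_sum span_scale *) auto
  finally show ?thesis .
qed

lemma smooth_vf_gram_schmidt:
  assumes "open U" "\<And>k. k < N \<Longrightarrow> smooth_vf \<A> U (X k)"
    and "\<And>k q. k < N \<Longrightarrow> q \<in> U \<Longrightarrow> gram_schmidt X k q \<noteq> 0"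
  shows "k < N \<Longrightarrow> smooth_vf \<A> U (gram_schmidt X k)"
proof (induction k rule: less_induct)
  case (less k)
  have "gram_schmidt X j q \<in> T q" if "j < N" "q \<in> U" for j q
    using gram_schmidt_tangent[of N X q] smooth_vf_tangent[OF assms(2)] that by blast
  then have nz: "g q (gram_schmidt X j q) (gram_schmidt X j q) \<noteq> 0" if "j < N" "q \<in> U" for j q
    using g_pos assms(3) that by (metis less_irrefl)
  let ?F = "\<lambda>q. X k q - (\<Sum>j\<in>{..<k}.
     (g q (X k q) (gram_schmidt X j q) * inverse (g q (gram_schmidt X j q) (gram_schmidt X j q)))
       *\<^sub>R gram_schmidt X j q)"
  have "smooth_vf \<A> U ?F"
    by (intro smooth_vf_diff smooth_vf_sum smooth_vf_scaleR
        smooth_fun_bilinear[OF bounded_bilinear_mult] smooth_fun_inverse g_smooth)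
      (use assms less nz in auto)
  moreover have "gram_schmidt X k = ?F"
    by (intro ext gram_schmidt.simps)
  ultimately show ?case
    by (simp only:)
qed

text \<open>Gram-Schmidt is applied to the coordinate fields of one chart. It succeeds on the whole
  chart domain, since none of the resulting vectors vanishes there; the triangular shape
  \<open>tri\<close> takes the place of an argument by linear independence.\<close>

lemma local_orthogonal_frame:
  obtains U f where "open U" "p \<in> U"
    and "\<And>k. k < DIM('e) \<Longrightarrow> smooth_vf \<A> U (f k)"
    and "\<And>k q. k < DIM('e) \<Longrightarrow> q \<in> U \<Longrightarrow> f k q \<noteq> 0"
    and "\<And>i j q. i < DIM('e) \<Longrightarrow> j < DIM('e) \<Longrightarrow> i \<noteq> j \<Longrightarrow> q \<in> U \<Longrightarrow> g q (f i q) (f j q) = 0"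
    and "\<And>q. q \<in> U \<Longrightarrow> T q \<subseteq> span ((\<lambda>k. f k q) ` {..<DIM('e)})"
proof -
  obtain c where c: "c \<in> \<A>" "p \<in> fst c"
    using chart_exists by blast
  obtain b :: "nat \<Rightarrow> 'e" where b: "bij_betw b {..<DIM('e)} Basis"
    using ex_bij_betw_nat_finite[OF finite_Basis] atLeast0LessThan by metis
  define X where "X k = coord_vf c (b k)" for k
  define f where "f = gram_schmidt X"
  have X: "smooth_vf \<A> (fst c) (X k)" for k
    unfolding X_def by (rule smooth_vf_coord_vf[OF c(1)])
  have XT: "X k q \<in> T q" if "q \<in> fst c" for k q
    using smooth_vf_tangent[OF X that] .
  have inner: "b i \<bullet> b j = (if i = j then 1 else 0)" if "i < DIM('e)" "j < DIM('e)" for i j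
  proof -
    have "b i \<in> Basis" "b j \<in> Basis" "b i = b j \<longleftrightarrow> i = j"
      using b that by (auto simp: bij_betw_def inj_on_def)
    then show ?thesis
      by (simp add: inner_Basis)
  qed
  \<comment> \<open>\<open>f k\<close> is \<open>X k\<close> minus a combination of the
    \<open>f i\<close> with \<open>i < k\<close>, whose \<open>j\<close>-th coordinates vanish for
    \<open>j \<ge> k\<close>. For such \<open>j\<close> its coordinate is therefore that of
    \<open>X k\<close>, whatever the coefficients are. For \<open>j = k\<close> it is one, so
    \<open>f k\<close> is not zero.\<close>
  have tri: "f k q c \<bullet> b j = (if j = k then 1 else 0)"
    if "q \<in> fst c" "k \<le> j" "j < DIM('e)" for k j q
    using that(2)
  proof (induction k rule: less_induct)
    case (less k)
    have *: "(\<Sum>i\<in>I. h i) c = (\<Sum>i\<in>I. h i c)" for I and h :: "nat \<Rightarrow> ('m, 'e) tvec"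
      by (induction I rule: infinite_finite_induct) auto
    have "(\<Sum>i<k. a i *\<^sub>R (f i q c \<bullet> b j)) = 0" for a :: "nat \<Rightarrow> real"
      using less by (intro sum.neutral) auto
    moreover have "X k q c = b k"
      unfolding X_def by (rule coord_vf_self[OF c(1) that(1)])
    ultimately show ?case
      using inner[of k j] less.prems that(3) unfolding f_def
      by (subst gram_schmidt.simps)
        (simp add: * scaleR_fun_def inner_diff_left inner_sum_left f_def)
  qed
  have nz: "f k q \<noteq> 0" if "k < DIM('e)" "q \<in> fst c" for k q
    using tri[OF that(2) order_refl that(1)] by auto
  have "T q \<subseteq> span ((\<lambda>k. f k q) ` {..<DIM('e)})" if "q \<in> fst c" for q
  proof
    fix v assume "v \<in> T q"
    then have "v = (\<Sum>b\<in>Basis. (v c \<bullet> b) *\<^sub>R coord_vf c b q)"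
      by (rule coord_vf_expansion[OF c(1) that])
    also have "\<dots> \<in> span ((\<lambda>k. f k q) ` {..<DIM('e)})"
    proof (intro span_sum span_scale)
      fix b' :: 'e assume "b' \<in> Basis"
      then obtain k where "k < DIM('e)" "b' = b k"
        using b by (auto simp: bij_betw_def)
      then show "coord_vf c b' q \<in> span ((\<lambda>k. f k q) ` {..<DIM('e)})"
        using gram_schmidt_span[of k "DIM('e)" X q] by (simp add: X_def f_def)
    qed
    finally show "v \<in> span ((\<lambda>k. f k q) ` {..<DIM('e)})" .
  qed
  moreover have "smooth_vf \<A> (fst c) (f k)" if "k < DIM('e)" for k
    unfolding f_def
    by (rule smooth_vf_gram_schmidt[where N = "DIM('e)"])
      (use X nz that chart_domain_open[OF c(1)] in \<open>auto simp: f_def\<close>)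
  moreover have "g q (f i q) (f j q) = 0"
    if "i < DIM('e)" "j < DIM('e)" "i \<noteq> j" "q \<in> fst c" for i j q
    unfolding f_def
    by (rule gram_schmidt_orthogonal[where N = "DIM('e)"])
      (use XT nz that in \<open>auto simp: f_def\<close>)
  ultimately show ?thesis
    using that[of "fst c" f] c chart_domain_open nz by blast
qed

end

section \<open>Algebras over a field\<close>

text \<open>Unital associative algebras whose scalars form a type. Commutativity is not imposed,
  since Clifford multiplication does not commute.\<close>

locale kalgebra = ring A for A :: "('k::field, 'a) module" (structure) +
  assumes smult_closed [simp]: "x \<in> carrier A \<Longrightarrow> a \<odot> x \<in> carrier A"
    and smult_add: "x \<in> carrier A \<Longrightarrow> y \<in> carrier A \<Longrightarrow> a \<odot> (x \<oplus> y) = a \<odot> x \<oplus> a \<odot> y"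
    and add_smult: "x \<in> carrier A \<Longrightarrow> (a + b) \<odot> x = a \<odot> x \<oplus> b \<odot> x"
    and smult_smult: "x \<in> carrier A \<Longrightarrow> a \<odot> (b \<odot> x) = (a * b) \<odot> x"
    and one_smult [simp]: "x \<in> carrier A \<Longrightarrow> 1 \<odot> x = x"
    and smult_mult_left: "x \<in> carrier A \<Longrightarrow> y \<in> carrier A \<Longrightarrow> (a \<odot> x) \<otimes> y = a \<odot> (x \<otimes> y)"
    and smult_mult_right: "x \<in> carrier A \<Longrightarrow> y \<in> carrier A \<Longrightarrow> x \<otimes> (a \<odot> y) = a \<odot> (x \<otimes> y)"
begin

lemma zero_smult [simp]: "x \<in> carrier A \<Longrightarrow> 0 \<odot> x = \<zero>"
  using add_smult[of x 0 0] by (metis add.l_cancel_one' add_0 smult_closed)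

lemma smult_zero [simp]: "a \<odot> \<zero> = \<zero>"
  by (metis smult_mult_right l_null r_null zero_closed smult_closed)

lemma neg_smult: "x \<in> carrier A \<Longrightarrow> (- a) \<odot> x = \<ominus> (a \<odot> x)"
  using add_smult[of x "- a" a] by (simp add: minus_equality)

lemma smult_neg: "x \<in> carrier A \<Longrightarrow> a \<odot> (\<ominus> x) = \<ominus> (a \<odot> x)"
  using neg_smult[of x 1] neg_smult[of x a] smult_smult[of x a "-1"] by simp

lemma smult_diff: "x \<in> carrier A \<Longrightarrow> y \<in> carrier A \<Longrightarrow> a \<odot> (x \<ominus> y) = a \<odot> x \<ominus> a \<odot> y"
  by (simp add: a_minus_def smult_add smult_neg)

lemma two_smult: "x \<in> carrier A \<Longrightarrow> 2 \<odot> x = x \<oplus> x"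
  using add_smult[of x 1 1] by simp

lemma finsum_smult:
  "finite I \<Longrightarrow> f \<in> I \<rightarrow> carrier A \<Longrightarrow> (\<Oplus>i\<in>I. a \<odot> f i) = a \<odot> (\<Oplus>i\<in>I. f i)"
  by (induction I rule: finite_induct) (auto simp: smult_add Pi_def)

lemma finsum_neg:
  "finite I \<Longrightarrow> f \<in> I \<rightarrow> carrier A \<Longrightarrow> (\<Oplus>i\<in>I. \<ominus> f i) = \<ominus> (\<Oplus>i\<in>I. f i)"
  using finsum_smult[of I f "-1"] finsum_cong'[of I I "\<lambda>i. \<ominus> f i" "\<lambda>i. (-1) \<odot> f i"]
    neg_smult[of _ 1] by (auto simp: Pi_def)

lemma finsum_swap:
  assumes "finite I" "finite K" "\<And>i k. i \<in> I \<Longrightarrow> k \<in> K \<Longrightarrow> f i k \<in> carrier A"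
  shows "(\<Oplus>i\<in>I. \<Oplus>k\<in>K. f i k) = (\<Oplus>k\<in>K. \<Oplus>i\<in>I. f i k)"
  using assms(1,3)
proof (induction I rule: finite_induct)
  case (insert j I)
  have "(\<Oplus>k\<in>K. \<Oplus>i\<in>insert j I. f i k) = (\<Oplus>k\<in>K. f j k \<oplus> (\<Oplus>i\<in>I. f i k))"
    by (rule finsum_cong') (use insert in \<open>auto simp: Pi_def\<close>)
  with insert show ?case
    by (simp add: finsum_addf Pi_def)
qed (simp add: finsum_zero)

end

lemma complexification_simps [simp]:
  "carrier (complexification A) = carrier A \<times> carrier A"
  "one (complexification A) = (\<one>\<^bsub>A\<^esub>, \<zero>\<^bsub>A\<^esub>)"
  "zero (complexification A) = (\<zero>\<^bsub>A\<^esub>, \<zero>\<^bsub>A\<^esub>)"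
  "(a, b) \<oplus>\<^bsub>complexification A\<^esub> (c, d) = (a \<oplus>\<^bsub>A\<^esub> c, b \<oplus>\<^bsub>A\<^esub> d)"
  "(a, b) \<otimes>\<^bsub>complexification A\<^esub> (c, d) =
     ((a \<otimes>\<^bsub>A\<^esub> c) \<ominus>\<^bsub>A\<^esub> (b \<otimes>\<^bsub>A\<^esub> d), (a \<otimes>\<^bsub>A\<^esub> d) \<oplus>\<^bsub>A\<^esub> (b \<otimes>\<^bsub>A\<^esub> c))"
  "z \<odot>\<^bsub>complexification A\<^esub> (a, b) =
     ((Re z \<odot>\<^bsub>A\<^esub> a) \<ominus>\<^bsub>A\<^esub> (Im z \<odot>\<^bsub>A\<^esub> b), (Re z \<odot>\<^bsub>A\<^esub> b) \<oplus>\<^bsub>A\<^esub> (Im z \<odot>\<^bsub>A\<^esub> a))"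
  by (simp_all add: complexification_def)

lemma kalgebra_complexification:
  fixes A :: "(real, 'a) module" (structure)
  assumes "kalgebra A"
  shows "kalgebra (complexification A)"
proof -
  interpret kalgebra A by fact
  let ?C = "complexification A"
  have "ring ?C"
  proof (rule ringI)
    show "abelian_group ?C"
    proof (rule abelian_groupI)
      fix x assume "x \<in> carrier ?C"
      then obtain a b where x: "x = (a, b)" "a \<in> carrier A" "b \<in> carrier A" by auto
      then show "\<exists>y\<in>carrier ?C. y \<oplus>\<^bsub>?C\<^esub> x = \<zero>\<^bsub>?C\<^esub>"
        by (intro bexI[of _ "(\<ominus> a, \<ominus> b)"]) (auto simp: l_neg)
    qed (auto simp: a_ac)
    show "Group.monoid ?C"
    proof (rule monoidI)
      fix x y z assume "x \<in> carrier ?C" "y \<in> carrier ?C" "z \<in> carrier ?C"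
      then obtain a b c d e f where *: "x = (a, b)" "y = (c, d)" "z = (e, f)"
        and [simp]: "a \<in> carrier A" "b \<in> carrier A" "c \<in> carrier A" "d \<in> carrier A"
          "e \<in> carrier A" "f \<in> carrier A"
        by auto
      have "(a \<otimes> c \<ominus> b \<otimes> d) \<otimes> e \<ominus> (a \<otimes> d \<oplus> b \<otimes> c) \<otimes> f =
          a \<otimes> (c \<otimes> e \<ominus> d \<otimes> f) \<ominus> b \<otimes> (c \<otimes> f \<oplus> d \<otimes> e)"
        "(a \<otimes> c \<ominus> b \<otimes> d) \<otimes> f \<oplus> (a \<otimes> d \<oplus> b \<otimes> c) \<otimes> e =
          a \<otimes> (c \<otimes> f \<oplus> d \<otimes> e) \<oplus> b \<otimes> (c \<otimes> e \<ominus> d \<otimes> f)"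
        by (simp_all add: a_minus_def l_distr r_distr m_assoc l_minus r_minus minus_add a_ac)
      then show "x \<otimes>\<^bsub>?C\<^esub> y \<otimes>\<^bsub>?C\<^esub> z = x \<otimes>\<^bsub>?C\<^esub> (y \<otimes>\<^bsub>?C\<^esub> z)"
        by (simp add: *)
    qed (auto simp: a_minus_def)
  qed (auto simp: a_minus_def l_distr r_distr minus_add a_ac)
  then show ?thesis
    by (intro kalgebra.intro kalgebra_axioms.intro)
      (auto simp: a_minus_def smult_add add_smult smult_smult smult_mult_left smult_mult_right
        smult_neg neg_smult l_minus r_minus minus_add a_ac l_distr r_distr right_diff_distrib
        left_diff_distrib diff_conv_add_uminus simp del: add_uminus_conv_diff)
qed

text \<open>The first three parts make the real algebra a subalgebra of its complexification; the
  last one decomposes a general element, which reduces induction over the complexification to real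
  elements.\<close>

lemma kalgebra_complexification_embed:
  fixes A :: "(real, 'a) module"
  assumes "kalgebra A"
  shows "x \<in> carrier A \<Longrightarrow> y \<in> carrier A \<Longrightarrow>
      (x, \<zero>\<^bsub>A\<^esub>) \<oplus>\<^bsub>complexification A\<^esub> (y, \<zero>\<^bsub>A\<^esub>) = (x \<oplus>\<^bsub>A\<^esub> y, \<zero>\<^bsub>A\<^esub>)"
    and "x \<in> carrier A \<Longrightarrow> y \<in> carrier A \<Longrightarrow>
      (x, \<zero>\<^bsub>A\<^esub>) \<otimes>\<^bsub>complexification A\<^esub> (y, \<zero>\<^bsub>A\<^esub>) = (x \<otimes>\<^bsub>A\<^esub> y, \<zero>\<^bsub>A\<^esub>)"
    and "x \<in> carrier A \<Longrightarrow>
      complex_of_real a \<odot>\<^bsub>complexification A\<^esub> (x, \<zero>\<^bsub>A\<^esub>) = (a \<odot>\<^bsub>A\<^esub> x, \<zero>\<^bsub>A\<^esub>)"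
    and "x \<in> carrier A \<Longrightarrow> y \<in> carrier A \<Longrightarrow>
      (x, y) = (x, \<zero>\<^bsub>A\<^esub>) \<oplus>\<^bsub>complexification A\<^esub> (\<i> \<odot>\<^bsub>complexification A\<^esub> (y, \<zero>\<^bsub>A\<^esub>))"
proof -
  interpret kalgebra A by fact
  show "x \<in> carrier A \<Longrightarrow> y \<in> carrier A \<Longrightarrow>
      (x, \<zero>\<^bsub>A\<^esub>) \<oplus>\<^bsub>complexification A\<^esub> (y, \<zero>\<^bsub>A\<^esub>) = (x \<oplus>\<^bsub>A\<^esub> y, \<zero>\<^bsub>A\<^esub>)"
    "x \<in> carrier A \<Longrightarrow> y \<in> carrier A \<Longrightarrow>
      (x, \<zero>\<^bsub>A\<^esub>) \<otimes>\<^bsub>complexification A\<^esub> (y, \<zero>\<^bsub>A\<^esub>) = (x \<otimes>\<^bsub>A\<^esub> y, \<zero>\<^bsub>A\<^esub>)"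
    "x \<in> carrier A \<Longrightarrow>
      complex_of_real a \<odot>\<^bsub>complexification A\<^esub> (x, \<zero>\<^bsub>A\<^esub>) = (a \<odot>\<^bsub>A\<^esub> x, \<zero>\<^bsub>A\<^esub>)"
    "x \<in> carrier A \<Longrightarrow> y \<in> carrier A \<Longrightarrow>
      (x, y) = (x, \<zero>\<^bsub>A\<^esub>) \<oplus>\<^bsub>complexification A\<^esub> (\<i> \<odot>\<^bsub>complexification A\<^esub> (y, \<zero>\<^bsub>A\<^esub>))"
    by (simp_all add: a_minus_def)
qed

section \<open>Clifford algebras\<close>

text \<open>The basis of the free algebra. Scalars and vectors are expressed through it, so that
  their products reduce to concatenation.\<close>

definition fword :: "'v list \<Rightarrow> 'v list \<Rightarrow> real" where
  "fword u = (\<lambda>w. if w = u then 1 else 0)"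

lemma fvec_eq_fword: "fvec v = fword [v]"
  by (simp add: fvec_def fword_def)

lemma fscalar_eq_fword: "fscalar a = a *\<^sub>R fword []"
  by (auto simp: fscalar_def fword_def scaleR_fun_def)

section \<open>The free algebra and its induction principle\<close>

context
  fixes V :: "'v set"
begin

private abbreviation "F \<equiv> free_algebra V"

lemma free_algebra_add: "f \<oplus>\<^bsub>F\<^esub> h = f + h"
  and free_algebra_zero: "\<zero>\<^bsub>F\<^esub> = 0"
  and free_algebra_one: "\<one>\<^bsub>F\<^esub> = fscalar 1"
  and free_algebra_mult: "(f \<otimes>\<^bsub>F\<^esub> h) w = (\<Sum>i\<le>length w. f (take i w) * h (drop i w))"
  by (auto simp: free_algebra_def fun_eq_iff)

lemma free_algebra_carrier:
  "f \<in> carrier F \<longleftrightarrow> finite {w. f w \<noteq> 0} \<and> (\<forall>w. f w \<noteq> 0 \<longrightarrow> set w \<subseteq> V)"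
  by (simp add: free_algebra_def)

lemma free_algebra_add_closed:
  assumes "f \<in> carrier F" "h \<in> carrier F"
  shows "f + h \<in> carrier F"
proof -
  have *: "f w \<noteq> 0 \<or> h w \<noteq> 0" if "(f + h) w \<noteq> 0" for w
    using that by auto
  then have "{w. (f + h) w \<noteq> 0} \<subseteq> {w. f w \<noteq> 0} \<union> {w. h w \<noteq> 0}"
    by blast
  then have "finite {w. (f + h) w \<noteq> 0}"
    by (rule finite_subset) (use assms in \<open>simp add: free_algebra_carrier\<close>)
  then show ?thesis
    using * assms unfolding free_algebra_carrier by blast
qed

lemma free_algebra_scaleR_closed:
  assumes "f \<in> carrier F"
  shows "a *\<^sub>R f \<in> carrier F"
proof -
  have *: "f w \<noteq> 0" if "(a *\<^sub>R f) w \<noteq> 0" for w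
    using that by (auto simp: scaleR_fun_def)
  then have "{w. (a *\<^sub>R f) w \<noteq> 0} \<subseteq> {w. f w \<noteq> 0}"
    by blast
  then have "finite {w. (a *\<^sub>R f) w \<noteq> 0}"
    by (rule finite_subset) (use assms in \<open>simp add: free_algebra_carrier\<close>)
  then show ?thesis
    using * assms unfolding free_algebra_carrier by blast
qed

lemma free_algebra_diff_closed:
  "f \<in> carrier F \<Longrightarrow> h \<in> carrier F \<Longrightarrow> f - h \<in> carrier F"
  using free_algebra_add_closed[of f "(-1) *\<^sub>R h"] free_algebra_scaleR_closed[of h "-1"] by simp

lemma fword_closed: "set u \<subseteq> V \<Longrightarrow> fword u \<in> carrier F"
  by (auto simp: free_algebra_carrier fword_def)

lemma free_algebra_mult_closed:
  assumes "f \<in> carrier F" "h \<in> carrier F"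
  shows "f \<otimes>\<^bsub>F\<^esub> h \<in> carrier F"
proof -
  have *: "\<exists>u v. w = u @ v \<and> f u \<noteq> 0 \<and> h v \<noteq> 0" if "(f \<otimes>\<^bsub>F\<^esub> h) w \<noteq> 0" for w
  proof -
    obtain i where "f (take i w) * h (drop i w) \<noteq> 0"
      using \<open>(f \<otimes>\<^bsub>F\<^esub> h) w \<noteq> 0\<close> unfolding free_algebra_mult by (meson sum.not_neutral_contains_not_neutral)
    then show ?thesis
      by (intro exI[of _ "take i w"] exI[of _ "drop i w"]) simp
  qed
  then have "{w. (f \<otimes>\<^bsub>F\<^esub> h) w \<noteq> 0} \<subseteq> (\<lambda>(u, v). u @ v) ` ({w. f w \<noteq> 0} \<times> {w. h w \<noteq> 0})"
    by fastforce
  then have "finite {w. (f \<otimes>\<^bsub>F\<^esub> h) w \<noteq> 0}"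
    by (rule finite_subset) (use assms in \<open>auto simp: free_algebra_carrier\<close>)
  moreover have "set w \<subseteq> V" if "(f \<otimes>\<^bsub>F\<^esub> h) w \<noteq> 0" for w
  proof -
    obtain u v where "w = u @ v" "f u \<noteq> 0" "h v \<noteq> 0"
      using *[OF \<open>(f \<otimes>\<^bsub>F\<^esub> h) w \<noteq> 0\<close>] by blast
    then have "set u \<subseteq> V" "set v \<subseteq> V"
      using assms unfolding free_algebra_carrier by blast+
    then show ?thesis
      using \<open>w = u @ v\<close> by simp
  qed
  ultimately show ?thesis
    by (simp add: free_algebra_carrier)
qed

text \<open>Both sides sum over the ways to cut \<open>w\<close> into three pieces: the outer sum on
  the left runs over the second cut, the one on the right over the first.\<close>

lemma free_algebra_mult_assoc: "(f \<otimes>\<^bsub>F\<^esub> h) \<otimes>\<^bsub>F\<^esub> k = f \<otimes>\<^bsub>F\<^esub> (h \<otimes>\<^bsub>F\<^esub> k)"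
proof
  fix w :: "'v list"
  let ?n = "length w"
  \<comment> \<open>The third argument is a dummy giving the summand the shape required by
    \<open>fps_mult_assoc_lemma\<close>: the length of the last piece is determined by the other
    two.\<close>
  let ?t = "\<lambda>i m (_ :: nat). f (take i w) * h (take m (drop i w)) * k (drop (i + m) w)"
  have "((f \<otimes>\<^bsub>F\<^esub> h) \<otimes>\<^bsub>F\<^esub> k) w = (\<Sum>j=0..?n. \<Sum>i=0..j. ?t i (j - i) (?n - j))"
    unfolding free_algebra_mult atMost_atLeast0 sum_distrib_right
    by (auto intro!: sum.cong simp: min_absorb1 min_absorb2 drop_take)
  also have "\<dots> = (\<Sum>j=0..?n. \<Sum>i=0..?n - j. ?t j i (?n - j - i))"
    by (rule fps_mult_assoc_lemma)
  also have "\<dots> = (f \<otimes>\<^bsub>F\<^esub> (h \<otimes>\<^bsub>F\<^esub> k)) w"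
    unfolding free_algebra_mult atMost_atLeast0 sum_distrib_left
    by (auto intro!: sum.cong simp: add.commute mult.assoc)
  finally show "((f \<otimes>\<^bsub>F\<^esub> h) \<otimes>\<^bsub>F\<^esub> k) w = (f \<otimes>\<^bsub>F\<^esub> (h \<otimes>\<^bsub>F\<^esub> k)) w" .
qed

lemma fscalar_mult: "fscalar a \<otimes>\<^bsub>F\<^esub> f = a *\<^sub>R f"
proof
  fix w :: "'v list"
  have "(fscalar a \<otimes>\<^bsub>F\<^esub> f) w = (\<Sum>i\<le>length w. if i = 0 then a * f w else 0)"
    unfolding free_algebra_mult by (intro sum.cong) (auto simp: fscalar_def)
  then show "(fscalar a \<otimes>\<^bsub>F\<^esub> f) w = (a *\<^sub>R f) w"
    by (simp add: scaleR_fun_def)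
qed

lemma mult_fscalar: "f \<otimes>\<^bsub>F\<^esub> fscalar a = a *\<^sub>R f"
proof
  fix w :: "'v list"
  have "(f \<otimes>\<^bsub>F\<^esub> fscalar a) w = (\<Sum>i\<le>length w. if i = length w then a * f w else 0)"
    unfolding free_algebra_mult by (intro sum.cong) (auto simp: fscalar_def)
  then show "(f \<otimes>\<^bsub>F\<^esub> fscalar a) w = (a *\<^sub>R f) w"
    by (simp add: scaleR_fun_def)
qed

text \<open>Of all cuts of \<open>w\<close> only the one after \<open>length u\<close> letters can
  give a nonzero summand.\<close>

lemma fword_mult: "fword u \<otimes>\<^bsub>F\<^esub> fword v = fword (u @ v)"
proof
  fix w :: "'v list"
  have "(fword u \<otimes>\<^bsub>F\<^esub> fword v) w = (\<Sum>i\<le>length w. if i = length u then fword (u @ v) w else 0)"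
    unfolding free_algebra_mult
  proof (intro sum.cong refl)
    fix i assume "i \<in> {..length w}"
    show "fword u (take i w) * fword v (drop i w) =
        (if i = length u then fword (u @ v) w else 0)"
    proof (cases "take i w = u")
      case True
      then have "i = length u"
        using \<open>i \<in> {..length w}\<close> by auto
      moreover have "w = u @ drop i w"
        by (metis True append_take_drop_id)
      then have "drop i w = v \<longleftrightarrow> w = u @ v"
        by (metis same_append_eq)
      ultimately show ?thesis
        using True by (simp add: fword_def)
    next
      case False
      then have "fword (u @ v) w = 0" if "i = length u"
        using that by (auto simp: fword_def)
      then show ?thesis
        using False by (simp add: fword_def)
    qed
  qed
  also have "\<dots> = fword (u @ v) w"
    by (auto simp: fword_def)
  finally show "(fword u \<otimes>\<^bsub>F\<^esub> fword v) w = fword (u @ v) w" .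
qed

lemma free_algebra_distrib_right: "(f + h) \<otimes>\<^bsub>F\<^esub> k = f \<otimes>\<^bsub>F\<^esub> k + h \<otimes>\<^bsub>F\<^esub> k"
  by (rule ext) (simp add: free_algebra_mult distrib_right sum.distrib)

lemma free_algebra_distrib_left: "k \<otimes>\<^bsub>F\<^esub> (f + h) = k \<otimes>\<^bsub>F\<^esub> f + k \<otimes>\<^bsub>F\<^esub> h"
  by (rule ext) (simp add: free_algebra_mult distrib_left sum.distrib)

lemma free_algebra_scaleR_mult: "(a *\<^sub>R f) \<otimes>\<^bsub>F\<^esub> h = a *\<^sub>R (f \<otimes>\<^bsub>F\<^esub> h)"
  by (rule ext) (simp add: free_algebra_mult scaleR_fun_def sum_distrib_left mult.assoc)

lemma free_algebra_mult_scaleR: "f \<otimes>\<^bsub>F\<^esub> (a *\<^sub>R h) = a *\<^sub>R (f \<otimes>\<^bsub>F\<^esub> h)"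
  by (rule ext) (simp add: free_algebra_mult scaleR_fun_def sum_distrib_left mult.left_commute)

lemma fscalar_closed: "fscalar a \<in> carrier F"
  unfolding fscalar_eq_fword by (intro free_algebra_scaleR_closed fword_closed) simp

lemma free_algebra_ring: "ring F"
proof (rule ringI)
  show "abelian_group F"
  proof (rule abelian_groupI)
    fix f assume "f \<in> carrier F"
    then show "\<exists>h\<in>carrier F. h \<oplus>\<^bsub>F\<^esub> f = \<zero>\<^bsub>F\<^esub>"
      unfolding free_algebra_add free_algebra_zero
      using free_algebra_scaleR_closed[of f "-1"] by (intro bexI[of _ "(-1) *\<^sub>R f"]) simp_all
  next
    show "\<zero>\<^bsub>F\<^esub> \<in> carrier F"
      unfolding free_algebra_zero by (simp add: free_algebra_carrier)
  qed (simp_all add: free_algebra_add free_algebra_zero free_algebra_add_closed add_ac)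
  show "Group.monoid F"
    by (rule monoidI)
      (simp_all only: free_algebra_mult_assoc free_algebra_mult_closed free_algebra_one
        fscalar_mult mult_fscalar fscalar_closed scaleR_one)
qed (simp_all only: free_algebra_add free_algebra_distrib_left free_algebra_distrib_right)

text \<open>Words are products of generators, and every finitely supported function is a combination
  of words; these are split off one at a time.\<close>

lemma free_algebra_induct [consumes 1, case_names one vec add mult scale]:
  assumes "f \<in> carrier F"
    and one: "P (fscalar 1)"
    and vec: "\<And>v. v \<in> V \<Longrightarrow> P (fvec v)"
    and add: "\<And>f h. f \<in> carrier F \<Longrightarrow> h \<in> carrier F \<Longrightarrow> P f \<Longrightarrow> P h \<Longrightarrow> P (f + h)"
    and mult: "\<And>f h. f \<in> carrier F \<Longrightarrow> h \<in> carrier F \<Longrightarrow> P f \<Longrightarrow> P h \<Longrightarrow> P (f \<otimes>\<^bsub>F\<^esub> h)"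
    and scale: "\<And>a f. f \<in> carrier F \<Longrightarrow> P f \<Longrightarrow> P (a *\<^sub>R f)"
  shows "P f"
proof -
  have word: "P (fword w)" if "set w \<subseteq> V" for w
    using that
  proof (induction w)
    case Nil
    then show ?case using one by (simp add: fscalar_eq_fword)
  next
    case (Cons v w)
    then show ?case
      using mult[of "fvec v" "fword w"] vec[of v] fword_closed[of "[v]"] fword_closed[of w]
      by (simp add: fvec_eq_fword fword_mult)
  qed
  \<comment> \<open>\<open>S\<close> need only contain the support of \<open>f\<close>, so a word
    with coefficient zero is simply dropped from it.\<close>
  have "P f" if "finite S" "f \<in> carrier F" "{w. f w \<noteq> 0} \<subseteq> S" for S f
    using that
  proof (induction S arbitrary: f rule: finite_induct)
    case empty
    \<comment> \<open>The principle has no case for zero, which is reached here as a multiple of the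
      empty word.\<close>
    then have "f = 0 *\<^sub>R fword []"
      by (auto simp: scaleR_fun_def)
    moreover have "P (0 *\<^sub>R fword [])"
      by (intro scale fword_closed word) simp_all
    ultimately show ?case
      by (simp only:)
  next
    case (insert w S)
    show ?case
    proof (cases "f w = 0")
      case True
      then show ?thesis
        using insert by (intro insert.IH) auto
    next
      case False
      then have w: "set w \<subseteq> V"
        using insert.prems(1) by (auto simp: free_algebra_carrier)
      let ?h = "f - f w *\<^sub>R fword w"
      have "?h \<in> carrier F"
        using insert.prems(1) w
        by (intro free_algebra_diff_closed free_algebra_scaleR_closed fword_closed)
      moreover have "P ?h"
      proof (rule insert.IH)
        show "{u. ?h u \<noteq> 0} \<subseteq> S"
          using insert.prems(2) by (auto simp: scaleR_fun_def fword_def)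
      qed fact
      moreover have "P (f w *\<^sub>R fword w)" "f w *\<^sub>R fword w \<in> carrier F"
        using w by (auto intro!: scale fword_closed word free_algebra_scaleR_closed)
      ultimately have "P (?h + f w *\<^sub>R fword w)"
        by (intro add)
      then show ?thesis
        by simp
    qed
  qed
  then show ?thesis
    using assms(1) by (auto simp: free_algebra_carrier)
qed

end

section \<open>The Clifford algebra as a quotient, and its complexification\<close>

locale clifford =
  fixes V :: "'v::real_vector set" and B :: "'v \<Rightarrow> 'v \<Rightarrow> real"
  assumes subspace_V: "subspace V"
begin

abbreviation "F \<equiv> free_algebra V"
abbreviation "I \<equiv> clifford_ideal V B"
abbreviation "A \<equiv> clifford_algebra V B"
abbreviation "\<pi> f \<equiv> I +>\<^bsub>F\<^esub> f"
abbreviation "C \<equiv> complexification A"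

lemma relations_closed: "clifford_relations V B \<subseteq> carrier (F)"
proof -
  have v: "fvec v \<in> carrier (F)" if "v \<in> V" for v
    using fword_closed[of "[v]"] that by (simp add: fvec_eq_fword)
  show ?thesis
    unfolding clifford_relations_def
    using subspace_add[OF subspace_V] subspace_scale[OF subspace_V]
    by (auto intro!: free_algebra_diff_closed free_algebra_add_closed free_algebra_scaleR_closed
        free_algebra_mult_closed v fscalar_closed)
qed

sublocale ideal I F
  unfolding clifford_ideal_def
  by (rule ring.genideal_ideal[OF free_algebra_ring relations_closed])

lemma pi_zero: "f \<in> clifford_relations V B \<Longrightarrow> \<pi> f = \<zero>\<^bsub>A\<^esub>"
  using ring.genideal_self[OF free_algebra_ring relations_closed]
  by (auto simp: clifford_algebra_def Let_def FactRing_def clifford_ideal_def[symmetric]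
      intro!: a_rcos_const)

text \<open>With these facts, computations in \<open>A\<close> are carried out on representatives in
  the free algebra, without unfolding the quotient.\<close>

lemma
  shows pi_carrier: "carrier A = \<pi> ` carrier (F)"
    and pi_add: "f \<in> carrier (F) \<Longrightarrow> h \<in> carrier (F) \<Longrightarrow> \<pi> f \<oplus>\<^bsub>A\<^esub> \<pi> h = \<pi> (f + h)"
    and pi_mult: "f \<in> carrier (F) \<Longrightarrow> h \<in> carrier (F) \<Longrightarrow> \<pi> f \<otimes>\<^bsub>A\<^esub> \<pi> h = \<pi> (f \<otimes>\<^bsub>F\<^esub> h)"
    and pi_one: "\<one>\<^bsub>A\<^esub> = \<pi> (fscalar 1)"
    and pi_smult: "f \<in> carrier (F) \<Longrightarrow> a \<odot>\<^bsub>A\<^esub> \<pi> f = \<pi> (a *\<^sub>R f)"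
  by (auto simp: clifford_algebra_def Let_def FactRing_def A_RCOSETS_def' fscalar_mult
    rcoset_mult_add a_rcos_sum free_algebra_add free_algebra_one fscalar_closed)

text \<open>\<open>A\<close> has the ring operations of the quotient but is a record extended by
  scalar multiplication, so the ring laws are transferred one by one.\<close>

lemma ring_A: "ring A"
proof -
  interpret Q: ring "F Quot I"
    by (rule quotient_is_ring)
  have A: "carrier A = carrier (F Quot I)" "monoid.mult A = monoid.mult (F Quot I)"
    "one A = one (F Quot I)" "zero A = zero (F Quot I)" "add A = add (F Quot I)"
    by (simp_all add: clifford_algebra_def Let_def)
  show ?thesis
    by (intro ringI abelian_groupI monoidI; unfold A)
      (auto simp: Q.l_distr Q.r_distr Q.m_assoc Q.a_ac intro: Q.l_neg)
qed

lemma kalgebra_A: "kalgebra A"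
  by (intro kalgebra.intro kalgebra_axioms.intro ring_A)
    (auto simp: pi_carrier pi_add pi_mult pi_smult free_algebra_add_closed
      free_algebra_scaleR_closed free_algebra_mult_closed scaleR_add_right scaleR_add_left
      free_algebra_scaleR_mult free_algebra_mult_scaleR)


abbreviation "cv v \<equiv> (clifford_vec V B v, \<zero>\<^bsub>A\<^esub>)"

lemma kalgebra_C: "kalgebra C"
  by (rule kalgebra_complexification[OF kalgebra_A])

lemma fvec_closed: "v \<in> V \<Longrightarrow> fvec v \<in> carrier (F)"
  unfolding fvec_eq_fword by (rule fword_closed) simp

text \<open>The defining relations are elements of the ideal; this turns each of them into an
  equation between classes.\<close>

lemma pi_eq:
  assumes "f - h \<in> clifford_relations V B" "h \<in> carrier (F)"
  shows "\<pi> f = \<pi> h"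
proof -
  interpret A: kalgebra A by (rule kalgebra_A)
  have "\<pi> f = \<pi> ((f - h) + h)"
    by simp
  also have "\<dots> = \<pi> (f - h) \<oplus>\<^bsub>A\<^esub> \<pi> h"
    using assms relations_closed by (subst pi_add) auto
  also have "\<dots> = \<pi> h"
    using assms by (simp add: pi_zero pi_carrier)
  finally show ?thesis .
qed

lemma clifford_vec_closed: "v \<in> V \<Longrightarrow> clifford_vec V B v \<in> carrier A"
  by (simp add: clifford_vec_def pi_carrier fvec_closed)

lemma clifford_vec_add:
  assumes "v \<in> V" "w \<in> V"
  shows "clifford_vec V B (v + w) = clifford_vec V B v \<oplus>\<^bsub>A\<^esub> clifford_vec V B w"
proof -
  have "fvec (v + w) - (fvec v + fvec w) \<in> clifford_relations V B"
    unfolding clifford_relations_def using assms by (auto simp: algebra_simps)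
  from pi_eq[OF this] show ?thesis
    using assms by (simp add: clifford_vec_def pi_add fvec_closed free_algebra_add_closed)
qed

lemma clifford_vec_scale:
  assumes "v \<in> V"
  shows "clifford_vec V B (a *\<^sub>R v) = a \<odot>\<^bsub>A\<^esub> clifford_vec V B v"
proof -
  have "fvec (a *\<^sub>R v) - a *\<^sub>R fvec v \<in> clifford_relations V B"
    unfolding clifford_relations_def using assms by blast
  from pi_eq[OF this] show ?thesis
    using assms by (simp add: clifford_vec_def pi_smult fvec_closed free_algebra_scaleR_closed)
qed

lemma clifford_vec_anticommute:
  assumes "v \<in> V" "w \<in> V"
  shows "clifford_vec V B v \<otimes>\<^bsub>A\<^esub> clifford_vec V B w \<oplus>\<^bsub>A\<^esub>
    clifford_vec V B w \<otimes>\<^bsub>A\<^esub> clifford_vec V B v = (- 2 * B v w) \<odot>\<^bsub>A\<^esub> \<one>\<^bsub>A\<^esub>"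
proof -
  let ?f = "fvec v \<otimes>\<^bsub>F\<^esub> fvec w + fvec w \<otimes>\<^bsub>F\<^esub> fvec v"
  have "?f - (- 2 * B v w) *\<^sub>R fscalar 1 = ?f + fscalar (2 * B v w)"
    by (simp add: fscalar_eq_fword)
  then have "?f - (- 2 * B v w) *\<^sub>R fscalar 1 \<in> clifford_relations V B"
    unfolding clifford_relations_def using assms by blast
  from pi_eq[OF this free_algebra_scaleR_closed[OF fscalar_closed]] show ?thesis
    using assms by (simp add: clifford_vec_def pi_add pi_mult pi_smult pi_one fvec_closed
        fscalar_closed free_algebra_scaleR_closed free_algebra_mult_closed)
qed

lemma cv_closed: "v \<in> V \<Longrightarrow> cv v \<in> carrier C"
  using kalgebra_A clifford_vec_closed
  by (simp add: kalgebra_def ring.ring_simprules(2))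

lemma cv_add: "v \<in> V \<Longrightarrow> w \<in> V \<Longrightarrow> cv (v + w) = cv v \<oplus>\<^bsub>C\<^esub> cv w"
  by (simp only: clifford_vec_add kalgebra_complexification_embed(1)[OF kalgebra_A] clifford_vec_closed)

lemma cv_scale: "v \<in> V \<Longrightarrow> cv (a *\<^sub>R v) = complex_of_real a \<odot>\<^bsub>C\<^esub> cv v"
  by (simp only: clifford_vec_scale kalgebra_complexification_embed(3)[OF kalgebra_A] clifford_vec_closed)

lemma cv_anticommute:
  assumes "v \<in> V" "w \<in> V"
  shows "cv v \<otimes>\<^bsub>C\<^esub> cv w \<oplus>\<^bsub>C\<^esub> cv w \<otimes>\<^bsub>C\<^esub> cv v = complex_of_real (- 2 * B v w) \<odot>\<^bsub>C\<^esub> \<one>\<^bsub>C\<^esub>"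
proof -
  interpret A: kalgebra A by (rule kalgebra_A)
  note embed = kalgebra_complexification_embed[OF kalgebra_A]
  have [simp]: "clifford_vec V B v \<in> carrier A" "clifford_vec V B w \<in> carrier A"
    using assms by (simp_all add: clifford_vec_closed)
  have "cv v \<otimes>\<^bsub>C\<^esub> cv w \<oplus>\<^bsub>C\<^esub> cv w \<otimes>\<^bsub>C\<^esub> cv v = ((- 2 * B v w) \<odot>\<^bsub>A\<^esub> \<one>\<^bsub>A\<^esub>, \<zero>\<^bsub>A\<^esub>)"
    unfolding clifford_vec_anticommute[OF assms, symmetric]
    by (simp only: embed(1,2) A.m_closed \<open>clifford_vec V B v \<in> carrier A\<close> \<open>clifford_vec V B w \<in> carrier A\<close>)
  also have "\<dots> = complex_of_real (- 2 * B v w) \<odot>\<^bsub>C\<^esub> \<one>\<^bsub>C\<^esub>"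
    unfolding complexification_simps(2)
    by (simp only: embed(3) A.one_closed A.zero_closed)
  finally show ?thesis .
qed

text \<open>Meant for identities whose two sides are linear and behave alike under products, such as
  those between derivations or between algebra maps: only the case of vectors then needs a geometric
  argument.\<close>

lemma induct_C [consumes 1, case_names one vec add mult smult]:
  assumes "x \<in> carrier C"
    and one: "P \<one>\<^bsub>C\<^esub>"
    and vec: "\<And>v. v \<in> V \<Longrightarrow> P (cv v)"
    and add: "\<And>x y. x \<in> carrier C \<Longrightarrow> y \<in> carrier C \<Longrightarrow> P x \<Longrightarrow> P y \<Longrightarrow> P (x \<oplus>\<^bsub>C\<^esub> y)"
    and mult: "\<And>x y. x \<in> carrier C \<Longrightarrow> y \<in> carrier C \<Longrightarrow> P x \<Longrightarrow> P y \<Longrightarrow> P (x \<otimes>\<^bsub>C\<^esub> y)"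
    and smult: "\<And>z x. x \<in> carrier C \<Longrightarrow> P x \<Longrightarrow> P (z \<odot>\<^bsub>C\<^esub> x)"
  shows "P x"
proof -
  interpret A: kalgebra A by (rule kalgebra_A)
  interpret C: kalgebra C by (rule kalgebra_C)
  note embed = kalgebra_complexification_embed[OF kalgebra_A]
  have cl: "\<pi> f \<in> carrier A" "(\<pi> f, \<zero>\<^bsub>A\<^esub>) \<in> carrier C" if "f \<in> carrier (F)" for f
  proof -
    show "\<pi> f \<in> carrier A"
      using that by (simp add: pi_carrier)
    then show "(\<pi> f, \<zero>\<^bsub>A\<^esub>) \<in> carrier C"
      by simp
  qed
  \<comment> \<open>Elements with zero imaginary part come first, by induction on a representative
    in the free algebra.\<close>
  have real: "P (\<pi> f, \<zero>\<^bsub>A\<^esub>)" if "f \<in> carrier (F)" for f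
    using that
  proof (induction f rule: free_algebra_induct)
    case one
    then show ?case using assms(2) by (simp add: pi_one)
  next
    case (vec v)
    then show ?case using assms(3)[of v] by (simp add: clifford_vec_def)
  next
    case (add f h)
    then show ?case
      using assms(4)[of "(\<pi> f, \<zero>\<^bsub>A\<^esub>)" "(\<pi> h, \<zero>\<^bsub>A\<^esub>)"] cl by (simp add: embed(1) pi_add plus_fun_def)
  next
    case (mult f h)
    then show ?case
      using assms(5)[of "(\<pi> f, \<zero>\<^bsub>A\<^esub>)" "(\<pi> h, \<zero>\<^bsub>A\<^esub>)"] cl free_algebra_mult_closed[of f V h]
      by (simp add: a_minus_def pi_mult)
  next
    case (scale a f)
    then show ?case
      using assms(6)[of "(\<pi> f, \<zero>\<^bsub>A\<^esub>)" "complex_of_real a"] cl embed(3)[of "\<pi> f" a]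
      by (simp add: a_minus_def pi_smult)
  qed
  obtain f h where "f \<in> carrier (F)" "h \<in> carrier (F)" and x: "x = (\<pi> f, \<pi> h)"
    using assms(1) by (auto simp: pi_carrier)
  then show ?thesis
    unfolding x
    using embed(4)[of "\<pi> f" "\<pi> h"] cl real assms(4,6) C.smult_closed by metis
qed

end

section \<open>Smooth sections of the Clifford bundle\<close>

context riemannian_manifold
begin

abbreviation "CL p \<equiv> Cl \<A> g p"
abbreviation "cv p v \<equiv> cvec \<A> g p v"

lemma clifford_at: "clifford (T p)"
  by unfold_locales (rule tangent_space_subspace)

lemma kalgebra_CL: "kalgebra (CL p)"
  unfolding Cl_def by (rule clifford.kalgebra_C[OF clifford_at])

sublocale CL: kalgebra "CL p" for p
  by (rule kalgebra_CL)

lemma cv_closed: "v \<in> T p \<Longrightarrow> cv p v \<in> carrier (CL p)"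
  unfolding Cl_def cvec_def by (rule clifford.cv_closed[OF clifford_at])

lemma cv_add: "u \<in> T p \<Longrightarrow> v \<in> T p \<Longrightarrow> cv p (u + v) = cv p u \<oplus>\<^bsub>CL p\<^esub> cv p v"
  unfolding Cl_def cvec_def by (rule clifford.cv_add[OF clifford_at])

lemma cv_scale: "v \<in> T p \<Longrightarrow> cv p (a *\<^sub>R v) = complex_of_real a \<odot>\<^bsub>CL p\<^esub> cv p v"
  unfolding Cl_def cvec_def by (rule clifford.cv_scale[OF clifford_at])

lemma cv_anticommute: "u \<in> T p \<Longrightarrow> v \<in> T p \<Longrightarrow>
    cv p u \<otimes>\<^bsub>CL p\<^esub> cv p v \<oplus>\<^bsub>CL p\<^esub> cv p v \<otimes>\<^bsub>CL p\<^esub> cv p u =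
      complex_of_real (- 2 * g p u v) \<odot>\<^bsub>CL p\<^esub> \<one>\<^bsub>CL p\<^esub>"
  unfolding Cl_def cvec_def by (rule clifford.cv_anticommute[OF clifford_at])

lemmas CL_induct [consumes 1, case_names one vec add mult smult] =
  clifford.induct_C[OF clifford_at[of p], where B = "g p", folded Cl_def cvec_def] for p

lemma cv_zero: "cv p 0 = \<zero>\<^bsub>CL p\<^esub>"
  using cv_scale[OF T_zero, of p 0] cv_closed[OF T_zero] by simp

lemma cv_neg: "v \<in> T p \<Longrightarrow> cv p (- v) = \<ominus>\<^bsub>CL p\<^esub> cv p v"
  using cv_scale[of v p "-1"] cv_closed[of v p] CL.neg_smult[of "cv p v" p 1] by simp

lemma cv_sum:
  "finite I \<Longrightarrow> (\<And>i. i \<in> I \<Longrightarrow> v i \<in> T p) \<Longrightarrow>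
    cv p (\<Sum>i\<in>I. v i) = (\<Oplus>\<^bsub>CL p\<^esub>i\<in>I. cv p (v i))"
  by (induction I rule: finite_induct)
    (auto simp: cv_zero cv_add T_sum cv_closed Pi_def)

section \<open>Products of vector fields and locally smooth sections\<close>

definition word :: "('m \<Rightarrow> ('m, 'e) tvec) list \<Rightarrow> 'm \<Rightarrow> ('m, 'e) cliff" where
  "word X q = foldr (\<lambda>Y x. cv q (Y q) \<otimes>\<^bsub>CL q\<^esub> x) X \<one>\<^bsub>CL q\<^esub>"

lemma word_Nil [simp]: "word [] q = \<one>\<^bsub>CL q\<^esub>"
  and word_Cons [simp]: "word (Y # X) q = cv q (Y q) \<otimes>\<^bsub>CL q\<^esub> word X q"
  by (simp_all add: word_def)

lemma word_closed: "(\<And>Y. Y \<in> set X \<Longrightarrow> Y q \<in> T q) \<Longrightarrow> word X q \<in> carrier (CL q)"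
  by (induction X) (auto simp: cv_closed)

lemma word_append:
  "(\<And>Y. Y \<in> set (X @ Z) \<Longrightarrow> Y q \<in> T q) \<Longrightarrow> word (X @ Z) q = word X q \<otimes>\<^bsub>CL q\<^esub> word Z q"
  by (induction X) (auto simp: cv_closed word_closed CL.m_assoc)

text \<open>The finite sums from the definition of \<open>smooth_section\<close>, generated one term
  at a time, so that closure properties follow by rule induction rather than by work with indexed
  families. The rules constrain values on \<open>U\<close> only.\<close>

inductive smooth_locally :: "'m set \<Rightarrow> ('m \<Rightarrow> ('m, 'e) cliff) \<Rightarrow> bool" for U where
  zero: "(\<And>q. q \<in> U \<Longrightarrow> s q = \<zero>\<^bsub>CL q\<^esub>) \<Longrightarrow> smooth_locally U s"
| step: "smooth_locally U s \<Longrightarrow> smooth_fun \<A> U f \<Longrightarrow> (\<And>Y. Y \<in> set X \<Longrightarrow> smooth_vf \<A> U Y) \<Longrightarrow>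
    (\<And>q. q \<in> U \<Longrightarrow> t q = (f q \<odot>\<^bsub>CL q\<^esub> word X q) \<oplus>\<^bsub>CL q\<^esub> s q) \<Longrightarrow> smooth_locally U t"

lemma smooth_locally_closed: "smooth_locally U s \<Longrightarrow> q \<in> U \<Longrightarrow> s q \<in> carrier (CL q)"
proof (induction rule: smooth_locally.induct)
  case (step s f X t)
  then have "word X q \<in> carrier (CL q)"
    by (intro word_closed smooth_vf_tangent)
  with step show ?case by simp
qed simp

lemma smooth_locally_cong:
  assumes "smooth_locally U s" "\<And>q. q \<in> U \<Longrightarrow> t q = s q"
  shows "smooth_locally U t"
  using assms
proof (cases rule: smooth_locally.cases)
  case zero
  then show ?thesis using assms(2) by (intro smooth_locally.zero) simp
next
  case (step s' f X)
  then show ?thesis using assms(2) by (intro smooth_locally.step[of U s' f X t]) auto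
qed

lemma smooth_locally_subset:
  "smooth_locally U s \<Longrightarrow> W \<subseteq> U \<Longrightarrow> smooth_locally W s"
proof (induction rule: smooth_locally.induct)
  case (zero s)
  then show ?case by (intro smooth_locally.zero) auto
next
  case (step s f X t)
  then show ?case
    by (intro smooth_locally.step[of W s f X t]) (auto intro: smooth_fun_subset smooth_vf_subset)
qed

lemma smooth_locally_term:
  assumes "smooth_fun \<A> U f" "\<And>Y. Y \<in> set X \<Longrightarrow> smooth_vf \<A> U Y"
  shows "smooth_locally U (\<lambda>q. f q \<odot>\<^bsub>CL q\<^esub> word X q)"
proof (rule smooth_locally.step[OF _ assms])
  show "smooth_locally U (\<lambda>q. \<zero>\<^bsub>CL q\<^esub>)"
    by (rule smooth_locally.zero) simp
  show "f q \<odot>\<^bsub>CL q\<^esub> word X q = f q \<odot>\<^bsub>CL q\<^esub> word X q \<oplus>\<^bsub>CL q\<^esub> \<zero>\<^bsub>CL q\<^esub>" if "q \<in> U" for q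
    using word_closed[of X q] smooth_vf_tangent[OF assms(2) that] by simp
qed

lemma smooth_locally_add:
  "smooth_locally U s \<Longrightarrow> smooth_locally U t \<Longrightarrow> smooth_locally U (\<lambda>q. s q \<oplus>\<^bsub>CL q\<^esub> t q)"
proof (induction rule: smooth_locally.induct)
  case (zero s)
  show ?case
    by (rule smooth_locally_cong[OF zero(2)])
      (simp add: zero(1) smooth_locally_closed[OF zero(2)])
next
  case (step s f X s')
  show ?case
  proof (rule smooth_locally.step[OF step.IH[OF step.prems] step.hyps(2,3)])
    fix q assume "q \<in> U"
    moreover from this have "word X q \<in> carrier (CL q)"
      by (intro word_closed smooth_vf_tangent[OF step.hyps(3)])
    ultimately show "s' q \<oplus>\<^bsub>CL q\<^esub> t q = f q \<odot>\<^bsub>CL q\<^esub> word X q \<oplus>\<^bsub>CL q\<^esub> (s q \<oplus>\<^bsub>CL q\<^esub> t q)"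
      using step smooth_locally_closed by (simp add: CL.a_assoc)
  qed
qed

lemma smooth_locally_finsum:
  assumes "finite K" "\<And>k. k \<in> K \<Longrightarrow> smooth_locally U (s k)"
  shows "smooth_locally U (\<lambda>q. \<Oplus>\<^bsub>CL q\<^esub>k\<in>K. s k q)"
  using assms
proof (induction K rule: finite_induct)
  case empty
  show ?case by (rule smooth_locally.zero) simp
next
  case (insert j K)
  have "smooth_locally U (\<lambda>q. s j q \<oplus>\<^bsub>CL q\<^esub> (\<Oplus>\<^bsub>CL q\<^esub>k\<in>K. s k q))"
    using insert by (intro smooth_locally_add) auto
  then show ?case
  proof (rule smooth_locally_cong)
    fix q assume "q \<in> U"
    then have "s k q \<in> carrier (CL q)" if "k \<in> insert j K" for k
      using insert.prems that by (auto intro: smooth_locally_closed)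
    then show "(\<Oplus>\<^bsub>CL q\<^esub>k\<in>insert j K. s k q) = s j q \<oplus>\<^bsub>CL q\<^esub> (\<Oplus>\<^bsub>CL q\<^esub>k\<in>K. s k q)"
      using insert.hyps by (intro CL.finsum_insert) auto
  qed
qed

lemma smooth_locally_smult:
  assumes "open U" "smooth_fun \<A> U (h :: 'm \<Rightarrow> complex)"
  shows "smooth_locally U s \<Longrightarrow> smooth_locally U (\<lambda>q. h q \<odot>\<^bsub>CL q\<^esub> s q)"
proof (induction rule: smooth_locally.induct)
  case (zero s)
  then show ?case by (intro smooth_locally.zero) simp
next
  case (step s f X t)
  have hf: "smooth_fun \<A> U (\<lambda>q. h q * f q)"
    by (rule smooth_fun_bilinear[OF bounded_bilinear_mult assms step.hyps(2)])
  show ?case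
  proof (rule smooth_locally.step[OF step.IH hf step.hyps(3)])
    fix q assume "q \<in> U"
    moreover from this have "word X q \<in> carrier (CL q)"
      by (intro word_closed smooth_vf_tangent[OF step.hyps(3)])
    ultimately show "h q \<odot>\<^bsub>CL q\<^esub> t q =
        (h q * f q) \<odot>\<^bsub>CL q\<^esub> word X q \<oplus>\<^bsub>CL q\<^esub> h q \<odot>\<^bsub>CL q\<^esub> s q"
      using step smooth_locally_closed by (simp add: CL.smult_add CL.smult_smult)
  qed
qed

lemma smooth_locally_word_mult:
  assumes X: "\<And>Y. Y \<in> set X \<Longrightarrow> smooth_vf \<A> U Y"
  shows "smooth_locally U s \<Longrightarrow> smooth_locally U (\<lambda>q. word X q \<otimes>\<^bsub>CL q\<^esub> s q)"
proof (induction rule: smooth_locally.induct)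
  case (zero s)
  then show ?case
    by (intro smooth_locally.zero) (simp add: word_closed smooth_vf_tangent[OF X])
next
  case (step s f Z t)
  have XZ: "smooth_vf \<A> U Y" if "Y \<in> set (X @ Z)" for Y
    using that X step.hyps(3) by auto
  show ?case
  proof (rule smooth_locally.step[OF step.IH step.hyps(2) XZ])
    fix q assume "q \<in> U"
    moreover from this have "word X q \<in> carrier (CL q)" "word Z q \<in> carrier (CL q)"
      "word (X @ Z) q = word X q \<otimes>\<^bsub>CL q\<^esub> word Z q"
      by (auto intro!: word_append word_closed smooth_vf_tangent[OF XZ])
    ultimately show "word X q \<otimes>\<^bsub>CL q\<^esub> t q =
        f q \<odot>\<^bsub>CL q\<^esub> word (X @ Z) q \<oplus>\<^bsub>CL q\<^esub> word X q \<otimes>\<^bsub>CL q\<^esub> s q"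
      using step smooth_locally_closed by (simp add: CL.r_distr CL.smult_mult_right)
  qed
qed

text \<open>Induction on the left factor: a single term of it multiplies \<open>t\<close> by a word
  and then by a smooth coefficient, and both operations are already covered.\<close>

lemma smooth_locally_mult:
  assumes "open U" and t: "smooth_locally U t"
  shows "smooth_locally U s \<Longrightarrow> smooth_locally U (\<lambda>q. s q \<otimes>\<^bsub>CL q\<^esub> t q)"
proof (induction rule: smooth_locally.induct)
  case (zero s)
  then show ?case
    using smooth_locally_closed[OF t] by (intro smooth_locally.zero) simp
next
  case (step s f X s')
  have "smooth_locally U
      (\<lambda>q. f q \<odot>\<^bsub>CL q\<^esub> (word X q \<otimes>\<^bsub>CL q\<^esub> t q) \<oplus>\<^bsub>CL q\<^esub> s q \<otimes>\<^bsub>CL q\<^esub> t q)"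
    by (intro smooth_locally_add step.IH smooth_locally_smult[OF assms(1) step.hyps(2)]
        smooth_locally_word_mult[OF step.hyps(3) t])
  then show ?case
  proof (rule smooth_locally_cong)
    fix q assume "q \<in> U"
    moreover from this have "word X q \<in> carrier (CL q)"
      by (intro word_closed smooth_vf_tangent[OF step.hyps(3)])
    ultimately show "s' q \<otimes>\<^bsub>CL q\<^esub> t q =
        f q \<odot>\<^bsub>CL q\<^esub> (word X q \<otimes>\<^bsub>CL q\<^esub> t q) \<oplus>\<^bsub>CL q\<^esub> s q \<otimes>\<^bsub>CL q\<^esub> t q"
      using step smooth_locally_closed t by (simp add: CL.l_distr CL.smult_mult_left)
  qed
qed

text \<open>Connects the inductive description with the indexed sums in the definition of
  \<open>smooth_section\<close>.\<close>

lemma smooth_locally_iff: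
  "smooth_locally U s \<longleftrightarrow>
    (\<exists>(N::nat) (f :: nat \<Rightarrow> 'm \<Rightarrow> complex) X.
      (\<forall>k<N. smooth_fun \<A> U (f k) \<and> (\<forall>Y\<in>set (X k). smooth_vf \<A> U Y)) \<and>
      (\<forall>q\<in>U. s q = (\<Oplus>\<^bsub>CL q\<^esub>k\<in>{..<N}. f k q \<odot>\<^bsub>CL q\<^esub> word (X k) q)))"
    (is "_ \<longleftrightarrow> ?R s")
proof
  show "?R s" if "smooth_locally U s"
    using that
  proof (induction rule: smooth_locally.induct)
    case (zero s)
    then show ?case by (intro exI[of _ 0]) simp
  next
    case (step s f X t)
    then obtain N :: nat and f' :: "nat \<Rightarrow> 'm \<Rightarrow> complex" and X'
      where "(\<forall>k<N. smooth_fun \<A> U (f' k) \<and> (\<forall>Y\<in>set (X' k). smooth_vf \<A> U Y)) \<and>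
        (\<forall>q\<in>U. s q = (\<Oplus>\<^bsub>CL q\<^esub>k\<in>{..<N}. f' k q \<odot>\<^bsub>CL q\<^esub> word (X' k) q))"
      by blast
    then have *: "\<And>k. k < N \<Longrightarrow> smooth_fun \<A> U (f' k)"
        "\<And>k Y. k < N \<Longrightarrow> Y \<in> set (X' k) \<Longrightarrow> smooth_vf \<A> U Y"
        "\<And>q. q \<in> U \<Longrightarrow> s q = (\<Oplus>\<^bsub>CL q\<^esub>k\<in>{..<N}. f' k q \<odot>\<^bsub>CL q\<^esub> word (X' k) q)"
      by blast+
    \<comment> \<open>The new term takes the free index \<open>N\<close>, so the terms below
      \<open>N\<close> stay as they were.\<close>
    let ?f = "f'(N := f)" and ?X = "X'(N := X)"
    have sm: "smooth_fun \<A> U (?f k)" "\<And>Y. Y \<in> set (?X k) \<Longrightarrow> smooth_vf \<A> U Y" if "k < Suc N" for k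
      using that * step.hyps by (auto simp: less_Suc_eq split: if_splits)
    have "t q = (\<Oplus>\<^bsub>CL q\<^esub>k\<in>{..<Suc N}. ?f k q \<odot>\<^bsub>CL q\<^esub> word (?X k) q)" if q: "q \<in> U" for q
    proof -
      have cl: "?f k q \<odot>\<^bsub>CL q\<^esub> word (?X k) q \<in> carrier (CL q)" if "k < Suc N" for k
        using sm(2)[OF that] q by (intro CL.smult_closed word_closed smooth_vf_tangent)
      have "(\<Oplus>\<^bsub>CL q\<^esub>k\<in>{..<Suc N}. ?f k q \<odot>\<^bsub>CL q\<^esub> word (?X k) q) =
          ?f N q \<odot>\<^bsub>CL q\<^esub> word (?X N) q \<oplus>\<^bsub>CL q\<^esub>
          (\<Oplus>\<^bsub>CL q\<^esub>k\<in>{..<N}. ?f k q \<odot>\<^bsub>CL q\<^esub> word (?X k) q)"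
        unfolding lessThan_Suc by (rule CL.finsum_insert)
          (use cl in \<open>simp_all add: Pi_def del: fun_upd_apply\<close>)
      also have "(\<Oplus>\<^bsub>CL q\<^esub>k\<in>{..<N}. ?f k q \<odot>\<^bsub>CL q\<^esub> word (?X k) q) = s q"
      proof -
        have "f' k q \<odot>\<^bsub>CL q\<^esub> word (X' k) q \<in> carrier (CL q)" if "k < N" for k
          using cl[of k] that by simp
        then show ?thesis
          unfolding *(3)[OF q] by (intro CL.finsum_cong') auto
      qed
      finally show ?thesis
        using step.hyps(4)[OF q] by simp
    qed
    with sm show ?case
      by (intro exI[of _ "Suc N"] exI[of _ ?f] exI[of _ ?X]) blast
  qed
next
  assume "?R s"
  then obtain N :: nat and f :: "nat \<Rightarrow> 'm \<Rightarrow> complex" and X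
    where "(\<forall>k<N. smooth_fun \<A> U (f k) \<and> (\<forall>Y\<in>set (X k). smooth_vf \<A> U Y)) \<and>
      (\<forall>q\<in>U. s q = (\<Oplus>\<^bsub>CL q\<^esub>k\<in>{..<N}. f k q \<odot>\<^bsub>CL q\<^esub> word (X k) q))"
    by blast
  then have *: "\<And>k. k < N \<Longrightarrow> smooth_fun \<A> U (f k)"
      "\<And>k Y. k < N \<Longrightarrow> Y \<in> set (X k) \<Longrightarrow> smooth_vf \<A> U Y"
      "\<And>q. q \<in> U \<Longrightarrow> s q = (\<Oplus>\<^bsub>CL q\<^esub>k\<in>{..<N}. f k q \<odot>\<^bsub>CL q\<^esub> word (X k) q)"
    by blast+
  have "smooth_locally U (\<lambda>q. \<Oplus>\<^bsub>CL q\<^esub>k\<in>{..<N}. f k q \<odot>\<^bsub>CL q\<^esub> word (X k) q)"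
    using * by (intro smooth_locally_finsum smooth_locally_term) auto
  then show "smooth_locally U s"
    by (rule smooth_locally_cong) (rule *(3))
qed

lemma smooth_section_iff:
  "smooth_section \<A> g s \<longleftrightarrow> (\<forall>p. \<exists>U. open U \<and> p \<in> U \<and> smooth_locally U s)"
proof -
  have "smooth_section \<A> g s \<longleftrightarrow> (\<forall>p. s p \<in> carrier (CL p)) \<and>
      (\<forall>p. \<exists>U. open U \<and> p \<in> U \<and> smooth_locally U s)"
    unfolding smooth_section_def smooth_locally_iff word_def by metis
  then show ?thesis
    using smooth_locally_closed by blast
qed

lemma smooth_section_closed: "smooth_section \<A> g s \<Longrightarrow> s p \<in> carrier (CL p)"
  by (simp add: smooth_section_def)

text \<open>The two sections may come with different neighbourhoods of a point; the intersection
  serves both.\<close>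

lemma smooth_section_binop:
  assumes "smooth_section \<A> g s" "smooth_section \<A> g t"
    and "\<And>U. open U \<Longrightarrow> smooth_locally U s \<Longrightarrow> smooth_locally U t \<Longrightarrow> smooth_locally U r"
  shows "smooth_section \<A> g r"
  unfolding smooth_section_iff
proof
  fix p
  obtain U W where "open U" "p \<in> U" "smooth_locally U s" "open W" "p \<in> W" "smooth_locally W t"
    using assms(1,2) unfolding smooth_section_iff by meson
  then show "\<exists>U. open U \<and> p \<in> U \<and> smooth_locally U r"
    using assms(3)[of "U \<inter> W"] smooth_locally_subset by (intro exI[of _ "U \<inter> W"]) blast
qed

lemma smooth_section_add:
  "smooth_section \<A> g s \<Longrightarrow> smooth_section \<A> g t \<Longrightarrow> smooth_section \<A> g (\<lambda>q. s q \<oplus>\<^bsub>CL q\<^esub> t q)"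
  by (rule smooth_section_binop[of s t]) (blast intro: smooth_locally_add)+

lemma smooth_section_mult:
  "smooth_section \<A> g s \<Longrightarrow> smooth_section \<A> g t \<Longrightarrow> smooth_section \<A> g (\<lambda>q. s q \<otimes>\<^bsub>CL q\<^esub> t q)"
  by (rule smooth_section_binop[of s t]) (blast intro: smooth_locally_mult)+

lemma smooth_section_smult:
  "smooth_section \<A> g s \<Longrightarrow> smooth_section \<A> g (\<lambda>q. z \<odot>\<^bsub>CL q\<^esub> s q)"
  by (rule smooth_section_binop[of s s]) (assumption+, rule smooth_locally_smult[OF _ smooth_fun_const])

end

section \<open>The fundamental element\<close>

text \<open>Used to group sums over an adapted frame into the pairs \<open>e p i\<close>,
  \<open>e p (i + n)\<close> on which \<open>J\<close> acts.\<close>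

lemma (in kalgebra) finsum_double:
  assumes "\<And>i. i \<in> {1..2*n::nat} \<Longrightarrow> f i \<in> carrier A"
  shows "(\<Oplus>i\<in>{1..2*n}. f i) = (\<Oplus>i\<in>{1..n}. f i \<oplus> f (i + n))"
proof -
  have "{1..2*n} = {1..n} \<union> (\<lambda>i. i + n) ` {1..n}"
    by (auto simp: image_iff intro!: bexI[of _ "_ - n"])
  then have "(\<Oplus>i\<in>{1..2*n}. f i) = (\<Oplus>i\<in>{1..n} \<union> (\<lambda>i. i + n) ` {1..n}. f i)"
    by simp
  also have "\<dots> = (\<Oplus>i\<in>{1..n}. f i) \<oplus> (\<Oplus>i\<in>(\<lambda>i. i + n) ` {1..n}. f i)"
    by (rule finsum_Un_disjoint) (auto intro!: assms)
  also have "(\<Oplus>i\<in>(\<lambda>i. i + n) ` {1..n}. f i) = (\<Oplus>i\<in>{1..n}. f (i + n))"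
    by (rule finsum_reindex) (auto intro!: assms)
  also have "(\<Oplus>i\<in>{1..n}. f i) \<oplus> (\<Oplus>i\<in>{1..n}. f (i + n)) = (\<Oplus>i\<in>{1..n}. f i \<oplus> f (i + n))"
    by (rule finsum_addf[symmetric]) (auto intro!: assms)
  finally show ?thesis .
qed

text \<open>Adding and subtracting \<open>a \<otimes> v \<otimes> b\<close> turns the commutator
  with a product into anticommutators with its factors, which the Clifford relation
  evaluates.\<close>

lemma (in ring) commutator_product:
  assumes "a \<in> carrier R" "b \<in> carrier R" "v \<in> carrier R" "s \<in> carrier R" "t \<in> carrier R"
    and "b \<otimes> v \<oplus> v \<otimes> b = s" "a \<otimes> v \<oplus> v \<otimes> a = t"
  shows "a \<otimes> b \<otimes> v \<ominus> v \<otimes> (a \<otimes> b) = a \<otimes> s \<ominus> t \<otimes> b"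
  unfolding assms(6,7)[symmetric] using assms(1-3) by algebra

text \<open>The commutator with \<open>w\<close> is a derivation. The form without differences, with
  doubled terms in place of a scalar 2, makes sense in a plain ring and is the one that passes
  through the induction over products.\<close>

lemma (in ring) commutator_mult:
  assumes "w \<in> carrier R" "x \<in> carrier R" "y \<in> carrier R" "s \<in> carrier R" "t \<in> carrier R"
    and "w \<otimes> x = x \<otimes> w \<oplus> (s \<oplus> s)" "w \<otimes> y = y \<otimes> w \<oplus> (t \<oplus> t)"
  shows "w \<otimes> (x \<otimes> y) = (x \<otimes> y) \<otimes> w \<oplus> ((s \<otimes> y \<oplus> x \<otimes> t) \<oplus> (s \<otimes> y \<oplus> x \<otimes> t))"
proof -
  have "w \<otimes> (x \<otimes> y) = (x \<otimes> w \<oplus> (s \<oplus> s)) \<otimes> y"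
    using assms by (simp add: m_assoc[symmetric])
  also have "\<dots> = x \<otimes> (w \<otimes> y) \<oplus> (s \<oplus> s) \<otimes> y"
    using assms(1-5) by algebra
  also have "\<dots> = x \<otimes> (y \<otimes> w \<oplus> (t \<oplus> t)) \<oplus> (s \<oplus> s) \<otimes> y"
    by (simp only: assms(7))
  also have "\<dots> = (x \<otimes> y) \<otimes> w \<oplus> ((s \<otimes> y \<oplus> x \<otimes> t) \<oplus> (s \<otimes> y \<oplus> x \<otimes> t))"
    using assms(1-5) by algebra
  finally show ?thesis .
qed

text \<open>The part of \<open>2 \<i> (D H s - H D s)\<close> belonging to one frame vector:
  \<open>a\<close>, \<open>b\<close> stand for \<open>e A\<close>, \<open>J (e A)\<close>, then
  \<open>w\<close>, \<open>x\<close> for \<open>\<omega>\<close>, \<open>s\<close>, next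
  \<open>dw\<close>, \<open>dx\<close> for their derivatives along \<open>e A\<close>, and
  \<open>d\<close> for the derivative of \<open>Jd\<close> applied to \<open>s\<close>. The products
  \<open>a w dx\<close> and \<open>a dx w\<close> cancel; what is left is doubled.\<close>

lemma (in ring) dirac_commutator_term:
  assumes "a \<in> carrier R" "b \<in> carrier R" "w \<in> carrier R" "x \<in> carrier R" "dx \<in> carrier R"
    "dw \<in> carrier R" "d \<in> carrier R"
    and "w \<otimes> a = a \<otimes> w \<oplus> (b \<oplus> b)" "dw \<otimes> x = x \<otimes> dw \<oplus> (d \<oplus> d)"
  shows "a \<otimes> ((dw \<otimes> x \<oplus> w \<otimes> dx) \<oplus> (dx \<otimes> w \<oplus> x \<otimes> dw)) \<ominus> (w \<otimes> (a \<otimes> dx) \<oplus> (a \<otimes> dx) \<otimes> w) =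
    (a \<otimes> (dw \<otimes> x) \<ominus> b \<otimes> dx \<ominus> a \<otimes> d) \<oplus> (a \<otimes> (dw \<otimes> x) \<ominus> b \<otimes> dx \<ominus> a \<otimes> d)"
proof -
  have "w \<otimes> (a \<otimes> dx) = (a \<otimes> w \<oplus> (b \<oplus> b)) \<otimes> dx"
    using assms by (simp add: m_assoc[symmetric])
  then show ?thesis
    unfolding assms(9) using assms(1-7) by algebra
qed

text \<open>Letters as before, with \<open>y\<close> for \<open>dw \<otimes> x\<close>. The new
  \<open>k\<close> is the derivative of \<open>Ja\<close> along \<open>J (e A)\<close>, pulled back
  by \<open>Ja\<close> and applied to \<open>s\<close>; it occurs both in the conjugate Dirac
  operator and in the \<open>\<sigma>\<close> term, and drops out.\<close>

lemma (in ring) dirac_conjugate_term: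
  assumes "a \<in> carrier R" "b \<in> carrier R" "y \<in> carrier R" "dx \<in> carrier R" "k \<in> carrier R"
    "d \<in> carrier R"
  shows "(\<ominus> (b \<otimes> dx) \<oplus> a \<otimes> k) \<ominus> a \<otimes> (d \<oplus> k) \<oplus> a \<otimes> y = a \<otimes> y \<ominus> b \<otimes> dx \<ominus> a \<otimes> d"
  using assms by algebra

section \<open>Almost Hermitian manifolds with an adapted basis at each point\<close>

locale almost_hermitian = riemannian_manifold \<A> g
  for \<A> :: "('m::topological_space, 'e::euclidean_space) chart set" and g +
  fixes J :: "'m \<Rightarrow> ('m, 'e) tvec \<Rightarrow> ('m, 'e) tvec"
    and n :: nat and e :: "'m \<Rightarrow> nat \<Rightarrow> ('m, 'e) tvec"
  assumes acs: "almost_complex_structure \<A> J"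
    and compatible: "compatible_metric \<A> g J"
    and basis: "adapted_basis \<A> g J n q (e q)"
begin

lemma J_closed: "u \<in> T p \<Longrightarrow> J p u \<in> T p"
  and J_J: "u \<in> T p \<Longrightarrow> J p (J p u) = - u"
  and J_add: "u \<in> T p \<Longrightarrow> v \<in> T p \<Longrightarrow> J p (u + v) = J p u + J p v"
  and J_scale: "u \<in> T p \<Longrightarrow> J p (a *\<^sub>R u) = a *\<^sub>R J p u"
  and J_smooth: "open U \<Longrightarrow> smooth_vf \<A> U X \<Longrightarrow> smooth_vf \<A> U (\<lambda>p. J p (X p))"
  using acs unfolding almost_complex_structure_def by blast+

lemma J_zero: "J p 0 = 0"
  using J_scale[of 0 p 0] T_zero by simp

lemma J_neg: "u \<in> T p \<Longrightarrow> J p (- u) = - J p u"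
  using J_scale[of u p "-1"] by simp

lemma J_sum: "(\<And>i. i \<in> I \<Longrightarrow> v i \<in> T p) \<Longrightarrow> J p (\<Sum>i\<in>I. v i) = (\<Sum>i\<in>I. J p (v i))"
  by (induction I rule: infinite_finite_induct) (auto simp: J_zero J_add T_sum)

text \<open>Orthogonality of \<open>J\<close>, applied to \<open>J p u\<close> and \<open>v\<close>,
  together with \<open>J p (J p u) = - u\<close>.\<close>

lemma g_J_left: "u \<in> T p \<Longrightarrow> v \<in> T p \<Longrightarrow> g p (J p u) v = - g p u (J p v)"
proof -
  assume uv: "u \<in> T p" "v \<in> T p"
  have "g p (J p (J p u)) (J p v) = g p (J p u) v"
    using compatible uv J_closed unfolding compatible_metric_def by blast
  moreover have "g p (- u) (J p v) = - g p u (J p v)"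
    using g_scale_left[of u p "J p v" "-1"] uv J_closed by simp
  ultimately show ?thesis
    using uv by (simp add: J_J)
qed

abbreviation "S \<equiv> {1..2*n}"

lemma e_closed: "A \<in> S \<Longrightarrow> e p A \<in> T p"
  and e_inner: "A \<in> S \<Longrightarrow> B \<in> S \<Longrightarrow> g p (e p A) (e p B) = (if A = B then 1 else 0)"
  and e_span: "span (e p ` S) = T p"
  and J_e: "i \<in> {1..n} \<Longrightarrow> J p (e p i) = e p (i + n)"
  using basis[of p] unfolding adapted_basis_def by blast+

lemma J_e': "i \<in> {1..n} \<Longrightarrow> J p (e p (i + n)) = - e p i"
  using J_e[of i p] J_J[OF e_closed, of i p] by simp

lemma e_nonzero: "A \<in> S \<Longrightarrow> e p A \<noteq> 0"
  using e_inner[of A A p] g_zero_left[OF T_zero, of p] by auto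

lemma e_expansion:
  assumes "v \<in> T p"
  shows "v = (\<Sum>A\<in>S. g p (e p A) v *\<^sub>R e p A)"
proof -
  have "v = (\<Sum>A\<in>S. (g p v (e p A) / g p (e p A) (e p A)) *\<^sub>R e p A)"
    by (rule orthogonal_expansion) (use assms e_closed e_inner e_nonzero e_span in auto)
  also have "\<dots> = (\<Sum>A\<in>S. g p (e p A) v *\<^sub>R e p A)"
    by (intro sum.cong refl) (simp add: e_inner g_sym[OF assms e_closed])
  finally show ?thesis .
qed

abbreviation "\<omega> \<equiv> fundamental_element \<A> g n e"

text \<open>The trace of this bilinear map does not depend on the basis, whereas the summands
  \<open>e i \<cdot> e (i + n)\<close> of \<open>\<omega>\<close> refer to an adapted one.\<close>

definition J_prod :: "'m \<Rightarrow> ('m, 'e) tvec \<Rightarrow> ('m, 'e) tvec \<Rightarrow> ('m, 'e) cliff" where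
  "J_prod p u v = cv p u \<otimes>\<^bsub>CL p\<^esub> cv p (J p v)"

lemma J_prod_closed: "u \<in> T p \<Longrightarrow> v \<in> T p \<Longrightarrow> J_prod p u v \<in> carrier (CL p)"
  by (simp add: J_prod_def cv_closed J_closed)

lemma J_prod_scale:
  "u \<in> T p \<Longrightarrow> v \<in> T p \<Longrightarrow> J_prod p (a *\<^sub>R u) v = complex_of_real a \<odot>\<^bsub>CL p\<^esub> J_prod p u v"
  "u \<in> T p \<Longrightarrow> v \<in> T p \<Longrightarrow> J_prod p u (a *\<^sub>R v) = complex_of_real a \<odot>\<^bsub>CL p\<^esub> J_prod p u v"
  by (simp_all add: J_prod_def cv_scale J_scale J_closed cv_closed CL.smult_mult_left
      CL.smult_mult_right)

lemma J_prod_sum: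
  assumes "finite I" "\<And>i. i \<in> I \<Longrightarrow> u i \<in> T p" "v \<in> T p"
  shows "J_prod p (\<Sum>i\<in>I. u i) v = (\<Oplus>\<^bsub>CL p\<^esub>i\<in>I. J_prod p (u i) v)"
    and "J_prod p v (\<Sum>i\<in>I. u i) = (\<Oplus>\<^bsub>CL p\<^esub>i\<in>I. J_prod p v (u i))"
proof -
  have "(\<lambda>i. cv p (u i)) \<in> I \<rightarrow> carrier (CL p)" "(\<lambda>i. cv p (J p (u i))) \<in> I \<rightarrow> carrier (CL p)"
    using assms(2) by (auto simp: cv_closed J_closed)
  then show "J_prod p (\<Sum>i\<in>I. u i) v = (\<Oplus>\<^bsub>CL p\<^esub>i\<in>I. J_prod p (u i) v)"
    "J_prod p v (\<Sum>i\<in>I. u i) = (\<Oplus>\<^bsub>CL p\<^esub>i\<in>I. J_prod p v (u i))"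
    using assms unfolding J_prod_def
    by (simp_all add: cv_sum J_sum J_closed cv_closed CL.finsum_ldistr CL.finsum_rdistr)
qed

text \<open>\<open>J\<close> sends \<open>e (i + n)\<close> to \<open>- e i\<close>, and orthogonal
  vectors anticommute, so the terms for \<open>i\<close> and \<open>i + n\<close> both equal
  \<open>e i \<cdot> e (i + n)\<close>. Every summand of \<open>\<omega>\<close> is counted twice,
  whence the factor 1/2.\<close>

lemma fundamental_element_eq:
  "\<omega> p = (1/2) \<odot>\<^bsub>CL p\<^esub> (\<Oplus>\<^bsub>CL p\<^esub>A\<in>S. J_prod p (e p A) (e p A))"
proof -
  let ?t = "\<lambda>i. cv p (e p i) \<otimes>\<^bsub>CL p\<^esub> cv p (e p (i + n))"
  have cl: "e p i \<in> T p" "e p (i + n) \<in> T p" if "i \<in> {1..n}" for i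
    using that e_closed by auto
  have t: "?t i \<in> carrier (CL p)" if "i \<in> {1..n}" for i
    using cl[OF that] by (simp add: cv_closed)
  have eq: "J_prod p (e p i) (e p i) \<oplus>\<^bsub>CL p\<^esub> J_prod p (e p (i + n)) (e p (i + n)) = 2 \<odot>\<^bsub>CL p\<^esub> ?t i"
    if "i \<in> {1..n}" for i
  proof -
    let ?a = "cv p (e p i)" and ?b = "cv p (e p (i + n))"
    have ab: "?a \<in> carrier (CL p)" "?b \<in> carrier (CL p)"
      using cl[OF that] by (simp_all add: cv_closed)
    have "g p (e p i) (e p (i + n)) = 0"
      using that e_inner by auto
    then have "?a \<otimes>\<^bsub>CL p\<^esub> ?b \<oplus>\<^bsub>CL p\<^esub> ?b \<otimes>\<^bsub>CL p\<^esub> ?a = \<zero>\<^bsub>CL p\<^esub>"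
      using cv_anticommute[OF cl[OF that]] by simp
    then have "\<ominus>\<^bsub>CL p\<^esub> (?b \<otimes>\<^bsub>CL p\<^esub> ?a) = ?a \<otimes>\<^bsub>CL p\<^esub> ?b"
      using ab by (intro CL.minus_equality) auto
    then show ?thesis
      using ab cl[OF that]
      by (simp add: J_prod_def J_e[OF that] J_e'[OF that] cv_neg CL.r_minus CL.two_smult)
  qed
  have "(\<Oplus>\<^bsub>CL p\<^esub>A\<in>S. J_prod p (e p A) (e p A)) = (\<Oplus>\<^bsub>CL p\<^esub>i\<in>{1..n}. 2 \<odot>\<^bsub>CL p\<^esub> ?t i)"
  proof -
    have "(\<Oplus>\<^bsub>CL p\<^esub>A\<in>S. J_prod p (e p A) (e p A)) = (\<Oplus>\<^bsub>CL p\<^esub>i\<in>{1..n}.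
        J_prod p (e p i) (e p i) \<oplus>\<^bsub>CL p\<^esub> J_prod p (e p (i + n)) (e p (i + n)))"
      by (rule CL.finsum_double) (simp add: J_prod_closed e_closed)
    also have "\<dots> = (\<Oplus>\<^bsub>CL p\<^esub>i\<in>{1..n}. 2 \<odot>\<^bsub>CL p\<^esub> ?t i)"
      by (intro CL.finsum_cong' refl eq) (use t in auto)
    finally show ?thesis .
  qed
  also have "\<dots> = 2 \<odot>\<^bsub>CL p\<^esub> \<omega> p"
    unfolding fundamental_element_def by (rule CL.finsum_smult) (use t in auto)
  finally have "(\<Oplus>\<^bsub>CL p\<^esub>A\<in>S. J_prod p (e p A) (e p A)) = 2 \<odot>\<^bsub>CL p\<^esub> \<omega> p" .
  moreover have "\<omega> p \<in> carrier (CL p)"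
    unfolding fundamental_element_def using t by (intro CL.finsum_closed) auto
  ultimately show ?thesis
    by (simp add: CL.smult_smult)
qed

lemma fundamental_element_closed: "\<omega> p \<in> carrier (CL p)"
  unfolding fundamental_element_eq
  by (intro CL.smult_closed CL.finsum_closed) (auto simp: J_prod_closed e_closed)

text \<open>The contraction does not depend on the basis: writing \<open>e\<^sub>A\<close> in terms of \<open>f\<close> and
  collecting the terms with the same \<open>f\<^sub>k\<close> turns the remaining sum over \<open>A\<close> into \<open>f\<^sub>k / |f\<^sub>k|\<^sup>2\<close>.\<close>

lemma J_prod_trace_orthogonal:
  assumes "finite K" "\<And>k. k \<in> K \<Longrightarrow> f k \<in> T p" "\<And>k. k \<in> K \<Longrightarrow> f k \<noteq> 0"
    and "\<And>j k. j \<in> K \<Longrightarrow> k \<in> K \<Longrightarrow> j \<noteq> k \<Longrightarrow> g p (f j) (f k) = 0"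
    and "T p \<subseteq> span (f ` K)"
  shows "(\<Oplus>\<^bsub>CL p\<^esub>A\<in>S. J_prod p (e p A) (e p A)) =
    (\<Oplus>\<^bsub>CL p\<^esub>k\<in>K. complex_of_real (inverse (g p (f k) (f k))) \<odot>\<^bsub>CL p\<^esub> J_prod p (f k) (f k))"
proof -
  let ?c = "\<lambda>A k. g p (e p A) (f k) / g p (f k) (f k)"
  have cl: "?c A k *\<^sub>R f k \<in> T p" "?c A k *\<^sub>R e p A \<in> T p" if "A \<in> S" "k \<in> K" for A k
    using that assms(2) by (auto intro!: T_scale e_closed)
  have "J_prod p (e p A) (e p A) = (\<Oplus>\<^bsub>CL p\<^esub>k\<in>K. J_prod p (f k) (?c A k *\<^sub>R e p A))"
    if "A \<in> S" for A
  proof -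
    have "e p A = (\<Sum>k\<in>K. ?c A k *\<^sub>R f k)"
      by (rule orthogonal_expansion) (use assms e_closed[OF that, of p] in auto)
    then have "J_prod p (e p A) (e p A) = J_prod p (\<Sum>k\<in>K. ?c A k *\<^sub>R f k) (e p A)"
      by simp
    also have "\<dots> = (\<Oplus>\<^bsub>CL p\<^esub>k\<in>K. J_prod p (?c A k *\<^sub>R f k) (e p A))"
      by (rule J_prod_sum) (use assms cl that e_closed in auto)
    also have "\<dots> = (\<Oplus>\<^bsub>CL p\<^esub>k\<in>K. J_prod p (f k) (?c A k *\<^sub>R e p A))"
      using assms(2) that cl
      by (intro CL.finsum_cong')
        (auto simp del: scaleR_left_diff_distrib simp: J_prod_scale e_closed
          intro!: CL.smult_closed J_prod_closed)
    finally show ?thesis .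
  qed
  then have "(\<Oplus>\<^bsub>CL p\<^esub>A\<in>S. J_prod p (e p A) (e p A)) =
      (\<Oplus>\<^bsub>CL p\<^esub>A\<in>S. \<Oplus>\<^bsub>CL p\<^esub>k\<in>K. J_prod p (f k) (?c A k *\<^sub>R e p A))"
    using assms(2) cl by (intro CL.finsum_cong') (auto intro!: CL.finsum_closed J_prod_closed)
  also have "\<dots> = (\<Oplus>\<^bsub>CL p\<^esub>k\<in>K. \<Oplus>\<^bsub>CL p\<^esub>A\<in>S. J_prod p (f k) (?c A k *\<^sub>R e p A))"
    using assms(1,2) cl by (intro CL.finsum_swap) (auto intro!: J_prod_closed)
  also have "\<dots> = (\<Oplus>\<^bsub>CL p\<^esub>k\<in>K. complex_of_real (inverse (g p (f k) (f k))) \<odot>\<^bsub>CL p\<^esub> J_prod p (f k) (f k))"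
  proof (intro CL.finsum_cong')
    fix k assume k: "k \<in> K"
    have "(\<Oplus>\<^bsub>CL p\<^esub>A\<in>S. J_prod p (f k) (?c A k *\<^sub>R e p A)) = J_prod p (f k) (\<Sum>A\<in>S. ?c A k *\<^sub>R e p A)"
      by (rule J_prod_sum(2)[symmetric]) (use assms cl k in auto)
    also have "(\<Sum>A\<in>S. ?c A k *\<^sub>R e p A) = inverse (g p (f k) (f k)) *\<^sub>R (\<Sum>A\<in>S. g p (e p A) (f k) *\<^sub>R e p A)"
      by (simp add: scaleR_sum_right divide_inverse mult.commute)
    also have "\<dots> = inverse (g p (f k) (f k)) *\<^sub>R f k"
      using e_expansion[OF assms(2)[OF k]] by simp
    also have "J_prod p (f k) \<dots> =
        complex_of_real (inverse (g p (f k) (f k))) \<odot>\<^bsub>CL p\<^esub> J_prod p (f k) (f k)"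
      using assms(2)[OF k] by (rule J_prod_scale(2)) fact
    finally show "(\<Oplus>\<^bsub>CL p\<^esub>A\<in>S. J_prod p (f k) (?c A k *\<^sub>R e p A)) =
        complex_of_real (inverse (g p (f k) (f k))) \<odot>\<^bsub>CL p\<^esub> J_prod p (f k) (f k)" .
  qed (auto intro!: CL.smult_closed J_prod_closed assms(2))
  finally show ?thesis .
qed

text \<open>Near each point the trace is taken in a smooth orthogonal frame, where it is a
  combination of words of length two with the inverse squared lengths as coefficients. Nothing is
  thereby asked of the way \<open>e q\<close> varies with \<open>q\<close>.\<close>

lemma smooth_section_fundamental_element: "smooth_section \<A> g \<omega>"
  unfolding smooth_section_iff
proof
  fix p
  obtain U f where U: "open U" "p \<in> U"
    and f: "\<And>k. k < DIM('e) \<Longrightarrow> smooth_vf \<A> U (f k)"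
      "\<And>k q. k < DIM('e) \<Longrightarrow> q \<in> U \<Longrightarrow> f k q \<noteq> 0"
      "\<And>i j q. i < DIM('e) \<Longrightarrow> j < DIM('e) \<Longrightarrow> i \<noteq> j \<Longrightarrow> q \<in> U \<Longrightarrow> g q (f i q) (f j q) = 0"
      "\<And>q. q \<in> U \<Longrightarrow> T q \<subseteq> span ((\<lambda>k. f k q) ` {..<DIM('e)})"
    using local_orthogonal_frame[of p] by blast
  let ?K = "{..<DIM('e)}"
  let ?h = "\<lambda>k q. complex_of_real (inverse (g q (f k q) (f k q)))"
  let ?X = "\<lambda>k. [f k, \<lambda>q. J q (f k q)]"
  have fT: "f k q \<in> T q" if "k \<in> ?K" "q \<in> U" for k q
    using smooth_vf_tangent[OF f(1)] that by auto
  have "smooth_fun \<A> U (?h k)" if "k \<in> ?K" for k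
    using that f(1) g_pos[OF fT f(2)] U(1)
    by (intro smooth_fun_bounded_linear[OF bounded_linear_of_real] smooth_fun_inverse g_smooth)
      fastforce+
  then have "smooth_locally U
      (\<lambda>q. (1/2) \<odot>\<^bsub>CL q\<^esub> (\<Oplus>\<^bsub>CL q\<^esub>k\<in>?K. ?h k q \<odot>\<^bsub>CL q\<^esub> word (?X k) q))"
    using f(1) U(1)
    by (intro smooth_locally_smult smooth_locally_finsum smooth_locally_term smooth_fun_const)
      (auto intro: J_smooth)
  then have "smooth_locally U \<omega>"
  proof (rule smooth_locally_cong)
    fix q assume q: "q \<in> U"
    have "word (?X k) q = J_prod q (f k q) (f k q)" if "k \<in> ?K" for k
      using fT[OF that q] by (simp add: J_prod_def cv_closed J_closed)
    then have "(\<Oplus>\<^bsub>CL q\<^esub>k\<in>?K. ?h k q \<odot>\<^bsub>CL q\<^esub> word (?X k) q) =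
        (\<Oplus>\<^bsub>CL q\<^esub>k\<in>?K. ?h k q \<odot>\<^bsub>CL q\<^esub> J_prod q (f k q) (f k q))"
      using fT q by (intro CL.finsum_cong') (auto simp: J_prod_closed)
    also have "\<dots> = (\<Oplus>\<^bsub>CL q\<^esub>A\<in>S. J_prod q (e q A) (e q A))"
      by (rule J_prod_trace_orthogonal[symmetric]) (use f fT q in auto)
    finally show "\<omega> q =
        (1/2) \<odot>\<^bsub>CL q\<^esub> (\<Oplus>\<^bsub>CL q\<^esub>k\<in>?K. ?h k q \<odot>\<^bsub>CL q\<^esub> word (?X k) q)"
      using fundamental_element_eq by simp
  qed
  with U show "\<exists>U. open U \<and> p \<in> U \<and> smooth_locally U \<omega>"
    by blast
qed

end

lemma (in kalgebra) finsum_diff: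
  assumes "finite I" "\<And>i. i \<in> I \<Longrightarrow> f i \<in> carrier A" "\<And>i. i \<in> I \<Longrightarrow> h i \<in> carrier A"
  shows "(\<Oplus>i\<in>I. f i \<ominus> h i) = (\<Oplus>i\<in>I. f i) \<ominus> (\<Oplus>i\<in>I. h i)"
proof -
  have "(\<Oplus>i\<in>I. f i \<ominus> h i) = (\<Oplus>i\<in>I. f i) \<oplus> (\<Oplus>i\<in>I. \<ominus> h i)"
    unfolding a_minus_def using assms by (intro finsum_addf) auto
  then show ?thesis
    using finsum_neg[of I h] assms by (simp add: a_minus_def Pi_def)
qed

lemma (in ring) diff_eq_imp_eq_add:
  assumes "x \<in> carrier R" "y \<in> carrier R" "x \<ominus> y = z"
  shows "x = y \<oplus> z"
  unfolding assms(3)[symmetric] using assms(1,2) by algebra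

text \<open>Reading \<open>dw\<close>, \<open>dx\<close> as derivatives: the covariant derivative of
  the operator \<open>x \<mapsto> w x - x w\<close> is the commutator with the derivative of
  \<open>w\<close>.\<close>

lemma (in ring) commutator_leibniz:
  assumes "dw \<in> carrier R" "dx \<in> carrier R" "w \<in> carrier R" "x \<in> carrier R"
  shows "((dw \<otimes> x \<oplus> w \<otimes> dx) \<ominus> (dx \<otimes> w \<oplus> x \<otimes> dw)) \<ominus> (w \<otimes> dx \<ominus> dx \<otimes> w) =
    dw \<otimes> x \<ominus> x \<otimes> dw"
  using assms by algebra

section \<open>The commutator of the fundamental element with a vector\<close>

context almost_hermitian
begin

text \<open>This is \<open>commutator_product\<close> for the factors \<open>u\<close> and
  \<open>J p u\<close>, with the anticommutators given by the Clifford relation; skewness of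
  \<open>J\<close> then moves it from \<open>u\<close> to \<open>v\<close>.\<close>

lemma commutator_J_prod:
  assumes "u \<in> T p" "v \<in> T p"
  shows "J_prod p u u \<otimes>\<^bsub>CL p\<^esub> cv p v \<ominus>\<^bsub>CL p\<^esub> cv p v \<otimes>\<^bsub>CL p\<^esub> J_prod p u u =
    cv p ((2 * g p u (J p v)) *\<^sub>R u + (2 * g p u v) *\<^sub>R J p u)"
proof -
  have cl: "cv p u \<in> carrier (CL p)" "cv p (J p u) \<in> carrier (CL p)" "cv p v \<in> carrier (CL p)"
    using assms by (simp_all add: cv_closed J_closed)
  have "J_prod p u u \<otimes>\<^bsub>CL p\<^esub> cv p v \<ominus>\<^bsub>CL p\<^esub> cv p v \<otimes>\<^bsub>CL p\<^esub> J_prod p u u =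
    cv p u \<otimes>\<^bsub>CL p\<^esub> (complex_of_real (- 2 * g p (J p u) v) \<odot>\<^bsub>CL p\<^esub> \<one>\<^bsub>CL p\<^esub>)
    \<ominus>\<^bsub>CL p\<^esub> (complex_of_real (- 2 * g p u v) \<odot>\<^bsub>CL p\<^esub> \<one>\<^bsub>CL p\<^esub>) \<otimes>\<^bsub>CL p\<^esub> cv p (J p u)"
    unfolding J_prod_def
    by (rule CL.commutator_product) (use assms cl in \<open>simp_all only: cv_anticommute J_closed
      CL.smult_closed CL.one_closed\<close>)
  also have "\<dots> = complex_of_real (2 * g p u (J p v)) \<odot>\<^bsub>CL p\<^esub> cv p u
      \<ominus>\<^bsub>CL p\<^esub> complex_of_real (- (2 * g p u v)) \<odot>\<^bsub>CL p\<^esub> cv p (J p u)"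
    using cl assms by (simp add: g_J_left CL.smult_mult_left CL.smult_mult_right)
  also have "\<dots> = complex_of_real (2 * g p u (J p v)) \<odot>\<^bsub>CL p\<^esub> cv p u
      \<oplus>\<^bsub>CL p\<^esub> complex_of_real (2 * g p u v) \<odot>\<^bsub>CL p\<^esub> cv p (J p u)"
    unfolding a_minus_def of_real_minus CL.neg_smult[OF cl(2)]
    using cl by (simp only: CL.minus_minus CL.smult_closed)
  also have "\<dots> = cv p ((2 * g p u (J p v)) *\<^sub>R u + (2 * g p u v) *\<^sub>R J p u)"
    using assms by (simp only: cv_add cv_scale T_scale J_closed)
  finally show ?thesis .
qed

text \<open>Summing \<open>commutator_J_prod\<close> over the frame yields two expansions: that of
  \<open>J p v\<close>, and \<open>J\<close> applied to that of \<open>v\<close>. Each contributes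
  \<open>2 J v\<close> to the commutator with the trace, and \<open>\<omega>\<close> is half the
  trace.\<close>

lemma commutator_fundamental_vec:
  assumes v: "v \<in> T p"
  shows "\<omega> p \<otimes>\<^bsub>CL p\<^esub> cv p v \<ominus>\<^bsub>CL p\<^esub> cv p v \<otimes>\<^bsub>CL p\<^esub> \<omega> p = 2 \<odot>\<^bsub>CL p\<^esub> cv p (J p v)"
proof -
  let ?b = "\<lambda>A. J_prod p (e p A) (e p A)"
  let ?W = "\<Oplus>\<^bsub>CL p\<^esub>A\<in>S. ?b A"
  let ?v = "cv p v"
  have cl: "?v \<in> carrier (CL p)" "?W \<in> carrier (CL p)" "\<And>A. A \<in> S \<Longrightarrow> ?b A \<in> carrier (CL p)"
    using v by (auto intro!: cv_closed CL.finsum_closed J_prod_closed e_closed)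
  let ?u = "\<lambda>A. (2 * g p (e p A) (J p v)) *\<^sub>R e p A + (2 * g p (e p A) v) *\<^sub>R J p (e p A)"
  have uT: "?u A \<in> T p" if "A \<in> S" for A
    using that by (intro T_add T_scale J_closed e_closed)
  have "?W \<otimes>\<^bsub>CL p\<^esub> ?v \<ominus>\<^bsub>CL p\<^esub> ?v \<otimes>\<^bsub>CL p\<^esub> ?W =
      (\<Oplus>\<^bsub>CL p\<^esub>A\<in>S. ?b A \<otimes>\<^bsub>CL p\<^esub> ?v \<ominus>\<^bsub>CL p\<^esub> ?v \<otimes>\<^bsub>CL p\<^esub> ?b A)"
    using cl by (subst CL.finsum_diff) (auto simp: CL.finsum_ldistr CL.finsum_rdistr)
  also have "\<dots> = (\<Oplus>\<^bsub>CL p\<^esub>A\<in>S. cv p (?u A))"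
    using uT v by (intro CL.finsum_cong' refl commutator_J_prod) (auto intro!: cv_closed e_closed)
  also have "\<dots> = cv p (\<Sum>A\<in>S. ?u A)"
    by (rule cv_sum[symmetric]) (use uT in auto)
  also have "(\<Sum>A\<in>S. ?u A) = 4 *\<^sub>R J p v"
  proof -
    have "J p v = J p (\<Sum>A\<in>S. g p (e p A) v *\<^sub>R e p A)"
      using e_expansion[OF v] by simp
    also have "\<dots> = (\<Sum>A\<in>S. g p (e p A) v *\<^sub>R J p (e p A))"
      by (subst J_sum) (auto intro!: sum.cong T_scale e_closed simp: J_scale e_closed)
    finally have "(\<Sum>A\<in>S. g p (e p A) v *\<^sub>R J p (e p A)) = J p v" by simp
    moreover have "(\<Sum>A\<in>S. g p (e p A) (J p v) *\<^sub>R e p A) = J p v"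
      using e_expansion[OF J_closed[OF v]] by simp
    moreover have "(\<Sum>A\<in>S. ?u A) = 2 *\<^sub>R (\<Sum>A\<in>S. g p (e p A) (J p v) *\<^sub>R e p A) +
        2 *\<^sub>R (\<Sum>A\<in>S. g p (e p A) v *\<^sub>R J p (e p A))"
      by (simp add: sum.distrib scaleR_sum_right)
    moreover have "2 *\<^sub>R J p v + 2 *\<^sub>R J p v = 4 *\<^sub>R J p v"
      unfolding scaleR_add_left[symmetric] by simp
    ultimately show ?thesis by simp
  qed
  finally have W: "?W \<otimes>\<^bsub>CL p\<^esub> ?v \<ominus>\<^bsub>CL p\<^esub> ?v \<otimes>\<^bsub>CL p\<^esub> ?W = 4 \<odot>\<^bsub>CL p\<^esub> cv p (J p v)"
    using cv_scale[OF J_closed[OF v], of 4] by simp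
  have "\<omega> p \<otimes>\<^bsub>CL p\<^esub> ?v \<ominus>\<^bsub>CL p\<^esub> ?v \<otimes>\<^bsub>CL p\<^esub> \<omega> p =
      (1/2) \<odot>\<^bsub>CL p\<^esub> (?W \<otimes>\<^bsub>CL p\<^esub> ?v \<ominus>\<^bsub>CL p\<^esub> ?v \<otimes>\<^bsub>CL p\<^esub> ?W)"
    unfolding fundamental_element_eq using cl
    by (simp only: CL.smult_mult_left CL.smult_mult_right CL.smult_diff CL.m_closed)
  then show ?thesis
    unfolding W using cv_closed[OF J_closed[OF v]] by (simp add: CL.smult_smult)
qed

end

section \<open>The connection and the two extensions of \<open>J\<close>\<close>

locale hermitian_clifford = almost_hermitian \<A> g J n e
  for \<A> :: "('m::topological_space, 'e::euclidean_space) chart set" and g J n e +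
  fixes nabT :: "'m \<Rightarrow> ('m, 'e) tvec \<Rightarrow> ('m \<Rightarrow> ('m, 'e) tvec) \<Rightarrow> ('m, 'e) tvec"
    and nab :: "'m \<Rightarrow> ('m, 'e) tvec \<Rightarrow> ('m \<Rightarrow> ('m, 'e) cliff) \<Rightarrow> ('m, 'e) cliff"
    and Jd Ja :: "'m \<Rightarrow> ('m, 'e) cliff \<Rightarrow> ('m, 'e) cliff"
  assumes connection: "clifford_connection \<A> g nabT nab"
    and derivation: "derivation_extension \<A> g J Jd"
    and homomorphism: "algebra_extension \<A> g J Ja"
begin

lemma Jd_closed: "x \<in> carrier (CL p) \<Longrightarrow> Jd p x \<in> carrier (CL p)"
  and Jd_add: "x \<in> carrier (CL p) \<Longrightarrow> y \<in> carrier (CL p) \<Longrightarrow>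
    Jd p (x \<oplus>\<^bsub>CL p\<^esub> y) = Jd p x \<oplus>\<^bsub>CL p\<^esub> Jd p y"
  and Jd_smult: "x \<in> carrier (CL p) \<Longrightarrow> Jd p (z \<odot>\<^bsub>CL p\<^esub> x) = z \<odot>\<^bsub>CL p\<^esub> Jd p x"
  and Jd_cv: "v \<in> T p \<Longrightarrow> Jd p (cv p v) = cv p (J p v)"
  and Jd_one: "Jd p \<one>\<^bsub>CL p\<^esub> = \<zero>\<^bsub>CL p\<^esub>"
  and Jd_mult: "x \<in> carrier (CL p) \<Longrightarrow> y \<in> carrier (CL p) \<Longrightarrow>
    Jd p (x \<otimes>\<^bsub>CL p\<^esub> y) = (Jd p x \<otimes>\<^bsub>CL p\<^esub> y) \<oplus>\<^bsub>CL p\<^esub> (x \<otimes>\<^bsub>CL p\<^esub> Jd p y)"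
  using derivation unfolding derivation_extension_def clifford_linear_def by blast+

lemma Ja_closed: "x \<in> carrier (CL p) \<Longrightarrow> Ja p x \<in> carrier (CL p)"
  and Ja_add: "x \<in> carrier (CL p) \<Longrightarrow> y \<in> carrier (CL p) \<Longrightarrow>
    Ja p (x \<oplus>\<^bsub>CL p\<^esub> y) = Ja p x \<oplus>\<^bsub>CL p\<^esub> Ja p y"
  and Ja_smult: "x \<in> carrier (CL p) \<Longrightarrow> Ja p (z \<odot>\<^bsub>CL p\<^esub> x) = z \<odot>\<^bsub>CL p\<^esub> Ja p x"
  and Ja_cv: "v \<in> T p \<Longrightarrow> Ja p (cv p v) = cv p (J p v)"
  and Ja_hom: "Ja p \<in> ring_hom (CL p) (CL p)"
  using homomorphism unfolding algebra_extension_def clifford_linear_def by blast+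

lemmas Ja_mult = ring_hom_mult[OF Ja_hom] and Ja_one = ring_hom_one[OF Ja_hom]

lemma Ja_neg: "x \<in> carrier (CL p) \<Longrightarrow> Ja p (\<ominus>\<^bsub>CL p\<^esub> x) = \<ominus>\<^bsub>CL p\<^esub> Ja p x"
  using Ja_smult[of x p "-1"] by (simp add: CL.neg_smult Ja_closed)

lemma Ja_zero: "Ja p \<zero>\<^bsub>CL p\<^esub> = \<zero>\<^bsub>CL p\<^esub>"
  using Ja_smult[OF CL.zero_closed, of p 0] by (simp add: Ja_closed)

lemma nab_closed: "smooth_section \<A> g s \<Longrightarrow> v \<in> T p \<Longrightarrow> nab p v s \<in> carrier (CL p)"
  and nab_scale: "smooth_section \<A> g s \<Longrightarrow> v \<in> T p \<Longrightarrow>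
    nab p (a *\<^sub>R v) s = complex_of_real a \<odot>\<^bsub>CL p\<^esub> nab p v s"
  and nab_add: "smooth_section \<A> g s \<Longrightarrow> smooth_section \<A> g t \<Longrightarrow> v \<in> T p \<Longrightarrow>
    nab p v (\<lambda>q. s q \<oplus>\<^bsub>CL q\<^esub> t q) = nab p v s \<oplus>\<^bsub>CL p\<^esub> nab p v t"
  and nab_mult: "smooth_section \<A> g s \<Longrightarrow> smooth_section \<A> g t \<Longrightarrow> v \<in> T p \<Longrightarrow>
    nab p v (\<lambda>q. s q \<otimes>\<^bsub>CL q\<^esub> t q) =
      (nab p v s \<otimes>\<^bsub>CL p\<^esub> t p) \<oplus>\<^bsub>CL p\<^esub> (s p \<otimes>\<^bsub>CL p\<^esub> nab p v t)"
  and nab_leibniz: "smooth_section \<A> g s \<Longrightarrow> smooth_fun \<A> UNIV (f :: 'm \<Rightarrow> complex) \<Longrightarrow> v \<in> T p \<Longrightarrow>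
    nab p v (\<lambda>q. f q \<odot>\<^bsub>CL q\<^esub> s q) =
      (dir_deriv \<A> p v f \<odot>\<^bsub>CL p\<^esub> s p) \<oplus>\<^bsub>CL p\<^esub> (f p \<odot>\<^bsub>CL p\<^esub> nab p v s)"
  using connection unfolding clifford_connection_def by blast+

text \<open>A constant coefficient is a smooth function with vanishing derivative.\<close>

lemma nab_smult:
  "smooth_section \<A> g s \<Longrightarrow> v \<in> T p \<Longrightarrow> nab p v (\<lambda>q. z \<odot>\<^bsub>CL q\<^esub> s q) = z \<odot>\<^bsub>CL p\<^esub> nab p v s"
  using nab_leibniz[OF _ smooth_fun_const, of s v p z]
  by (simp add: smooth_section_closed nab_closed)

lemma nab_neg: "smooth_section \<A> g s \<Longrightarrow> v \<in> T p \<Longrightarrow> nab p (- v) s = \<ominus>\<^bsub>CL p\<^esub> nab p v s"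
  using nab_scale[of s v p "-1"] by (simp add: nab_closed CL.neg_smult)

lemma commutator_fundamental:
  assumes "x \<in> carrier (CL p)"
  shows "\<omega> p \<otimes>\<^bsub>CL p\<^esub> x = x \<otimes>\<^bsub>CL p\<^esub> \<omega> p \<oplus>\<^bsub>CL p\<^esub> (Jd p x \<oplus>\<^bsub>CL p\<^esub> Jd p x)"
  using assms
proof (induction x rule: CL_induct)
  case one
  then show ?case
    by (simp add: Jd_one fundamental_element_closed)
next
  case (vec v)
  show ?case
    unfolding Jd_cv[OF vec]
    by (rule CL.diff_eq_imp_eq_add)
      (use vec commutator_fundamental_vec[OF vec] in
        \<open>simp_all add: cv_closed J_closed fundamental_element_closed CL.two_smult\<close>)
next
  case (add x y)
  then show ?case
    by (simp add: CL.r_distr CL.l_distr Jd_add Jd_closed fundamental_element_closed CL.a_ac)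
next
  case (mult x y)
  then show ?case
    unfolding Jd_mult[OF mult.hyps]
    by (intro CL.commutator_mult) (simp_all add: Jd_closed fundamental_element_closed)
next
  case (smult z x)
  then show ?case
    by (simp add: CL.smult_mult_left CL.smult_mult_right Jd_smult Jd_closed CL.smult_add
        fundamental_element_closed)
qed

text \<open>On vectors \<open>J\<close> has fourth power one, and the fourth power of
  \<open>Ja\<close> is an algebra map. This gives injectivity of \<open>Ja\<close> without a
  dimension count and identifies its inverse as its cube, from which \<open>Ji\<close> inherits its
  algebraic properties.\<close>

lemma Ja_Ja_Ja_Ja: "x \<in> carrier (CL p) \<Longrightarrow> Ja p (Ja p (Ja p (Ja p x))) = x"
  by (induction x rule: CL_induct)
    (simp_all add: Ja_one Ja_cv Ja_add Ja_mult Ja_smult Ja_closed J_closed J_J J_neg T_neg)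

abbreviation "Ji \<equiv> fibre_inverse \<A> g Ja"

lemma Ji_Ja:
  assumes "x \<in> carrier (CL p)"
  shows "Ji p (Ja p x) = x"
proof -
  have "inj_on (Ja p) (carrier (CL p))"
    by (rule inj_onI) (metis Ja_Ja_Ja_Ja)
  then show ?thesis
    unfolding fibre_inverse_def using assms by (rule inv_into_f_f)
qed

lemma Ji_eq: "x \<in> carrier (CL p) \<Longrightarrow> Ji p x = Ja p (Ja p (Ja p x))"
  using Ji_Ja[of "Ja p (Ja p (Ja p x))" p] by (simp add: Ja_Ja_Ja_Ja Ja_closed)

lemma Ji_closed: "x \<in> carrier (CL p) \<Longrightarrow> Ji p x \<in> carrier (CL p)"
  by (simp add: Ji_eq Ja_closed)

lemma Ji_mult: "x \<in> carrier (CL p) \<Longrightarrow> y \<in> carrier (CL p) \<Longrightarrow>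
    Ji p (x \<otimes>\<^bsub>CL p\<^esub> y) = Ji p x \<otimes>\<^bsub>CL p\<^esub> Ji p y"
  by (simp add: Ji_eq Ja_closed Ja_mult)

lemma Ji_add: "x \<in> carrier (CL p) \<Longrightarrow> y \<in> carrier (CL p) \<Longrightarrow>
    Ji p (x \<oplus>\<^bsub>CL p\<^esub> y) = Ji p x \<oplus>\<^bsub>CL p\<^esub> Ji p y"
  by (simp add: Ji_eq Ja_closed Ja_add)

lemma Ji_neg: "x \<in> carrier (CL p) \<Longrightarrow> Ji p (\<ominus>\<^bsub>CL p\<^esub> x) = \<ominus>\<^bsub>CL p\<^esub> Ji p x"
  by (simp add: Ji_eq Ja_closed Ja_neg)

lemma Ji_diff: "x \<in> carrier (CL p) \<Longrightarrow> y \<in> carrier (CL p) \<Longrightarrow>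
    Ji p (x \<ominus>\<^bsub>CL p\<^esub> y) = Ji p x \<ominus>\<^bsub>CL p\<^esub> Ji p y"
  by (simp add: a_minus_def Ji_add Ji_neg)

lemma Ji_cv: "v \<in> T p \<Longrightarrow> Ji p (cv p v) = \<ominus>\<^bsub>CL p\<^esub> cv p (J p v)"
  by (simp add: Ji_eq cv_closed Ja_cv J_closed J_J J_neg cv_neg Ja_neg)

lemma Ji_finsum:
  "finite I \<Longrightarrow> (\<And>i. i \<in> I \<Longrightarrow> f i \<in> carrier (CL p)) \<Longrightarrow>
    Ji p (\<Oplus>\<^bsub>CL p\<^esub>i\<in>I. f i) = (\<Oplus>\<^bsub>CL p\<^esub>i\<in>I. Ji p (f i))"
proof (induction I rule: finite_induct)
  case (insert j I)
  then show ?case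
    by (simp add: Pi_def Ji_add Ji_closed CL.finsum_closed)
qed (simp add: Ji_eq Ja_zero)

text \<open>\<open>Ja\<close> sends a word of fields \<open>Y\<close> to the word of the fields
  \<open>J Y\<close>, which are smooth again, and leaves the coefficients alone.\<close>

lemma smooth_section_Ja:
  assumes "smooth_section \<A> g s"
  shows "smooth_section \<A> g (\<lambda>q. Ja q (s q))"
proof (rule smooth_section_binop[OF assms assms])
  fix U assume "open U" "smooth_locally U s"
  from this(2,1) show "smooth_locally U (\<lambda>q. Ja q (s q))"
  proof (induction rule: smooth_locally.induct)
    case (zero s)
    then show ?case
      by (intro smooth_locally.zero) (simp add: Ja_zero)
  next
    case (step s f X t)
    have Ja_word: "Ja q (word Z q) = word (map (\<lambda>Y q. J q (Y q)) Z) q"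
      if "\<And>Y. Y \<in> set Z \<Longrightarrow> Y q \<in> T q" for Z q
      using that by (induction Z) (auto simp: Ja_one Ja_mult Ja_cv cv_closed word_closed)
    show ?case
    proof (rule smooth_locally.step[OF step.IH[OF \<open>open U\<close>] step.hyps(2)])
      fix Y assume "Y \<in> set (map (\<lambda>Y q. J q (Y q)) X)"
      then show "smooth_vf \<A> U Y"
        using step.hyps(3) step.prems by (auto intro!: J_smooth)
    next
      fix q assume q: "q \<in> U"
      then have XT: "\<And>Y. Y \<in> set X \<Longrightarrow> Y q \<in> T q"
        using smooth_vf_tangent[OF step.hyps(3)] by blast
      show "Ja q (t q) = f q \<odot>\<^bsub>CL q\<^esub> word (map (\<lambda>Y q. J q (Y q)) X) q \<oplus>\<^bsub>CL q\<^esub> Ja q (s q)"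
        using step.hyps(4)[OF q] smooth_locally_closed[OF step.hyps(1) q] word_closed[of X q]
          Ja_word[of X q] XT
        by (simp add: Ja_add Ja_smult)
    qed
  qed
qed

lemma smooth_section_omega_products:
  assumes "smooth_section \<A> g s"
  shows "smooth_section \<A> g (\<lambda>q. \<omega> q \<otimes>\<^bsub>CL q\<^esub> s q)" "smooth_section \<A> g (\<lambda>q. s q \<otimes>\<^bsub>CL q\<^esub> \<omega> q)"
  using assms smooth_section_fundamental_element by (intro smooth_section_mult; simp)+

text \<open>Half the commutator with \<open>\<omega>\<close> expresses \<open>Jd\<close> through
  global smooth sections, so the sum, product and scalar rules for \<open>nab\<close> apply.
  Membership in the fibre is read off from the resulting expression.\<close>

lemma nabla_end_Jd:
  assumes s: "smooth_section \<A> g s" and v: "v \<in> T p"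
  shows "nab p v \<omega> \<otimes>\<^bsub>CL p\<^esub> s p = s p \<otimes>\<^bsub>CL p\<^esub> nab p v \<omega> \<oplus>\<^bsub>CL p\<^esub>
    (nabla_end \<A> g nab Jd p v s \<oplus>\<^bsub>CL p\<^esub> nabla_end \<A> g nab Jd p v s)"
    and "nabla_end \<A> g nab Jd p v s \<in> carrier (CL p)"
proof -
  let ?dw = "nab p v \<omega>" and ?dx = "nab p v s" and ?w = "\<omega> p" and ?x = "s p"
  note cl = nab_closed[OF smooth_section_fundamental_element v] nab_closed[OF s v]
    fundamental_element_closed[of p] smooth_section_closed[OF s, of p]
  \<comment> \<open>The difference is written with the scalar -1, because the rules for
    \<open>nab\<close> speak of sums and scalar multiples.\<close>
  have Jd_eq: "Jd q x = (1/2) \<odot>\<^bsub>CL q\<^esub> (\<omega> q \<otimes>\<^bsub>CL q\<^esub> x \<oplus>\<^bsub>CL q\<^esub> (- 1) \<odot>\<^bsub>CL q\<^esub> (x \<otimes>\<^bsub>CL q\<^esub> \<omega> q))"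
    if "x \<in> carrier (CL q)" for q x
  proof -
    have "\<omega> q \<otimes>\<^bsub>CL q\<^esub> x \<oplus>\<^bsub>CL q\<^esub> (- 1) \<odot>\<^bsub>CL q\<^esub> (x \<otimes>\<^bsub>CL q\<^esub> \<omega> q) = 2 \<odot>\<^bsub>CL q\<^esub> Jd q x"
      unfolding commutator_fundamental[OF that]
      using that by (simp add: CL.neg_smult CL.two_smult Jd_closed fundamental_element_closed
          CL.a_ac CL.r_neg CL.r_neg1 CL.r_neg2)
    then show ?thesis
      using that by (simp add: CL.smult_smult Jd_closed)
  qed
  note prods = smooth_section_omega_products[OF s]
  have "(\<lambda>q. Jd q (s q)) =
      (\<lambda>q. (1/2) \<odot>\<^bsub>CL q\<^esub> (\<omega> q \<otimes>\<^bsub>CL q\<^esub> s q \<oplus>\<^bsub>CL q\<^esub> (- 1) \<odot>\<^bsub>CL q\<^esub> (s q \<otimes>\<^bsub>CL q\<^esub> \<omega> q)))"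
    by (rule ext) (rule Jd_eq[OF smooth_section_closed[OF s]])
  then have "nab p v (\<lambda>q. Jd q (s q)) = (1/2) \<odot>\<^bsub>CL p\<^esub>
      ((?dw \<otimes>\<^bsub>CL p\<^esub> ?x \<oplus>\<^bsub>CL p\<^esub> ?w \<otimes>\<^bsub>CL p\<^esub> ?dx) \<oplus>\<^bsub>CL p\<^esub>
        (- 1) \<odot>\<^bsub>CL p\<^esub> (?dx \<otimes>\<^bsub>CL p\<^esub> ?w \<oplus>\<^bsub>CL p\<^esub> ?x \<otimes>\<^bsub>CL p\<^esub> ?dw))"
    by (simp only: nab_smult nab_add nab_mult smooth_section_smult smooth_section_add prods v s
        smooth_section_fundamental_element)
  then have "nabla_end \<A> g nab Jd p v s = (1/2) \<odot>\<^bsub>CL p\<^esub>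
      (((?dw \<otimes>\<^bsub>CL p\<^esub> ?x \<oplus>\<^bsub>CL p\<^esub> ?w \<otimes>\<^bsub>CL p\<^esub> ?dx) \<ominus>\<^bsub>CL p\<^esub> (?dx \<otimes>\<^bsub>CL p\<^esub> ?w \<oplus>\<^bsub>CL p\<^esub> ?x \<otimes>\<^bsub>CL p\<^esub> ?dw))
       \<ominus>\<^bsub>CL p\<^esub> (?w \<otimes>\<^bsub>CL p\<^esub> ?dx \<ominus>\<^bsub>CL p\<^esub> ?dx \<otimes>\<^bsub>CL p\<^esub> ?w))"
    unfolding nabla_end_def Jd_eq[OF cl(2)] using cl
    by (simp add: CL.smult_diff CL.neg_smult a_minus_def[symmetric])
  also have "\<dots> = (1/2) \<odot>\<^bsub>CL p\<^esub> (?dw \<otimes>\<^bsub>CL p\<^esub> ?x \<ominus>\<^bsub>CL p\<^esub> ?x \<otimes>\<^bsub>CL p\<^esub> ?dw)"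
    using CL.commutator_leibniz[OF cl] by simp
  finally have d: "nabla_end \<A> g nab Jd p v s =
      (1/2) \<odot>\<^bsub>CL p\<^esub> (?dw \<otimes>\<^bsub>CL p\<^esub> ?x \<ominus>\<^bsub>CL p\<^esub> ?x \<otimes>\<^bsub>CL p\<^esub> ?dw)" .
  then show "nabla_end \<A> g nab Jd p v s \<in> carrier (CL p)"
    using cl by simp
  show "?dw \<otimes>\<^bsub>CL p\<^esub> ?x = ?x \<otimes>\<^bsub>CL p\<^esub> ?dw \<oplus>\<^bsub>CL p\<^esub>
      (nabla_end \<A> g nab Jd p v s \<oplus>\<^bsub>CL p\<^esub> nabla_end \<A> g nab Jd p v s)"
  proof (rule CL.diff_eq_imp_eq_add)
    show "?dw \<otimes>\<^bsub>CL p\<^esub> ?x \<ominus>\<^bsub>CL p\<^esub> ?x \<otimes>\<^bsub>CL p\<^esub> ?dw =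
        nabla_end \<A> g nab Jd p v s \<oplus>\<^bsub>CL p\<^esub> nabla_end \<A> g nab Jd p v s"
      unfolding d using cl by (simp add: CL.add_smult[symmetric])
  qed (use cl in auto)
qed

lemma nab_H_op:
  assumes s: "smooth_section \<A> g s" and v: "v \<in> T p"
  shows "nab p v (H_op \<A> g \<omega> s) = (1 / (2 * \<i>)) \<odot>\<^bsub>CL p\<^esub>
    ((nab p v \<omega> \<otimes>\<^bsub>CL p\<^esub> s p \<oplus>\<^bsub>CL p\<^esub> \<omega> p \<otimes>\<^bsub>CL p\<^esub> nab p v s) \<oplus>\<^bsub>CL p\<^esub>
     (nab p v s \<otimes>\<^bsub>CL p\<^esub> \<omega> p \<oplus>\<^bsub>CL p\<^esub> s p \<otimes>\<^bsub>CL p\<^esub> nab p v \<omega>))"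
  unfolding H_op_def[abs_def]
  by (simp only: nab_smult nab_add nab_mult smooth_section_add v s
      smooth_section_omega_products smooth_section_fundamental_element)

text \<open>Replacing \<open>e\<^sub>A\<close> by \<open>Je\<^sub>A\<close> only permutes the frame up to signs.\<close>

lemma frame_reindex:
  assumes "\<And>v. v \<in> T p \<Longrightarrow> \<Phi> v \<in> carrier (CL p)" "\<And>v. v \<in> T p \<Longrightarrow> \<Phi> (- v) = \<ominus>\<^bsub>CL p\<^esub> \<Phi> v"
  shows "(\<Oplus>\<^bsub>CL p\<^esub>A\<in>S. cv p (e p A) \<otimes>\<^bsub>CL p\<^esub> \<Phi> (J p (e p A))) =
    (\<Oplus>\<^bsub>CL p\<^esub>A\<in>S. \<ominus>\<^bsub>CL p\<^esub> (cv p (J p (e p A)) \<otimes>\<^bsub>CL p\<^esub> \<Phi> (e p A)))"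
proof -
  let ?l = "\<lambda>A. cv p (e p A) \<otimes>\<^bsub>CL p\<^esub> \<Phi> (J p (e p A))"
  let ?r = "\<lambda>A. \<ominus>\<^bsub>CL p\<^esub> (cv p (J p (e p A)) \<otimes>\<^bsub>CL p\<^esub> \<Phi> (e p A))"
  have cl: "?l A \<in> carrier (CL p)" "?r A \<in> carrier (CL p)" if "A \<in> S" for A
    using e_closed[OF that, of p] by (simp_all add: assms cv_closed J_closed)
  \<comment> \<open>Within a pair the terms trade places: \<open>?l i\<close> is
    \<open>?r (i + n)\<close> and \<open>?l (i + n)\<close> is \<open>?r i\<close>, the signs coming
    from \<open>J p (e p (i + n)) = - e p i\<close>.\<close>
  have "?l i \<oplus>\<^bsub>CL p\<^esub> ?l (i + n) = ?r i \<oplus>\<^bsub>CL p\<^esub> ?r (i + n)" if i: "i \<in> {1..n}" for i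
  proof -
    have "e p i \<in> T p" "e p (i + n) \<in> T p"
      using i e_closed by auto
    then show ?thesis
      by (simp add: J_e[OF i] J_e'[OF i] assms cv_closed cv_neg CL.l_minus CL.r_minus CL.a_comm)
  qed
  then have "(\<Oplus>\<^bsub>CL p\<^esub>i\<in>{1..n}. ?l i \<oplus>\<^bsub>CL p\<^esub> ?l (i + n)) = (\<Oplus>\<^bsub>CL p\<^esub>i\<in>{1..n}. ?r i \<oplus>\<^bsub>CL p\<^esub> ?r (i + n))"
    using cl by (intro CL.finsum_cong') auto
  then show ?thesis
    using CL.finsum_double[OF cl(1)] CL.finsum_double[OF cl(2)] by simp
qed

end

section \<open>The commutator\<close>

text \<open>Here \<open>y\<close> stands for the derivative of \<open>Ja q (s q)\<close> pulled back
  by \<open>Ja\<close>. Splitting it as \<open>dx\<close> plus \<open>y \<ominus> dx\<close>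
  isolates the derivative of \<open>Ja\<close> itself.\<close>

lemma (in ring) reindexed_term:
  assumes "b \<in> carrier R" "dx \<in> carrier R" "y \<in> carrier R"
  shows "\<ominus> (b \<otimes> dx) \<oplus> \<ominus> (b \<otimes> (y \<ominus> dx)) = (\<ominus> b) \<otimes> y"
  using assms by algebra

context hermitian_clifford
begin

lemma dirac_commutator:
  assumes s: "smooth_section \<A> g s"
  shows "op_commutator \<A> g (dirac \<A> g n e nab) (H_op \<A> g \<omega>) s p =
    ((- \<i>) \<odot>\<^bsub>CL p\<^esub> conjugate_op \<A> g Ja (dirac \<A> g n e nab) s p) \<oplus>\<^bsub>CL p\<^esub>
      (\<i> \<odot>\<^bsub>CL p\<^esub> dirac_sigma \<A> g J n e nab Jd Ja s p)
      \<ominus>\<^bsub>CL p\<^esub> (\<i> \<odot>\<^bsub>CL p\<^esub> clifford_left_mult \<A> g (dirac \<A> g n e nab \<omega>) s p)"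
proof -
  let ?c = "1 / (2 * \<i>)"
  let ?w = "\<omega> p" and ?x = "s p"
  let ?a = "\<lambda>A. cv p (e p A)" and ?b = "\<lambda>A. cv p (J p (e p A))"
  let ?dx = "\<lambda>A. nab p (e p A) s" and ?dw = "\<lambda>A. nab p (e p A) \<omega>"
  let ?d = "\<lambda>A. nabla_end \<A> g nab Jd p (e p A) s"
  let ?k = "\<lambda>A. Ji p (nabla_end \<A> g nab Ja p (J p (e p A)) s)"
  let ?y = "\<lambda>v. nab p v (\<lambda>q. Ja q (s q))"
  note s\<omega> = smooth_section_fundamental_element and sJ = smooth_section_Ja[OF s]
  have eT: "e p A \<in> T p" "J p (e p A) \<in> T p" if "A \<in> S" for A
    using e_closed[OF that] by (simp_all add: J_closed)
  have cl: "?w \<in> carrier (CL p)" "?x \<in> carrier (CL p)"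
    by (simp_all add: fundamental_element_closed smooth_section_closed[OF s])
  have y: "?y v \<in> carrier (CL p)" "nab p v s \<in> carrier (CL p)" if "v \<in> T p" for v
    using nab_closed[OF sJ that] nab_closed[OF s that] by simp_all
  \<comment> \<open>The derivative of \<open>Ja q (s q)\<close> is kept as it stands; only the plain
    derivative of \<open>s\<close> is split off, since \<open>Ji\<close> undoes
    \<open>Ja\<close>.\<close>
  have k: "Ji p (nabla_end \<A> g nab Ja p v s) = Ji p (?y v) \<ominus>\<^bsub>CL p\<^esub> nab p v s" if "v \<in> T p" for v
    unfolding nabla_end_def using y[OF that] by (simp add: Ji_diff Ja_closed Ji_Ja)
  have clA: "?a A \<in> carrier (CL p)" "?b A \<in> carrier (CL p)" "?dx A \<in> carrier (CL p)"
    "?dw A \<in> carrier (CL p)" "?d A \<in> carrier (CL p)" "?k A \<in> carrier (CL p)"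
    "Ji p (?y (e p A)) \<in> carrier (CL p)" if "A \<in> S" for A
    using eT[OF that] nab_closed[OF s\<omega>, of "e p A" p] nabla_end_Jd(2)[OF s, of "e p A" p]
    by (simp_all add: cv_closed y k Ji_closed)
  \<comment> \<open>The contribution of \<open>e p A\<close> on which both sides of the identity
    agree: each side will turn out to be \<open>- \<i>\<close> times the sum
    \<open>\<kappa>\<close>.\<close>
  define K where "K A = ?a A \<otimes>\<^bsub>CL p\<^esub> (?dw A \<otimes>\<^bsub>CL p\<^esub> ?x) \<ominus>\<^bsub>CL p\<^esub> ?b A \<otimes>\<^bsub>CL p\<^esub> ?dx A
    \<ominus>\<^bsub>CL p\<^esub> ?a A \<otimes>\<^bsub>CL p\<^esub> ?d A" for A
  have K: "K A \<in> carrier (CL p)" if "A \<in> S" for A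
    unfolding K_def using clA[OF that] cl by simp
  define \<kappa> where "\<kappa> = (\<Oplus>\<^bsub>CL p\<^esub>A\<in>S. K A)"
  have \<kappa>: "\<kappa> \<in> carrier (CL p)"
    unfolding \<kappa>_def by (rule CL.finsum_closed) (use K in auto)

  have commutator: "op_commutator \<A> g (dirac \<A> g n e nab) (H_op \<A> g \<omega>) s p = (- \<i>) \<odot>\<^bsub>CL p\<^esub> \<kappa>"
  proof -
    \<comment> \<open>Up to the factor \<open>1 / (2 * \<i>)\<close>, \<open>X A\<close> is the
      derivative of \<open>H s\<close> along \<open>e p A\<close>, and \<open>Y A\<close> is the
      part of \<open>H (D s)\<close> that comes from \<open>e p A\<close>.\<close>
    define X where "X A = (?dw A \<otimes>\<^bsub>CL p\<^esub> ?x \<oplus>\<^bsub>CL p\<^esub> ?w \<otimes>\<^bsub>CL p\<^esub> ?dx A) \<oplus>\<^bsub>CL p\<^esub>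
      (?dx A \<otimes>\<^bsub>CL p\<^esub> ?w \<oplus>\<^bsub>CL p\<^esub> ?x \<otimes>\<^bsub>CL p\<^esub> ?dw A)" for A
    define Y where "Y A = ?w \<otimes>\<^bsub>CL p\<^esub> (?a A \<otimes>\<^bsub>CL p\<^esub> ?dx A) \<oplus>\<^bsub>CL p\<^esub>
      (?a A \<otimes>\<^bsub>CL p\<^esub> ?dx A) \<otimes>\<^bsub>CL p\<^esub> ?w" for A
    have X: "X A \<in> carrier (CL p)" and Y: "Y A \<in> carrier (CL p)" if "A \<in> S" for A
      unfolding X_def Y_def using clA[OF that] cl by simp_all
    have XY: "?a A \<otimes>\<^bsub>CL p\<^esub> X A \<ominus>\<^bsub>CL p\<^esub> Y A = K A \<oplus>\<^bsub>CL p\<^esub> K A" if "A \<in> S" for A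
      unfolding X_def Y_def K_def
    proof (rule CL.dirac_commutator_term)
      show "?w \<otimes>\<^bsub>CL p\<^esub> ?a A = ?a A \<otimes>\<^bsub>CL p\<^esub> ?w \<oplus>\<^bsub>CL p\<^esub> (?b A \<oplus>\<^bsub>CL p\<^esub> ?b A)"
        using commutator_fundamental[OF clA(1)[OF that]] eT[OF that] by (simp add: Jd_cv)
      show "?dw A \<otimes>\<^bsub>CL p\<^esub> ?x = ?x \<otimes>\<^bsub>CL p\<^esub> ?dw A \<oplus>\<^bsub>CL p\<^esub> (?d A \<oplus>\<^bsub>CL p\<^esub> ?d A)"
        by (rule nabla_end_Jd(1)[OF s eT(1)[OF that]])
    qed (use clA[OF that] cl in simp_all)
    have "dirac \<A> g n e nab (H_op \<A> g \<omega> s) p = (\<Oplus>\<^bsub>CL p\<^esub>A\<in>S. ?c \<odot>\<^bsub>CL p\<^esub> (?a A \<otimes>\<^bsub>CL p\<^esub> X A))"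
      unfolding dirac_def
    proof (rule CL.finsum_cong')
      show "?a A \<otimes>\<^bsub>CL p\<^esub> nab p (e p A) (H_op \<A> g \<omega> s) = ?c \<odot>\<^bsub>CL p\<^esub> (?a A \<otimes>\<^bsub>CL p\<^esub> X A)"
        if "A \<in> S" for A
        using nab_H_op[OF s eT(1)[OF that]] clA(1)[OF that] X[OF that]
        by (simp only: X_def CL.smult_mult_right)
    qed (use clA X in auto)
    also have "\<dots> = ?c \<odot>\<^bsub>CL p\<^esub> (\<Oplus>\<^bsub>CL p\<^esub>A\<in>S. ?a A \<otimes>\<^bsub>CL p\<^esub> X A)"
      by (rule CL.finsum_smult) (use clA X in auto)
    finally have 1: "dirac \<A> g n e nab (H_op \<A> g \<omega> s) p =
        ?c \<odot>\<^bsub>CL p\<^esub> (\<Oplus>\<^bsub>CL p\<^esub>A\<in>S. ?a A \<otimes>\<^bsub>CL p\<^esub> X A)" .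
    have 2: "H_op \<A> g \<omega> (dirac \<A> g n e nab s) p = ?c \<odot>\<^bsub>CL p\<^esub> (\<Oplus>\<^bsub>CL p\<^esub>A\<in>S. Y A)"
    proof -
      have "(\<Oplus>\<^bsub>CL p\<^esub>A\<in>S. Y A) = (\<Oplus>\<^bsub>CL p\<^esub>A\<in>S. ?w \<otimes>\<^bsub>CL p\<^esub> (?a A \<otimes>\<^bsub>CL p\<^esub> ?dx A)) \<oplus>\<^bsub>CL p\<^esub>
          (\<Oplus>\<^bsub>CL p\<^esub>A\<in>S. (?a A \<otimes>\<^bsub>CL p\<^esub> ?dx A) \<otimes>\<^bsub>CL p\<^esub> ?w)"
        unfolding Y_def by (rule CL.finsum_addf) (use clA cl in auto)
      also have "\<dots> = ?w \<otimes>\<^bsub>CL p\<^esub> (\<Oplus>\<^bsub>CL p\<^esub>A\<in>S. ?a A \<otimes>\<^bsub>CL p\<^esub> ?dx A) \<oplus>\<^bsub>CL p\<^esub>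
          (\<Oplus>\<^bsub>CL p\<^esub>A\<in>S. ?a A \<otimes>\<^bsub>CL p\<^esub> ?dx A) \<otimes>\<^bsub>CL p\<^esub> ?w"
        using clA cl by (subst CL.finsum_ldistr CL.finsum_rdistr; auto)+
      finally show ?thesis
        by (simp add: H_op_def dirac_def)
    qed
    have "op_commutator \<A> g (dirac \<A> g n e nab) (H_op \<A> g \<omega>) s p =
        ?c \<odot>\<^bsub>CL p\<^esub> (\<Oplus>\<^bsub>CL p\<^esub>A\<in>S. ?a A \<otimes>\<^bsub>CL p\<^esub> X A) \<ominus>\<^bsub>CL p\<^esub> ?c \<odot>\<^bsub>CL p\<^esub> (\<Oplus>\<^bsub>CL p\<^esub>A\<in>S. Y A)"
      unfolding op_commutator_def 1 2 ..
    also have "\<dots> = ?c \<odot>\<^bsub>CL p\<^esub>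
        ((\<Oplus>\<^bsub>CL p\<^esub>A\<in>S. ?a A \<otimes>\<^bsub>CL p\<^esub> X A) \<ominus>\<^bsub>CL p\<^esub> (\<Oplus>\<^bsub>CL p\<^esub>A\<in>S. Y A))"
      by (rule CL.smult_diff[symmetric]) (use clA X Y in \<open>auto intro!: CL.finsum_closed\<close>)
    also have "(\<Oplus>\<^bsub>CL p\<^esub>A\<in>S. ?a A \<otimes>\<^bsub>CL p\<^esub> X A) \<ominus>\<^bsub>CL p\<^esub> (\<Oplus>\<^bsub>CL p\<^esub>A\<in>S. Y A) =
        (\<Oplus>\<^bsub>CL p\<^esub>A\<in>S. ?a A \<otimes>\<^bsub>CL p\<^esub> X A \<ominus>\<^bsub>CL p\<^esub> Y A)"
      by (rule CL.finsum_diff[symmetric]) (use clA X Y in auto)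
    also have "\<dots> = (\<Oplus>\<^bsub>CL p\<^esub>A\<in>S. K A \<oplus>\<^bsub>CL p\<^esub> K A)"
      by (intro CL.finsum_cong' refl XY) (use K in auto)
    also have "\<dots> = 2 \<odot>\<^bsub>CL p\<^esub> \<kappa>"
      unfolding CL.two_smult[OF \<kappa>] unfolding \<kappa>_def by (rule CL.finsum_addf) (use K in auto)
    also have "?c \<odot>\<^bsub>CL p\<^esub> (2 \<odot>\<^bsub>CL p\<^esub> \<kappa>) = (- \<i>) \<odot>\<^bsub>CL p\<^esub> \<kappa>"
      using \<kappa> by (simp add: CL.smult_smult)
    finally show ?thesis .
  qed

  have conjugate: "conjugate_op \<A> g Ja (dirac \<A> g n e nab) s p =
      (\<Oplus>\<^bsub>CL p\<^esub>A\<in>S. \<ominus>\<^bsub>CL p\<^esub> (?b A \<otimes>\<^bsub>CL p\<^esub> ?dx A) \<oplus>\<^bsub>CL p\<^esub> ?a A \<otimes>\<^bsub>CL p\<^esub> ?k A)"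
  proof -
    \<comment> \<open>The derivative of \<open>Ja\<close> along \<open>v\<close>, pulled back by
      \<open>Ja\<close> and applied to \<open>s\<close>. It is odd in \<open>v\<close>, as
      \<open>frame_reindex\<close> requires. Only this part is reindexed; the plain derivative of
      \<open>s\<close> stays with \<open>J p (e p A)\<close>.\<close>
    let ?\<Phi> = "\<lambda>v. Ji p (?y v) \<ominus>\<^bsub>CL p\<^esub> nab p v s"
    have \<Phi>: "?\<Phi> v \<in> carrier (CL p)" if "v \<in> T p" for v
      using y[OF that] by (simp add: Ji_closed)
    have "conjugate_op \<A> g Ja (dirac \<A> g n e nab) s p =
        Ji p (\<Oplus>\<^bsub>CL p\<^esub>A\<in>S. ?a A \<otimes>\<^bsub>CL p\<^esub> ?y (e p A))"
      by (simp add: conjugate_op_def dirac_def)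
    also have "\<dots> = (\<Oplus>\<^bsub>CL p\<^esub>A\<in>S. Ji p (?a A \<otimes>\<^bsub>CL p\<^esub> ?y (e p A)))"
      by (rule Ji_finsum) (use clA y eT in auto)
    also have "\<dots> = (\<Oplus>\<^bsub>CL p\<^esub>A\<in>S. \<ominus>\<^bsub>CL p\<^esub> (?b A \<otimes>\<^bsub>CL p\<^esub> ?dx A) \<oplus>\<^bsub>CL p\<^esub>
        \<ominus>\<^bsub>CL p\<^esub> (?b A \<otimes>\<^bsub>CL p\<^esub> ?\<Phi> (e p A)))"
    proof (rule CL.finsum_cong')
      fix A assume A: "A \<in> S"
      have "Ji p (?a A \<otimes>\<^bsub>CL p\<^esub> ?y (e p A)) = \<ominus>\<^bsub>CL p\<^esub> ?b A \<otimes>\<^bsub>CL p\<^esub> Ji p (?y (e p A))"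
        using clA[OF A] y eT[OF A] by (simp add: Ji_mult Ji_cv)
      also have "\<dots> = \<ominus>\<^bsub>CL p\<^esub> (?b A \<otimes>\<^bsub>CL p\<^esub> ?dx A) \<oplus>\<^bsub>CL p\<^esub> \<ominus>\<^bsub>CL p\<^esub> (?b A \<otimes>\<^bsub>CL p\<^esub> ?\<Phi> (e p A))"
        by (rule CL.reindexed_term[symmetric]) (use clA[OF A] in auto)
      finally show "Ji p (?a A \<otimes>\<^bsub>CL p\<^esub> ?y (e p A)) =
        \<ominus>\<^bsub>CL p\<^esub> (?b A \<otimes>\<^bsub>CL p\<^esub> ?dx A) \<oplus>\<^bsub>CL p\<^esub> \<ominus>\<^bsub>CL p\<^esub> (?b A \<otimes>\<^bsub>CL p\<^esub> ?\<Phi> (e p A))" .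
    qed (use clA \<Phi> eT in auto)
    also have "\<dots> = (\<Oplus>\<^bsub>CL p\<^esub>A\<in>S. \<ominus>\<^bsub>CL p\<^esub> (?b A \<otimes>\<^bsub>CL p\<^esub> ?dx A)) \<oplus>\<^bsub>CL p\<^esub>
        (\<Oplus>\<^bsub>CL p\<^esub>A\<in>S. \<ominus>\<^bsub>CL p\<^esub> (?b A \<otimes>\<^bsub>CL p\<^esub> ?\<Phi> (e p A)))"
      by (rule CL.finsum_addf) (use clA \<Phi> eT in auto)
    also have "(\<Oplus>\<^bsub>CL p\<^esub>A\<in>S. \<ominus>\<^bsub>CL p\<^esub> (?b A \<otimes>\<^bsub>CL p\<^esub> ?\<Phi> (e p A))) =
        (\<Oplus>\<^bsub>CL p\<^esub>A\<in>S. ?a A \<otimes>\<^bsub>CL p\<^esub> ?\<Phi> (J p (e p A)))"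
    proof (rule frame_reindex[symmetric])
      fix v assume v: "v \<in> T p"
      show "?\<Phi> v \<in> carrier (CL p)" by (rule \<Phi>[OF v])
      show "?\<Phi> (- v) = \<ominus>\<^bsub>CL p\<^esub> ?\<Phi> v"
        using y[OF v] v by (simp add: nab_neg s sJ Ji_neg Ji_closed a_minus_def CL.minus_add)
    qed
    also have "\<dots> = (\<Oplus>\<^bsub>CL p\<^esub>A\<in>S. ?a A \<otimes>\<^bsub>CL p\<^esub> ?k A)"
      by (rule CL.finsum_cong') (use clA k eT in auto)
    also have "(\<Oplus>\<^bsub>CL p\<^esub>A\<in>S. \<ominus>\<^bsub>CL p\<^esub> (?b A \<otimes>\<^bsub>CL p\<^esub> ?dx A)) \<oplus>\<^bsub>CL p\<^esub> \<dots> =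
        (\<Oplus>\<^bsub>CL p\<^esub>A\<in>S. \<ominus>\<^bsub>CL p\<^esub> (?b A \<otimes>\<^bsub>CL p\<^esub> ?dx A) \<oplus>\<^bsub>CL p\<^esub> ?a A \<otimes>\<^bsub>CL p\<^esub> ?k A)"
      by (rule CL.finsum_addf[symmetric]) (use clA in auto)
    finally show ?thesis .
  qed

  have sigma: "dirac_sigma \<A> g J n e nab Jd Ja s p = (\<Oplus>\<^bsub>CL p\<^esub>A\<in>S. ?a A \<otimes>\<^bsub>CL p\<^esub> (?d A \<oplus>\<^bsub>CL p\<^esub> ?k A))"
    by (simp add: dirac_sigma_def sigma_def)

  have left_mult: "clifford_left_mult \<A> g (dirac \<A> g n e nab \<omega>) s p =
      (\<Oplus>\<^bsub>CL p\<^esub>A\<in>S. ?a A \<otimes>\<^bsub>CL p\<^esub> (?dw A \<otimes>\<^bsub>CL p\<^esub> ?x))"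
  proof -
    have "clifford_left_mult \<A> g (dirac \<A> g n e nab \<omega>) s p =
        (\<Oplus>\<^bsub>CL p\<^esub>A\<in>S. ?a A \<otimes>\<^bsub>CL p\<^esub> ?dw A \<otimes>\<^bsub>CL p\<^esub> ?x)"
      unfolding clifford_left_mult_def dirac_def by (rule CL.finsum_ldistr) (use clA cl in auto)
    also have "\<dots> = (\<Oplus>\<^bsub>CL p\<^esub>A\<in>S. ?a A \<otimes>\<^bsub>CL p\<^esub> (?dw A \<otimes>\<^bsub>CL p\<^esub> ?x))"
      by (rule CL.finsum_cong') (use clA cl in \<open>auto simp: CL.m_assoc\<close>)
    finally show ?thesis .
  qed

  \<comment> \<open>The three sums enter as opaque \<open>P\<close>, \<open>Q\<close>,
    \<open>R\<close>, for which the scalar laws are easy to apply. Term by term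
    \<open>\<kappa> = P - Q + R\<close>, and multiplication by \<open>- \<i>\<close> produces the
    signs of the identity.\<close>
  have combination: "(- \<i>) \<odot>\<^bsub>CL p\<^esub> \<kappa> = ((- \<i>) \<odot>\<^bsub>CL p\<^esub> P) \<oplus>\<^bsub>CL p\<^esub> (\<i> \<odot>\<^bsub>CL p\<^esub> Q) \<ominus>\<^bsub>CL p\<^esub> (\<i> \<odot>\<^bsub>CL p\<^esub> R)"
    if P: "P = (\<Oplus>\<^bsub>CL p\<^esub>A\<in>S. \<ominus>\<^bsub>CL p\<^esub> (?b A \<otimes>\<^bsub>CL p\<^esub> ?dx A) \<oplus>\<^bsub>CL p\<^esub> ?a A \<otimes>\<^bsub>CL p\<^esub> ?k A)"
      and Q: "Q = (\<Oplus>\<^bsub>CL p\<^esub>A\<in>S. ?a A \<otimes>\<^bsub>CL p\<^esub> (?d A \<oplus>\<^bsub>CL p\<^esub> ?k A))"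
      and R: "R = (\<Oplus>\<^bsub>CL p\<^esub>A\<in>S. ?a A \<otimes>\<^bsub>CL p\<^esub> (?dw A \<otimes>\<^bsub>CL p\<^esub> ?x))" for P Q R
  proof -
    have PQR: "P \<in> carrier (CL p)" "Q \<in> carrier (CL p)" "R \<in> carrier (CL p)"
      unfolding P Q R using clA cl by (auto intro!: CL.finsum_closed)
    have "\<kappa> = (\<Oplus>\<^bsub>CL p\<^esub>A\<in>S. (\<ominus>\<^bsub>CL p\<^esub> (?b A \<otimes>\<^bsub>CL p\<^esub> ?dx A) \<oplus>\<^bsub>CL p\<^esub> ?a A \<otimes>\<^bsub>CL p\<^esub> ?k A)
        \<ominus>\<^bsub>CL p\<^esub> ?a A \<otimes>\<^bsub>CL p\<^esub> (?d A \<oplus>\<^bsub>CL p\<^esub> ?k A) \<oplus>\<^bsub>CL p\<^esub> ?a A \<otimes>\<^bsub>CL p\<^esub> (?dw A \<otimes>\<^bsub>CL p\<^esub> ?x))"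
      unfolding \<kappa>_def K_def
      by (intro CL.finsum_cong' refl CL.dirac_conjugate_term[symmetric]) (use clA cl in auto)
    also have "\<dots> = (\<Oplus>\<^bsub>CL p\<^esub>A\<in>S. (\<ominus>\<^bsub>CL p\<^esub> (?b A \<otimes>\<^bsub>CL p\<^esub> ?dx A) \<oplus>\<^bsub>CL p\<^esub> ?a A \<otimes>\<^bsub>CL p\<^esub> ?k A)
        \<ominus>\<^bsub>CL p\<^esub> ?a A \<otimes>\<^bsub>CL p\<^esub> (?d A \<oplus>\<^bsub>CL p\<^esub> ?k A)) \<oplus>\<^bsub>CL p\<^esub> R"
      unfolding R by (rule CL.finsum_addf) (use clA cl in auto)
    also have "\<dots> = (P \<ominus>\<^bsub>CL p\<^esub> Q) \<oplus>\<^bsub>CL p\<^esub> R"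
      unfolding P Q by (subst CL.finsum_diff) (use clA in auto)
    finally have "(- \<i>) \<odot>\<^bsub>CL p\<^esub> \<kappa> = (- \<i>) \<odot>\<^bsub>CL p\<^esub> ((P \<ominus>\<^bsub>CL p\<^esub> Q) \<oplus>\<^bsub>CL p\<^esub> R)"
      by (rule arg_cong)
    then show ?thesis
      using PQR by (simp add: CL.smult_add CL.smult_neg CL.neg_smult a_minus_def)
  qed

  show ?thesis
    unfolding commutator by (rule combination[OF conjugate sigma left_mult])
qed

end

theorem theorem1:
  fixes \<A> :: "('m::{t2_space,second_countable_topology}, 'e::euclidean_space) chart set"
    and n :: nat
    and g :: "'m \<Rightarrow> ('m, 'e) tvec \<Rightarrow> ('m, 'e) tvec \<Rightarrow> real"
    and J :: "'m \<Rightarrow> ('m, 'e) tvec \<Rightarrow> ('m, 'e) tvec"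
    and nabT :: "'m \<Rightarrow> ('m, 'e) tvec \<Rightarrow> ('m \<Rightarrow> ('m, 'e) tvec) \<Rightarrow> ('m, 'e) tvec"
    and nab :: "'m \<Rightarrow> ('m, 'e) tvec \<Rightarrow> ('m \<Rightarrow> ('m, 'e) cliff) \<Rightarrow> ('m, 'e) cliff"
    and Jd Ja :: "'m \<Rightarrow> ('m, 'e) cliff \<Rightarrow> ('m, 'e) cliff"
    and e :: "'m \<Rightarrow> nat \<Rightarrow> ('m, 'e) tvec"
    and s :: "'m \<Rightarrow> ('m, 'e) cliff"
    and p :: 'm
  assumes "smooth_atlas \<A>" and "DIM('e) = 2 * n"
    and "riemannian_metric \<A> g"
    and "almost_complex_structure \<A> J"
    and "compatible_metric \<A> g J"
    and "levi_civita_connection \<A> g nabT"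
    and "clifford_connection \<A> g nabT nab"
    and "derivation_extension \<A> g J Jd"
    and "algebra_extension \<A> g J Ja"
    and "\<And>q. adapted_basis \<A> g J n q (e q)"
    and "smooth_section \<A> g s"
  defines "\<omega> \<equiv> fundamental_element \<A> g n e"
    and "D \<equiv> dirac \<A> g n e nab"
    and "D\<sigma> \<equiv> dirac_sigma \<A> g J n e nab Jd Ja"
  defines "\<H> \<equiv> H_op \<A> g \<omega>"
    and "Dc \<equiv> conjugate_op \<A> g Ja D"
  shows "op_commutator \<A> g D \<H> s p =
    ((- \<i>) \<odot>\<^bsub>Cl \<A> g p\<^esub> Dc s p) \<oplus>\<^bsub>Cl \<A> g p\<^esub> (\<i> \<odot>\<^bsub>Cl \<A> g p\<^esub> D\<sigma> s p)
      \<ominus>\<^bsub>Cl \<A> g p\<^esub> (\<i> \<odot>\<^bsub>Cl \<A> g p\<^esub> clifford_left_mult \<A> g (D \<omega>) s p)"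
proof -
  interpret hermitian_clifford \<A> g J n e nabT nab Jd Ja
    by unfold_locales (fact assms)+
  show ?thesis
    unfolding \<omega>_def D_def D\<sigma>_def \<H>_def Dc_def
    by (rule dirac_commutator) fact
qed

end
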